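(* Let $\mu\subseteq\lambda$ be partitions and $\mathbf{z}=(z_1,\dots,z_r)$. The metaplectic symmetric function is a specialization of the super ribbon (LLT) function: $$\mathcal{M}^n_{\lambda/\mu}(\mathbf{z}):=\langle\mu|T_\Delta(z_1)\cdots T_\Delta(z_r)|\lambda\rangle=\mathcal{G}^n_{\lambda/\mu}(\mathbf{z}^n|v\mathbf{z}^n;q),$$ where $\mathbf{z}^n=(z_1^n,\dots,z_r^n)$ and $v\mathbf{z}^n=(vz_1^n,\dots,vz_r^n)$. Moreover $\mathcal{M}^n_{\lambda/\mu}$ vanishes unless $\lambda$ and $\mu$ have the same $n$-core.
   Context: Fix an integer $n\ge1$ and $q\in\mathbb{C}^\times$ not a root of unity; put $v=q^2$, $\sqrt v=q$, and let $g:\mathbb{Z}/n\mathbb{Z}\to\mathbb{C}$ be $g(0)=-v$, $g(a)=-\sqrt v=-q$ for $a\not\equiv0$ (the case without Drinfeld twisting). Row transfer matrix of Delta ice. Let $\mathfrak{F}_0$ be the vector space with basis $|\lambda\rangle$ indexed by partitions $\lambda$; to $|\lambda\rangle$ associate the set of integers $\{\lambda_1,\lambda_2-1,\lambda_3-2,\dots\}$ (in the quantum Fock space $|\lambda\rangle=u_{\lambda_1}\wedge u_{\lambda_2-1}\wedge\cdots$). Consider one row of vertices, one in each column, columns labeled by all integers in decreasing order from left to right; the right edge of a vertex is the left edge of the next. Vertical edges carry spins $\pm$; horizontal edges carry decorated spins $\pm^a$, $a\in\mathbb{Z}/n\mathbb{Z}$. The top (resp. bottom) edges are $-$ exactly in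 the columns of the set of $|\lambda\rangle$ (resp. $|\mu\rangle$). A state assigns decorated spins to horizontal edges with all but finitely many equal to $+^0$; it is admissible if every vertex has one of the following configurations (left, top, right, bottom), with weight: $(+^0,+,+^0,+)$: $1$; $(-^a,-,-^{a+1},-)$: $g(a)z$; $(+^0,-,+^0,-)$: $1$; $(-^a,+,-^{a+1},+)$: $z$; $(-^0,+,+^0,-)$: $(1-v)z$; $(+^0,-,-^1,+)$: $1$. $\langle\mu|T_\Delta(z)|\lambda\rangle$ is the sum over admissible states of the product of vertex weights, and $T_\Delta(z)|\lambda\rangle=\sum_\mu\langle\mu|T_\Delta(z)|\lambda\rangle\,|\mu\rangle$ (a finite sum). Ribbons (English convention). An $n$-ribbon is a connected skew shape with $n$ boxes containing no $2\times2$ block; its spin is its height (number of rows it occupies) minus $1$. A horizontal $n$-ribbon strip is a skew shape $\lambda/\mu$ that can be decomposed into disjoint $n$-ribbons, each of whose top-right-most box either is adjacent to $\mu$ (directly below a box of $\mu$) or lies in the first row. Vertical $n$-ribbon strips are defined similarly: a skew shape whose conjugate is a horizontal $n$-ribbon strip, decomposed into $n$-ribbons by conjugating. The spin of a strip is the sum of the spins of the ribbons in its decomposition. The $n$-core of $\lambda$ is the unique smallest partition obtainable from $\lambda$ by successively removing $n$-ribbons. A super ribbon tableau $T$ of shape $\lambda/\mu$ is a chain $\mu=\lambda_{r+1}\subset\lambda_{r'}\subset\lambda_r\subset\cdots\subset\lambda_{1'}\subset\lambda_1=\lambda$ (inclusions not necessarily strict) with each $\lambda_i/\lambda_{i'}$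 a horizontal and each $\lambda_{i'}/\lambda_{i+1}$ a vertical $n$-ribbon strip. $s(T)$ is the sum of the spins of all these strips; $\mathrm{wt}(T)=(\nu_i)$, $\mathrm{wt}'(T)=(\nu_i')$ with $\nu_i=|\lambda_i/\lambda_{i'}|/n$, $\nu'_i=|\lambda_{i'}/\lambda_{i+1}|/n$. The super ribbon function is $\mathcal{G}^n_{\lambda/\mu}(\mathbf{z}|\mathbf{w};q)=\sum_Tq^{s(T)}\mathbf{z}^{\mathrm{wt}(T)}(-\mathbf{w})^{\mathrm{wt}'(T)}$, the sum over super ribbon tableaux of shape $\lambda/\mu$.
   Formalization: The super ribbon function is evaluated at spin variable −q instead of q; with g(a) = −q the printed identity fails by a sign, e.g. n = 2, λ = (1,1), μ = ∅, r = 1, where the left side is −q(1−v)z² and the right side is q(1−v)z². *)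

theory Defs
  imports Complex_Main "HOL-Library.Groups_Big_Fun" "HOL-Library.Poly_Mapping"
begin

section \<open>Partitions and skew shapes\<close>

text \<open>Parts are indexed from 0: \<open>part lam i\<close> is the (i+1)-st part of \<open>lam\<close>.\<close>

typedef partition = "{p :: nat \<Rightarrow> nat. antimono p \<and> finite {i. p i \<noteq> 0}}"
  morphisms part Abs_partition
  by (rule exI [of _ "\<lambda>_. 0"]) (simp add: antimono_def)

setup_lifting type_definition_partition

text \<open>A box is a pair (row, column), both counted from 0; rows go downwards (English convention).\<close>

type_synonym box = "nat \<times> nat"

definition diagram :: "partition \<Rightarrow> box set" where
  "diagram lam = {(i, j). j < part lam i}"

lift_definition conjugate :: "partition \<Rightarrow> partition" is "\<lambda>p j. card {i. j < p i}"
proof -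
  fix p :: "nat \<Rightarrow> nat"
  assume p: "antimono p \<and> finite {i. p i \<noteq> 0}"
  have fin: "finite {i. j < p i}" for j
    by (rule finite_subset [of _ "{i. p i \<noteq> 0}"]) (use p in auto)
  have le: "p i \<le> p 0" for i
    using p by (simp add: antimono_def)
  have "{j. card {i. j < p i} \<noteq> 0} \<subseteq> {..p 0}"
  proof
    fix j
    assume "j \<in> {j. card {i. j < p i} \<noteq> 0}"
    then obtain i where "j < p i"
      by (auto simp: card_eq_0_iff)
    with le [of i] show "j \<in> {..p 0}"
      by simp
  qed
  then have "finite {j. card {i. j < p i} \<noteq> 0}"
    by (rule finite_subset) simp
  moreover have "antimono (\<lambda>j. card {i. j < p i})"
    by (intro antimonoI card_mono fin) auto
  ultimately show "antimono (\<lambda>j. card {i. j < p i}) \<and> finite {j. card {i. j < p i} \<noteq> 0}"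
    by blast
qed

lemma diagram_conjugate: "diagram (conjugate lam) = prod.swap ` diagram lam"
proof -
  have "j < card {i'. i < part lam i'} \<longleftrightarrow> i < part lam j" for i j
  proof -
    have anti: "antimono (part lam)" and fin: "finite {i. part lam i \<noteq> 0}"
      using part [of lam] by auto
    have fin': "finite {i'. i < part lam i'}"
      by (rule finite_subset [OF _ fin]) auto
    show ?thesis
    proof
      assume "i < part lam j"
      then have "{..j} \<subseteq> {i'. i < part lam i'}"
        using anti by (auto simp: antimono_def dest: less_le_trans)
      from card_mono [OF fin' this] show "j < card {i'. i < part lam i'}"
        by simp
    next
      assume *: "j < card {i'. i < part lam i'}"
      show "i < part lam j"
      proof (rule ccontr)
        assume neg: "\<not> i < part lam j"
        have "{i'. i < part lam i'} \<subseteq> {..<j}"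
        proof (intro subsetI, rule ccontr)
          fix k
          assume "k \<in> {i'. i < part lam i'}" "k \<notin> {..<j}"
          then have "i < part lam k" "part lam k \<le> part lam j"
            using anti by (auto simp: antimono_def)
          with neg show False
            by simp
        qed
        from card_mono [OF _ this] * show False
          by simp
      qed
    qed
  qed
  then show ?thesis
    by (auto simp: diagram_def conjugate.rep_eq image_iff)
qed

definition skew_shape :: "box set \<Rightarrow> bool" where
  "skew_shape S \<longleftrightarrow> (\<exists>lam mu. diagram mu \<subseteq> diagram lam \<and> S = diagram lam - diagram mu)"


section \<open>Ribbons and ribbon strips\<close>

definition adjacent_boxes :: "box \<Rightarrow> box \<Rightarrow> bool" where
  "adjacent_boxes b c \<longleftrightarrow>
     (fst b = fst c \<and> (snd b = Suc (snd c) \<or> snd c = Suc (snd b))) \<or>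
     (snd b = snd c \<and> (fst b = Suc (fst c) \<or> fst c = Suc (fst b)))"

definition connected_boxes :: "box set \<Rightarrow> bool" where
  "connected_boxes S \<longleftrightarrow>
     (\<forall>b\<in>S. \<forall>c\<in>S. (b, c) \<in> {(x, y). x \<in> S \<and> y \<in> S \<and> adjacent_boxes x y}\<^sup>*)"

definition ribbon :: "nat \<Rightarrow> box set \<Rightarrow> bool" where
  "ribbon n R \<longleftrightarrow> skew_shape R \<and> connected_boxes R \<and> card R = n \<and>
     (\<nexists>i j. {(i, j), (i, Suc j), (Suc i, j), (Suc i, Suc j)} \<subseteq> R)"

definition ribbon_spin :: "box set \<Rightarrow> nat" where
  "ribbon_spin R = card (fst ` R) - 1"

text \<open>A ribbon runs from its lower left end to its upper right end, so the box in its topmost row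
  and rightmost column belongs to it.\<close>

definition top_right_box :: "box set \<Rightarrow> box" where
  "top_right_box R = (Min (fst ` R), Max (snd ` R))"

definition horizontal_decomposition ::
    "nat \<Rightarrow> partition \<Rightarrow> partition \<Rightarrow> box set set \<Rightarrow> bool" where
  "horizontal_decomposition n lam mu D \<longleftrightarrow>
     diagram mu \<subseteq> diagram lam \<and> \<Union>D = diagram lam - diagram mu \<and> pairwise disjnt D \<and>
     (\<forall>R\<in>D. ribbon n R \<and>
        (case top_right_box R of (i, j) \<Rightarrow> i = 0 \<or> (i - 1, j) \<in> diagram mu))"

definition vertical_decomposition ::
    "nat \<Rightarrow> partition \<Rightarrow> partition \<Rightarrow> box set set \<Rightarrow> bool" where
  "vertical_decomposition n lam mu D \<longleftrightarrow>
     horizontal_decomposition n (conjugate lam) (conjugate mu) ((`) prod.swap ` D)"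

definition horizontal_strip :: "nat \<Rightarrow> partition \<Rightarrow> partition \<Rightarrow> bool" where
  "horizontal_strip n lam mu \<longleftrightarrow> (\<exists>D. horizontal_decomposition n lam mu D)"

definition vertical_strip :: "nat \<Rightarrow> partition \<Rightarrow> partition \<Rightarrow> bool" where
  "vertical_strip n lam mu \<longleftrightarrow> (\<exists>D. vertical_decomposition n lam mu D)"

text \<open>The decomposition of a strip into ribbons is unique. Also for a vertical strip the spin counts
  the rows of the ribbons of the strip itself, not of its conjugate.\<close>

definition horizontal_spin :: "nat \<Rightarrow> partition \<Rightarrow> partition \<Rightarrow> nat" where
  "horizontal_spin n lam mu = (\<Sum>R\<in>(THE D. horizontal_decomposition n lam mu D). ribbon_spin R)"

definition vertical_spin :: "nat \<Rightarrow> partition \<Rightarrow> partition \<Rightarrow> nat" where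
  "vertical_spin n lam mu = (\<Sum>R\<in>(THE D. vertical_decomposition n lam mu D). ribbon_spin R)"

definition remove_ribbon :: "nat \<Rightarrow> partition \<Rightarrow> partition \<Rightarrow> bool" where
  "remove_ribbon n lam mu \<longleftrightarrow> diagram mu \<subseteq> diagram lam \<and> ribbon n (diagram lam - diagram mu)"

definition n_core :: "nat \<Rightarrow> partition \<Rightarrow> partition" where
  "n_core n lam = (THE \<rho>. (remove_ribbon n)\<^sup>*\<^sup>* lam \<rho> \<and>
                        (\<forall>\<kappa>. (remove_ribbon n)\<^sup>*\<^sup>* lam \<kappa> \<longrightarrow> diagram \<rho> \<subseteq> diagram \<kappa>))"


section \<open>Super ribbon functions\<close>

text \<open>A tableau is the list of its partitions from the outermost to the innermost: entry \<open>2 * i\<close>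
  is \<open>lam\<close> with index i+1, and entry \<open>2 * i + 1\<close> is \<open>lam\<close> with primed index (i+1)'.\<close>

definition super_ribbon_tableaux ::
    "nat \<Rightarrow> nat \<Rightarrow> partition \<Rightarrow> partition \<Rightarrow> partition list set" where
  "super_ribbon_tableaux n r lam mu =
     {T. length T = 2 * r + 1 \<and> T ! 0 = lam \<and> T ! (2 * r) = mu \<and>
         (\<forall>i<r. horizontal_strip n (T ! (2 * i)) (T ! (2 * i + 1)) \<and>
                vertical_strip n (T ! (2 * i + 1)) (T ! (2 * i + 2)))}"

definition tableau_spin :: "nat \<Rightarrow> nat \<Rightarrow> partition list \<Rightarrow> nat" where
  "tableau_spin n r T =
     (\<Sum>i<r. horizontal_spin n (T ! (2 * i)) (T ! (2 * i + 1)) +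
             vertical_spin n (T ! (2 * i + 1)) (T ! (2 * i + 2)))"

definition tableau_wt :: "nat \<Rightarrow> partition list \<Rightarrow> nat \<Rightarrow> nat" where
  "tableau_wt n T i = card (diagram (T ! (2 * i)) - diagram (T ! (2 * i + 1))) div n"

definition tableau_wt' :: "nat \<Rightarrow> partition list \<Rightarrow> nat \<Rightarrow> nat" where
  "tableau_wt' n T i = card (diagram (T ! (2 * i + 1)) - diagram (T ! (2 * i + 2))) div n"

text \<open>The lists \<open>zs\<close> and \<open>ws\<close> of variables have the same length r; \<open>t\<close> is the spin variable.\<close>

definition super_ribbon_function ::
    "nat \<Rightarrow> partition \<Rightarrow> partition \<Rightarrow> complex list \<Rightarrow> complex list \<Rightarrow> complex \<Rightarrow> complex" where
  "super_ribbon_function n lam mu zs ws t =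
     (\<Sum>T\<in>super_ribbon_tableaux n (length zs) lam mu.
        t ^ tableau_spin n (length zs) T *
        (\<Prod>i<length zs. (zs ! i) ^ tableau_wt n T i) *
        (\<Prod>i<length zs. (- (ws ! i)) ^ tableau_wt' n T i))"


section \<open>Delta ice\<close>

datatype spin = Plus | Minus

text \<open>Decorations are represented by their residues in \<open>{0..<n}\<close>.\<close>

type_synonym decorated_spin = "spin \<times> nat"

definition gauss :: "complex \<Rightarrow> nat \<Rightarrow> complex" where
  "gauss q a = (if a = 0 then - (q ^ 2) else - q)"

text \<open>\<open>delta_weight n q z\<close> takes the left, top, right and bottom spins, and is \<open>None\<close> on the
  configurations that are not admissible; \<open>v\<close> is \<open>q ^ 2\<close>.\<close>

fun delta_weight ::
    "nat \<Rightarrow> complex \<Rightarrow> complex \<Rightarrow> decorated_spin \<Rightarrow> spin \<Rightarrow> decorated_spin \<Rightarrow> spin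
      \<Rightarrow> complex option" where
  "delta_weight n q z (Plus, a) Plus (Plus, b) Plus =
     (if a = 0 \<and> b = 0 then Some 1 else None)"
| "delta_weight n q z (Minus, a) Minus (Minus, b) Minus =
     (if b = Suc a mod n then Some (gauss q a * z) else None)"
| "delta_weight n q z (Plus, a) Minus (Plus, b) Minus =
     (if a = 0 \<and> b = 0 then Some 1 else None)"
| "delta_weight n q z (Minus, a) Plus (Minus, b) Plus =
     (if b = Suc a mod n then Some z else None)"
| "delta_weight n q z (Minus, a) Plus (Plus, b) Minus =
     (if a = 0 \<and> b = 0 then Some ((1 - q ^ 2) * z) else None)"
| "delta_weight n q z (Plus, a) Minus (Minus, b) Plus =
     (if a = 0 \<and> b = 1 mod n then Some 1 else None)"
| "delta_weight n q z _ _ _ _ = None"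

definition columns :: "partition \<Rightarrow> int set" where
  "columns lam = range (\<lambda>i. int (part lam i) - int i)"

definition column_spin :: "partition \<Rightarrow> int \<Rightarrow> spin" where
  "column_spin lam c = (if c \<in> columns lam then Minus else Plus)"

text \<open>In a state \<open>\<sigma>\<close>, \<open>\<sigma> c\<close> is the edge to the left of column \<open>c\<close>; the columns decrease from left
  to right, so the edge to its right is \<open>\<sigma> (c - 1)\<close>.\<close>

definition vertex_weight ::
    "nat \<Rightarrow> complex \<Rightarrow> complex \<Rightarrow> partition \<Rightarrow> partition \<Rightarrow> (int \<Rightarrow> decorated_spin) \<Rightarrow> int
      \<Rightarrow> complex option" where
  "vertex_weight n q z lam mu \<sigma> c =
     delta_weight n q z (\<sigma> c) (column_spin lam c) (\<sigma> (c - 1)) (column_spin mu c)"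

definition admissible_states ::
    "nat \<Rightarrow> complex \<Rightarrow> complex \<Rightarrow> partition \<Rightarrow> partition \<Rightarrow> (int \<Rightarrow> decorated_spin) set" where
  "admissible_states n q z lam mu =
     {\<sigma>. (\<forall>c. snd (\<sigma> c) < n) \<and> finite {c. \<sigma> c \<noteq> (Plus, 0)} \<and>
          (\<forall>c. vertex_weight n q z lam mu \<sigma> c \<noteq> None)}"

text \<open>All but finitely many vertices of an admissible state have weight 1, so the product over all
  columns is a finite one. \<open>delta_entry n q z mu lam\<close> has bottom \<open>mu\<close> and top \<open>lam\<close>.\<close>

definition delta_entry ::
    "nat \<Rightarrow> complex \<Rightarrow> complex \<Rightarrow> partition \<Rightarrow> partition \<Rightarrow> complex" where
  "delta_entry n q z mu lam =
     (\<Sum>\<sigma>\<in>admissible_states n q z lam mu.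
        Prod_any (\<lambda>c. the (vertex_weight n q z lam mu \<sigma> c)))"

type_synonym fock = "partition \<Rightarrow>\<^sub>0 complex"

definition ket :: "partition \<Rightarrow> fock" where
  "ket lam = Poly_Mapping.single lam 1"

text \<open>The linear extension of \<open>|lam> \<mapsto> \<Sum>mu. delta_entry n q z mu lam |mu>\<close>.\<close>

definition delta_transfer :: "nat \<Rightarrow> complex \<Rightarrow> complex \<Rightarrow> fock \<Rightarrow> fock" where
  "delta_transfer n q z x =
     (\<Sum>lam\<in>Poly_Mapping.keys x.
        Sum_any (\<lambda>mu. Poly_Mapping.single mu
                        (Poly_Mapping.lookup x lam * delta_entry n q z mu lam)))"

definition metaplectic_function ::
    "nat \<Rightarrow> complex \<Rightarrow> partition \<Rightarrow> partition \<Rightarrow> complex list \<Rightarrow> complex" where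
  "metaplectic_function n q lam mu zs =
     Poly_Mapping.lookup (foldr (delta_transfer n q) zs (ket lam)) mu"

text \<open>Sign convention: a particle that passes another one picks up a factor \<open>gauss q a = - q\<close>
  (\<open>a \<noteq> 0\<close>), whereas a ribbon of spin s contributes \<open>t ^ s\<close> to \<open>super_ribbon_function\<close>. So the spin
  variable that corresponds to this choice of \<open>gauss\<close> is \<open>t = - q\<close>. For example, with
  \<open>n = 2\<close>, \<open>lam = (1,1)\<close>, \<open>mu = ()\<close> and one variable z, the only admissible state has weight
  \<open>- q * (1 - q^2) * z^2\<close>, and the only ribbon is a vertical domino (spin 1), which is both a
  horizontal and a vertical strip: the super ribbon function at \<open>z^2, q^2 * z^2\<close> is
  \<open>t * (1 - q^2) * z^2\<close>.\<close>

end

(*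
  A row of Delta ice moves particles (columns of the partition) to the right in steps of n, along
  disjoint intervals, so a matrix entry is determined by the set F of starting points of the steps
  (the flow).  A horizontal n-ribbon strip is a set of such steps performed from left to right, a
  vertical one a set of steps performed from right to left.  A horizontal strip followed by a
  vertical one uses every step of the flow once; the type of a step is forced except for the last
  steps x of the particles, where the two choices together contribute t^k - t^2 / t^k, k being
  the number of steps that x crosses.  If two intervals overlap, then k = 1 for some x and the sum
  vanishes, otherwise it is the weight of the ice.  This identifies one row with one pair of strips.

  The transfer matrices act in the opposite order on the two sides, so it remains to show that they
  commute.  This is the train argument: two rows satisfy a Yang-Baxter relation with an R-matrix
  that mixes only the pairs of labels (a, b) and (b, a).
*)
theory Submission
  imports Defs
begin

text \<open>The orders disagree because in \<open>T(z_1) ... T(z_r) |lam>\<close> the operator of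
  \<open>z_r\<close> acts first on \<open>lam\<close>, while in a tableau \<open>z_1\<close> belongs
  to the outermost strips. Ice and strips do not match state by state: a flow with overlapping
  intervals carries no ice state but may carry many pairs of strips, so a cancellation is
  unavoidable. It comes from the last step of a particle. Made horizontally, this step brings the
  particle to rest before the k crossed steps are made; each of them then passes it, which gives
  \<open>t^k\<close>. Made vertically, it comes after all of them, so it passes k fewer particles
  than in the horizontal case, and its variable is \<open>- w = - v Z\<close> instead of
  \<open>Z\<close>; this gives \<open>- t^2 / t^k\<close>. At k = 1 the two terms cancel because
  \<open>v = t^2\<close>, and at k = 0 they give the ice weight \<open>1 - v\<close>. With
  \<open>t = - q\<close> the ice weights are \<open>g(a) = t\<close> and
  \<open>g(0) = - t^2\<close>, so that passing a particle costs the same on both sides.\<close>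

section \<open>Commuting transfer matrices\<close>

text \<open>The label 0 stands for a horizontal edge \<open>+\<^sup>0\<close>, and the label \<open>m\<close> with \<open>1 \<le> m \<le> n\<close> for \<open>-\<^sup>a\<close> with
  \<open>a = m mod n\<close>. Instead of a factor \<open>z\<close> at each nonzero label, \<open>step_weight\<close> has one factor \<open>Z = z\<^sup>n\<close> at
  the label \<open>n\<close>; the parameter \<open>t\<close> is \<open>- q\<close>.\<close>

definition step_ok :: "nat \<Rightarrow> nat \<Rightarrow> bool \<Rightarrow> bool \<Rightarrow> bool" where
  "step_ok n m s k \<longleftrightarrow> (if m = 0 then k \<longrightarrow> s else if m < n then s = k else s \<longrightarrow> k)"

definition step_next :: "nat \<Rightarrow> nat \<Rightarrow> bool \<Rightarrow> bool \<Rightarrow> nat" where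
  "step_next n m s k =
     (if m = 0 then (if s \<and> \<not> k then 1 else 0) else if m < n then Suc m else if s = k then 1 else 0)"

definition step_weight :: "nat \<Rightarrow> complex \<Rightarrow> complex \<Rightarrow> nat \<Rightarrow> bool \<Rightarrow> bool \<Rightarrow> complex" where
  "step_weight n t Z m s k =
     (if \<not> step_ok n m s k then 0
      else if m = 0 then 1
      else if m < n then (if s then t else 1)
      else Z * (if s then - t\<^sup>2 else if k then 1 - t\<^sup>2 else 1))"

text \<open>A label and the two vertical spins below and above it determine the next label, so a row
  with given boundary has at most one state and the recursion needs no sum. The window consists of
  \<open>N\<close> columns from \<open>c\<close> downwards.\<close>

fun row :: "nat \<Rightarrow> complex \<Rightarrow> complex \<Rightarrow> int set \<Rightarrow> int set \<Rightarrow> int \<Rightarrow> nat \<Rightarrow> nat \<Rightarrow> complex" where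
  "row n t Z S K c 0 m = (if m = 0 then 1 else 0)"
| "row n t Z S K c (Suc N) m =
     step_weight n t Z m (c \<in> S) (c \<in> K) * row n t Z S K (c - 1) N (step_next n m (c \<in> S) (c \<in> K))"

fun two_rows ::
    "nat \<Rightarrow> complex \<Rightarrow> complex \<Rightarrow> complex \<Rightarrow> int set \<Rightarrow> int set \<Rightarrow> int \<Rightarrow> nat \<Rightarrow> nat \<Rightarrow> nat \<Rightarrow> complex" where
  "two_rows n t Z W S U c 0 a b = (if a = 0 \<and> b = 0 then 1 else 0)"
| "two_rows n t Z W S U c (Suc N) a b =
     (\<Sum>k\<in>UNIV. step_weight n t Z a (c \<in> S) k * step_weight n t W b k (c \<in> U) *
        two_rows n t Z W S U (c - 1) N (step_next n a (c \<in> S) k) (step_next n b k (c \<in> U)))"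

lemma row_cong:
  assumes "\<And>d. d \<le> c \<Longrightarrow> c - int N < d \<Longrightarrow> (d \<in> S) = (d \<in> S')"
    and "\<And>d. d \<le> c \<Longrightarrow> c - int N < d \<Longrightarrow> (d \<in> K) = (d \<in> K')"
  shows "row n t Z S K c N m = row n t Z S' K' c N m"
  using assms
proof (induction N arbitrary: c m)
  case (Suc N)
  have "(c \<in> S) = (c \<in> S')" "(c \<in> K) = (c \<in> K')"
    using Suc.prems by auto
  moreover have "row n t Z S K (c - 1) N m' = row n t Z S' K' (c - 1) N m'" for m'
    by (rule Suc.IH) (use Suc.prems in auto)
  ultimately show ?case
    by simp
qed simp

lemma sum_Pow_insert:
  fixes f :: "'a set \<Rightarrow> 'b::comm_monoid_add"
  assumes "finite A" "x \<notin> A"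
  shows "(\<Sum>B\<in>Pow (insert x A). f B) = (\<Sum>B\<in>Pow A. f B) + (\<Sum>B\<in>Pow A. f (insert x B))"
proof -
  have "inj_on (insert x) (Pow A)"
    using assms(2) by (auto simp: inj_on_def)
  then have "(\<Sum>B\<in>insert x ` Pow A. f B) = (\<Sum>B\<in>Pow A. f (insert x B))"
    by (simp add: sum.reindex)
  moreover have "(\<Sum>B\<in>Pow A \<union> insert x ` Pow A. f B) = (\<Sum>B\<in>Pow A. f B) + (\<Sum>B\<in>insert x ` Pow A. f B)"
    by (rule sum.union_disjoint) (use assms in auto)
  ultimately show ?thesis
    by (simp add: Pow_insert)
qed

text \<open>The sum over the spins between the two rows is distributed over the columns: a set
  \<open>B\<close> either contains the first column \<open>c\<close> or not, and the rest of the
  window does not see this choice.\<close>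

lemma sum_row_row_eq_two_rows:
  "(\<Sum>B\<in>Pow {c - int N<..c}. row n t Z S B c N a * row n t W B U c N b) =
   two_rows n t Z W S U c N a b"
proof (induction N arbitrary: c a b)
  case (Suc N)
  let ?A = "{c - 1 - int N<..c - 1}"
  have int: "{c - int (Suc N)<..c} = insert c ?A"
    by auto
  have r: "row n t Z S B (c - 1) N m = row n t Z S (insert c B) (c - 1) N m"
     "row n t W B U (c - 1) N m = row n t W (insert c B) U (c - 1) N m" for B m Z W
    by (auto intro!: row_cong)
  have eq1: "(\<Sum>B\<in>Pow ?A. row n t Z S B c (Suc N) a * row n t W B U c (Suc N) b) =
     step_weight n t Z a (c \<in> S) False * step_weight n t W b False (c \<in> U) *
     two_rows n t Z W S U (c - 1) N (step_next n a (c \<in> S) False) (step_next n b False (c \<in> U))"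
  proof -
    have "c \<notin> B" if "B \<in> Pow ?A" for B
      using that by auto
    then show ?thesis
      unfolding Suc.IH [symmetric] sum_distrib_left
      by (intro sum.cong) (simp_all add: mult_ac)
  qed
  have eq2: "(\<Sum>B\<in>Pow ?A. row n t Z S (insert c B) c (Suc N) a * row n t W (insert c B) U c (Suc N) b) =
     step_weight n t Z a (c \<in> S) True * step_weight n t W b True (c \<in> U) *
     two_rows n t Z W S U (c - 1) N (step_next n a (c \<in> S) True) (step_next n b True (c \<in> U))"
    unfolding Suc.IH [symmetric] sum_distrib_left
    by (intro sum.cong) (simp_all add: mult_ac r [symmetric])
  have "c \<notin> ?A" "finite ?A"
    by auto
  then show ?case
    unfolding int by (subst sum_Pow_insert) (simp_all add: eq1 eq2 UNIV_bool del: row.simps)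
qed simp

text \<open>This says \<open>(Z - t\<^sup>2 W) g = R f\<close> for the R-matrix of the Yang-Baxter relation, where \<open>f\<close> has the
  row with parameter \<open>Z\<close> on top and \<open>g\<close> the row with parameter \<open>W\<close>.\<close>

definition intertwined ::
    "nat \<Rightarrow> complex \<Rightarrow> complex \<Rightarrow> complex \<Rightarrow> (nat \<Rightarrow> nat \<Rightarrow> complex) \<Rightarrow> (nat \<Rightarrow> nat \<Rightarrow> complex) \<Rightarrow> bool" where
  "intertwined n t Z W f g \<longleftrightarrow>
     (Z - t\<^sup>2 * W) * g 0 0 = (Z - t\<^sup>2 * W) * f 0 0 \<and>
     (\<forall>m. 0 < m \<and> m \<le> n \<longrightarrow>
        (Z - t\<^sup>2 * W) * g 0 m = (1 - t\<^sup>2) * Z * f 0 m + (Z - W) * f m 0 \<and>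
        (Z - t\<^sup>2 * W) * g m 0 = (1 - t\<^sup>2) * W * f m 0 + t\<^sup>2 * (Z - W) * f 0 m \<and>
        (Z - t\<^sup>2 * W) * g m m = (W - t\<^sup>2 * Z) * f m m) \<and>
     (\<forall>a b. 0 < a \<and> a < b \<and> b \<le> n \<longrightarrow>
        (Z - t\<^sup>2 * W) * g a b = (1 - t\<^sup>2) * Z * f a b + t * (Z - W) * f b a \<and>
        (Z - t\<^sup>2 * W) * g b a = (1 - t\<^sup>2) * W * f b a + t * (Z - W) * f a b)"

text \<open>The R-matrix is pushed through one column at a time, so the induction step is the
  Yang-Baxter equation for a single column. On the empty window only the entry (0, 0) is nonzero,
  and there the R-matrix is the scalar \<open>Z - t\<^sup>2 * W\<close> on both sides.\<close>

lemma intertwined_two_rows: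
  assumes n: "n \<ge> 1"
  shows "intertwined n t Z W (two_rows n t Z W S U c N) (two_rows n t W Z S U c N)"
proof (induction N arbitrary: c)
  case 0
  then show ?case
    by (auto simp: intertwined_def)
next
  case (Suc N)
  define f where "f = two_rows n t Z W S U (c - 1) N"
  define g where "g = two_rows n t W Z S U (c - 1) N"
  define s where "s = (c \<in> S)"
  define u where "u = (c \<in> U)"
  define D where "D = Z - t\<^sup>2 * W"
  have "intertwined n t Z W f g"
    unfolding f_def g_def by (rule Suc.IH)
  then have
    "D * g 0 0 = D * f 0 0" and
    "\<And>m. 0 < m \<Longrightarrow> m \<le> n \<Longrightarrow> D * g 0 m = (1 - t\<^sup>2) * Z * f 0 m + (Z - W) * f m 0" and
    "\<And>m. 0 < m \<Longrightarrow> m \<le> n \<Longrightarrow> D * g m 0 = (1 - t\<^sup>2) * W * f m 0 + t\<^sup>2 * (Z - W) * f 0 m" and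
    "\<And>m. 0 < m \<Longrightarrow> m \<le> n \<Longrightarrow> D * g m m = (W - t\<^sup>2 * Z) * f m m" and
    "\<And>a b. 0 < a \<Longrightarrow> a < b \<Longrightarrow> b \<le> n \<Longrightarrow> D * g a b = (1 - t\<^sup>2) * Z * f a b + t * (Z - W) * f b a" and
    "\<And>a b. 0 < a \<Longrightarrow> a < b \<Longrightarrow> b \<le> n \<Longrightarrow> D * g b a = (1 - t\<^sup>2) * W * f b a + t * (Z - W) * f a b"
    by (auto simp: intertwined_def D_def)
  \<comment> \<open>The extra factor \<open>x\<close> lets these equations rewrite \<open>g\<close>
    underneath a product of step weights, so that nothing has to be divided by \<open>D\<close>,
    which may be 0.\<close>
  then have
    i00: "\<And>x. D * (x * g 0 0) = x * ((Z - t\<^sup>2 * W) * f 0 0)" and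
    i0m: "\<And>x m. 0 < m \<Longrightarrow> m \<le> n \<Longrightarrow> D * (x * g 0 m) = x * ((1 - t\<^sup>2) * Z * f 0 m + (Z - W) * f m 0)" and
    im0: "\<And>x m. 0 < m \<Longrightarrow> m \<le> n \<Longrightarrow> D * (x * g m 0) = x * ((1 - t\<^sup>2) * W * f m 0 + t\<^sup>2 * (Z - W) * f 0 m)" and
    imm: "\<And>x m. 0 < m \<Longrightarrow> m \<le> n \<Longrightarrow> D * (x * g m m) = x * ((W - t\<^sup>2 * Z) * f m m)" and
    iab: "\<And>x a b. 0 < a \<Longrightarrow> a < b \<Longrightarrow> b \<le> n \<Longrightarrow> D * (x * g a b) = x * ((1 - t\<^sup>2) * Z * f a b + t * (Z - W) * f b a)" and
    iba: "\<And>x a b. 0 < a \<Longrightarrow> a < b \<Longrightarrow> b \<le> n \<Longrightarrow> D * (x * g b a) = x * ((1 - t\<^sup>2) * W * f b a + t * (Z - W) * f a b)"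
    unfolding D_def by (metis mult.left_commute)+
  note i = i00 i0m im0 imm iab iba
  note i1 = i [where x = 1, unfolded mult_1_left]
  note defs = step_weight_def step_ok_def step_next_def UNIV_bool
  have F: "two_rows n t Z W S U c (Suc N) a b =
     (\<Sum>k\<in>UNIV. step_weight n t Z a s k * step_weight n t W b k u * f (step_next n a s k) (step_next n b k u))" for a b
    by (simp add: f_def s_def u_def)
  have G: "two_rows n t W Z S U c (Suc N) a b =
     (\<Sum>k\<in>UNIV. step_weight n t W a s k * step_weight n t Z b k u * g (step_next n a s k) (step_next n b k u))" for a b
    by (simp add: g_def s_def u_def)
  have n0: "0 < n" "Suc 0 \<le> n" using n by simp_all
  show ?case
    unfolding intertwined_def F G D_def [symmetric]
  proof (intro conjI allI impI, goal_cases)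
    case (1)
    then show ?case
      using n0
      by (cases s; cases u)
        (simp_all add: defs i i1 distrib_left right_diff_distrib del: mult_cancel_left mult_cancel_right,
         (simp_all add: algebra_simps power2_eq_square D_def)?)
  next
    case (2 m)
    then show ?case
      using n0
      \<comment> \<open>The label \<open>n\<close> is a case of its own: there a step ends and the
        next label is 0 or 1 instead of \<open>Suc m\<close>.\<close>
      by (cases s; cases u; cases "m < n")
        (simp_all add: defs i i1 distrib_left right_diff_distrib del: mult_cancel_left mult_cancel_right,
         (simp_all add: algebra_simps power2_eq_square D_def)?)
  next
    case (3 m)
    then show ?case
      using n0
      by (cases s; cases u; cases "m < n")
        (simp_all add: defs i i1 distrib_left right_diff_distrib del: mult_cancel_left mult_cancel_right,
         (simp_all add: algebra_simps power2_eq_square D_def)?)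
  next
    case (4 m)
    then show ?case
      using n0
      by (cases s; cases u; cases "m < n")
        (simp_all add: defs i i1 distrib_left right_diff_distrib del: mult_cancel_left mult_cancel_right,
         (simp_all add: algebra_simps power2_eq_square D_def)?)
  next
    case (5 a b)
    then show ?case
      using n0
      by (cases s; cases u; cases "b < n")
        (simp_all add: defs i i1 distrib_left right_diff_distrib del: mult_cancel_left mult_cancel_right,
         (simp_all add: algebra_simps power2_eq_square D_def)?)
  next
    case (6 a b)
    then show ?case
      using n0
      by (cases s; cases u; cases "b < n")
        (simp_all add: defs i i1 distrib_left right_diff_distrib del: mult_cancel_left mult_cancel_right,
         (simp_all add: algebra_simps power2_eq_square D_def)?)
  qed
qed

text \<open>Continuity covers the case \<open>Z = t\<^sup>2 W\<close>, in which the relation above is void.\<close>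

lemma continuous_two_rows:
  "continuous_on UNIV (\<lambda>Z. two_rows n t Z W S U c N a b)"
  "continuous_on UNIV (\<lambda>Z. two_rows n t W Z S U c N a b)"
proof (induction N arbitrary: c a b)
  case (Suc N)
  {
    case 1
    have "continuous_on UNIV (\<lambda>Z. step_weight n t Z a s k)" for a s k
      by (cases "\<not> step_ok n a s k"; cases "a = 0"; cases "a < n")
        (auto simp: step_weight_def intro!: continuous_intros)
    then show ?case
      by (auto intro!: continuous_intros Suc.IH)
  next
    case 2
    have "continuous_on UNIV (\<lambda>Z. step_weight n t Z a s k)" for a s k
      by (cases "\<not> step_ok n a s k"; cases "a = 0"; cases "a < n")
        (auto simp: step_weight_def intro!: continuous_intros)
    then show ?case
      by (auto intro!: continuous_intros Suc.IH)
  }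
qed simp_all

text \<open>Both rows begin with label 0, and on the pair (0, 0) the R-matrix is the scalar
  \<open>Z - t\<^sup>2 * W\<close>, which can be cancelled whenever it is nonzero.\<close>

lemma two_rows_commute:
  assumes "n \<ge> 1"
  shows "two_rows n t Z W S U c N 0 0 = two_rows n t W Z S U c N 0 0"
proof -
  define h where "h = (\<lambda>Z. two_rows n t Z W S U c N 0 0 - two_rows n t W Z S U c N 0 0)"
  have z: "h Z = 0" if "Z \<noteq> t\<^sup>2 * W" for Z
    using intertwined_two_rows [OF assms, of t Z W S U c N] that
    by (simp add: intertwined_def h_def)
  have "isCont h (t\<^sup>2 * W)"
    unfolding h_def
    using continuous_two_rows [of n t W S U c N 0 0]
    by (intro continuous_intros) (simp_all add: continuous_on_eq_continuous_at)
  then have "(h \<longlongrightarrow> h (t\<^sup>2 * W)) (at (t\<^sup>2 * W))"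
    by (simp add: isCont_def)
  moreover have "((\<lambda>_. 0) \<longlongrightarrow> h (t\<^sup>2 * W)) (at (t\<^sup>2 * W)) = (h \<longlongrightarrow> h (t\<^sup>2 * W)) (at (t\<^sup>2 * W))"
    by (rule tendsto_cong) (auto simp: z eventually_at_filter)
  ultimately have "h (t\<^sup>2 * W) = 0"
    using tendsto_unique [OF at_neq_bot _ tendsto_const] by metis
  with z have "h Z = 0"
    by (cases "Z = t\<^sup>2 * W") auto
  then show ?thesis
    by (simp add: h_def)
qed

section \<open>Rows of Delta ice\<close>

definition ice_path :: "nat \<Rightarrow> int set \<Rightarrow> int set \<Rightarrow> (int \<Rightarrow> nat) \<Rightarrow> bool" where
  "ice_path n S K m \<longleftrightarrow> finite {c. m c \<noteq> 0} \<and>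
     (\<forall>c. m c \<le> n \<and> step_ok n (m c) (c \<in> S) (c \<in> K) \<and>
          m (c - 1) = step_next n (m c) (c \<in> S) (c \<in> K))"

definition ice :: "nat \<Rightarrow> complex \<Rightarrow> complex \<Rightarrow> int set \<Rightarrow> int set \<Rightarrow> complex" where
  "ice n t Z S K =
     (\<Sum>m | ice_path n S K m. \<Prod>c | m c \<noteq> 0. step_weight n t Z (m c) (c \<in> S) (c \<in> K))"

lemma finite_int_set_bound:
  fixes A :: "int set"
  assumes "finite A"
  obtains b where "\<And>c. c \<in> A \<Longrightarrow> c < b"
proof
  fix c assume "c \<in> A"
  then have "c \<le> Max (insert 0 A)"
    using assms by simp
  then show "c < Max (insert 0 A) + 1"
    by simp
qed

text \<open>Far to the left, that is for large columns, both paths have label 0, and from there the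
  labels propagate to the right without any choice.\<close>

lemma ice_path_unique:
  assumes "ice_path n S K m" "ice_path n S K m'"
  shows "m = m'"
proof -
  have "finite ({c. m c \<noteq> 0} \<union> {c. m' c \<noteq> 0})"
    using assms by (simp add: ice_path_def)
  then obtain b where b: "\<And>c. c \<in> {c. m c \<noteq> 0} \<union> {c. m' c \<noteq> 0} \<Longrightarrow> c < b"
    by (rule finite_int_set_bound) blast
  have ge: "m c = m' c" if "c \<ge> b" for c
    using b [of c] that by force
  have "m c = m' c" if "c \<le> b" for c
    using that
  proof (induction c rule: int_le_induct)
    case (step c)
    with assms show ?case
      by (simp add: ice_path_def)
  qed (simp add: ge)
  with ge show ?thesis
    by (metis ext linear)
qed

lemma ice_eq_prod:
  assumes "ice_path n S K m"
  shows "ice n t Z S K = (\<Prod>c | m c \<noteq> 0. step_weight n t Z (m c) (c \<in> S) (c \<in> K))"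
proof -
  have "{m. ice_path n S K m} = {m}"
    using assms ice_path_unique by auto
  then show ?thesis
    by (simp add: ice_def)
qed

lemma ice_eq_0:
  assumes "\<And>m. \<not> ice_path n S K m"
  shows "ice n t Z S K = 0"
  using assms by (simp add: ice_def)

lemma ice_path_step_weight_0:
  assumes "ice_path n S K m" "m c = 0"
  shows "step_weight n t Z (m c) (c \<in> S) (c \<in> K) = 1"
  using assms unfolding ice_path_def step_weight_def by (metis (full_types))

lemma ice_eq_prod_superset:
  assumes "ice_path n S K m" "finite A" "{c. m c \<noteq> 0} \<subseteq> A"
  shows "ice n t Z S K = (\<Prod>c\<in>A. step_weight n t Z (m c) (c \<in> S) (c \<in> K))"
  unfolding ice_eq_prod [OF assms(1)]
  by (rule prod.mono_neutral_left) (use assms ice_path_step_weight_0 in auto)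

lemma row_eq_prod:
  assumes "ice_path n S K m"
  shows "row n t Z S K c N (m c) =
     (if m (c - int N) = 0
      then \<Prod>d\<in>{c - int N<..c}. step_weight n t Z (m d) (d \<in> S) (d \<in> K) else 0)"
proof (induction N arbitrary: c)
  case (Suc N)
  have *: "{c - int (Suc N)<..c} = insert c {c - 1 - int N<..c - 1}"
    by auto
  have "step_next n (m c) (c \<in> S) (c \<in> K) = m (c - 1)"
    using assms by (simp add: ice_path_def)
  then show ?case
    using Suc.IH [of "c - 1"] unfolding * by (simp add: diff_diff_eq)
qed simp

lemma row_nonzeroD:
  assumes "n \<ge> 1" "a \<le> n" "row n t Z S K c N a \<noteq> 0"
  shows "\<exists>m. m c = a \<and> m (c - int N) = 0 \<and>
    (\<forall>d\<in>{c - int N<..c}. m d \<le> n \<and> step_ok n (m d) (d \<in> S) (d \<in> K) \<and>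
          m (d - 1) = step_next n (m d) (d \<in> S) (d \<in> K))"
  using assms(2,3)
proof (induction N arbitrary: c a)
  case 0
  then show ?case
    by (auto split: if_splits)
next
  case (Suc N)
  let ?a = "step_next n a (c \<in> S) (c \<in> K)"
  have "?a \<le> n"
    using Suc.prems assms(1) by (auto simp: step_next_def)
  moreover have "row n t Z S K (c - 1) N ?a \<noteq> 0" and ok: "step_ok n a (c \<in> S) (c \<in> K)"
    using Suc.prems by (auto simp: step_weight_def split: if_splits)
  ultimately obtain m where m: "m (c - 1) = ?a" "m (c - 1 - int N) = 0"
     "\<forall>d\<in>{c - 1 - int N<..c - 1}. m d \<le> n \<and> step_ok n (m d) (d \<in> S) (d \<in> K) \<and>
          m (d - 1) = step_next n (m d) (d \<in> S) (d \<in> K)"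
    using Suc.IH by blast
  have *: "{c - int (Suc N)<..c} = insert c {c - 1 - int N<..c - 1}"
    by auto
  show ?case
    unfolding *
    using m ok Suc.prems(1) by (intro exI [of _ "m(c := a)"]) (auto simp: diff_diff_eq)
qed

text \<open>To the left of the window the two spins of each column agree, so the label stays 0. To
  its right every column is occupied above and below; a nonzero label would cycle through 1, ..., n
  forever, against the finiteness of the support.\<close>

lemma row_eq_ice:
  assumes "n \<ge> 1" and eq: "\<And>d. d \<notin> {c - int N<..c} \<Longrightarrow> (d \<in> S) = (d \<in> K)"
    and low: "\<And>d. d \<le> c - int N \<Longrightarrow> d \<in> S"
    and high: "\<And>d. d > c \<Longrightarrow> d \<notin> S"
  shows "row n t Z S K c N 0 = ice n t Z S K"
proof (cases "\<exists>m. ice_path n S K m")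
  case True
  then obtain m where m: "ice_path n S K m"
    by blast
  have fin: "finite {c. m c \<noteq> 0}"
    and nxt: "\<And>d. m (d - 1) = step_next n (m d) (d \<in> S) (d \<in> K)"
    using m by (simp_all add: ice_path_def)
  then obtain b where b: "\<And>c. c \<in> {c. m c \<noteq> 0} \<Longrightarrow> c < b"
    using finite_int_set_bound by blast
  have ge: "m d = 0" if "c \<le> d" for d
  proof (cases "d \<ge> b")
    case True
    then show ?thesis
      using b [of d] by auto
  next
    case False
    then have "d \<le> b" by simp
    then show ?thesis
      using that
    proof (induction d rule: int_le_induct)
      case base
      then show ?case
        using b [of b] by auto
    next
      case (step d)
      then have "m d = 0" "(d \<in> S) = (d \<in> K)"
        using eq [of d] by auto
      then show ?case
        unfolding nxt by (simp add: step_next_def)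
    qed
  qed
  have le: "m d = 0" if "d \<le> c - int N" for d
  proof (rule ccontr)
    assume *: "m d \<noteq> 0"
    have "m d' \<noteq> 0" if "d' \<le> d" for d'
      using that
    proof (induction d' rule: int_le_induct)
      case (step d')
      moreover have "d' \<in> S" "d' \<in> K"
        using step low [of d'] eq [of d'] \<open>d \<le> c - int N\<close> by auto
      ultimately show ?case
        unfolding nxt using assms(1) by (simp add: step_next_def)
    qed (rule *)
    then have "{..d} \<subseteq> {c. m c \<noteq> 0}"
      by auto
    then show False
      using fin infinite_Iic finite_subset by blast
  qed
  have "{c. m c \<noteq> 0} \<subseteq> {c - int N<..c}"
  proof
    fix d assume "d \<in> {c. m c \<noteq> 0}"
    then have "\<not> c \<le> d" "\<not> d \<le> c - int N"
      using ge le by auto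
    then show "d \<in> {c - int N<..c}"
      by auto
  qed
  then have "ice n t Z S K = (\<Prod>d\<in>{c - int N<..c}. step_weight n t Z (m d) (d \<in> S) (d \<in> K))"
    by (intro ice_eq_prod_superset [OF m]) auto
  also have "\<dots> = row n t Z S K c N (m c)"
    using row_eq_prod [OF m] le by simp
  finally show ?thesis
    using ge by simp
next
  case False
  have "row n t Z S K c N 0 = 0"
  proof (rule ccontr)
    assume "row n t Z S K c N 0 \<noteq> 0"
    from row_nonzeroD [OF assms(1) _ this] obtain m where m: "m c = 0" "m (c - int N) = 0"
      "\<forall>d\<in>{c - int N<..c}. m d \<le> n \<and> step_ok n (m d) (d \<in> S) (d \<in> K) \<and>
          m (d - 1) = step_next n (m d) (d \<in> S) (d \<in> K)"
      by auto
    define m' where "m' = (\<lambda>d. if d \<in> {c - int N<..c} then m d else 0)"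
    have "{c. m' c \<noteq> 0} \<subseteq> {c - int N<..c}"
      by (auto simp: m'_def)
    then have "finite {c. m' c \<noteq> 0}"
      by (rule finite_subset) simp
    moreover have "m' d \<le> n \<and> step_ok n (m' d) (d \<in> S) (d \<in> K) \<and>
          m' (d - 1) = step_next n (m' d) (d \<in> S) (d \<in> K)" for d
    proof (cases "d \<in> {c - int N<..c}")
      case True
      then have "m' d = m d"
        by (simp add: m'_def)
      moreover have "m' (d - 1) = m (d - 1)"
      proof (cases "d - 1 = c - int N")
        case True
        then show ?thesis
          using m(2) by (simp add: m'_def)
      next
        case False
        then show ?thesis
          using \<open>d \<in> {c - int N<..c}\<close> by (simp add: m'_def)
      qed
      ultimately show ?thesis
        using m(3) True by simp
    next
      case False
      then have "m' d = 0" "m' (d - 1) = 0"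
        using m(1) by (cases "d - 1 = c"; auto simp: m'_def)+
      then show ?thesis
        using eq [OF False] by (simp add: step_ok_def step_next_def)
    qed
    ultimately have "ice_path n S K m'"
      by (simp add: ice_path_def)
    with False show False
      by blast
  qed
  with False show ?thesis
    by (simp add: ice_eq_0)
qed

section \<open>Translation between decorated spins and labels\<close>

definition decorate :: "nat \<Rightarrow> nat \<Rightarrow> decorated_spin" where
  "decorate n m = (if m = 0 then (Plus, 0) else (Minus, m mod n))"

definition spin_of :: "bool \<Rightarrow> spin" where
  "spin_of s = (if s then Minus else Plus)"

text \<open>The Delta ice weights with their factor \<open>z\<close> at every nonzero label, before
  these factors are gathered at the label \<open>n\<close>.\<close>

definition raw_weight :: "nat \<Rightarrow> complex \<Rightarrow> complex \<Rightarrow> nat \<Rightarrow> bool \<Rightarrow> bool \<Rightarrow> complex" where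
  "raw_weight n t z m s k = (if m = 0 then 1 else z) * step_weight n t 1 m s k"

lemma delta_weight_decorate:
  assumes "n \<ge> 1" "m \<le> n"
  shows "delta_weight n q z (decorate n m) (spin_of s) e (spin_of k) =
     (if step_ok n m s k \<and> e = decorate n (step_next n m s k)
      then Some (raw_weight n (- q) z m s k) else None)"
proof -
  obtain e1 e2 where e: "e = (e1, e2)"
    by (cases e)
  show ?thesis
    unfolding e
  proof (cases "m = 0")
    case True
    then show "delta_weight n q z (decorate n m) (spin_of s) (e1, e2) (spin_of k) =
     (if step_ok n m s k \<and> (e1, e2) = decorate n (step_next n m s k)
      then Some (raw_weight n (- q) z m s k) else None)"
      by (cases s; cases k; cases e1)
        (simp_all add: decorate_def spin_of_def step_ok_def step_next_def raw_weight_def step_weight_def gauss_def)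
  next
    case False
    then consider "m = n" "m mod n = 0" | "0 < m" "m < n" "m mod n = m"
      using assms by force
    then show "delta_weight n q z (decorate n m) (spin_of s) (e1, e2) (spin_of k) =
     (if step_ok n m s k \<and> (e1, e2) = decorate n (step_next n m s k)
      then Some (raw_weight n (- q) z m s k) else None)"
    proof cases
      case 1
      then show ?thesis
        using assms
        by (cases s; cases k; cases e1)
          (simp_all add: decorate_def spin_of_def step_ok_def step_next_def raw_weight_def step_weight_def gauss_def)
    next
      case 2
      then show ?thesis
        by (cases s; cases k; cases e1)
          (simp_all add: decorate_def spin_of_def step_ok_def step_next_def raw_weight_def step_weight_def gauss_def)
    qed
  qed
qed

lemma decorate_inject:
  assumes "n \<ge> 1" "a \<le> n" "b \<le> n"
  shows "decorate n a = decorate n b \<longleftrightarrow> a = b"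
  using assms by (auto simp: decorate_def le_less)

lemma column_spin_eq: "column_spin lam c = spin_of (c \<in> columns lam)"
  by (simp add: column_spin_def spin_of_def)

lemma ice_path_admissible:
  assumes "n \<ge> 1" "ice_path n (columns lam) (columns mu) m"
  shows "(\<lambda>c. decorate n (m c)) \<in> admissible_states n q z lam mu"
proof -
  have "vertex_weight n q z lam mu (\<lambda>c. decorate n (m c)) c \<noteq> None" for c
    using assms by (simp add: vertex_weight_def column_spin_eq delta_weight_decorate ice_path_def)
  moreover have "snd (decorate n (m c)) < n" for c
    using assms(1) by (simp add: decorate_def)
  moreover have "{c. decorate n (m c) \<noteq> (Plus, 0)} \<subseteq> {c. m c \<noteq> 0}"
    by (auto simp: decorate_def)
  then have "finite {c. decorate n (m c) \<noteq> (Plus, 0)}"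
    using assms(2) finite_subset by (auto simp: ice_path_def)
  ultimately show ?thesis
    by (simp add: admissible_states_def)
qed

text \<open>Labels are found by induction from the far left, where every edge is
  \<open>(Plus, 0)\<close>. They are unique because \<open>n\<close> is the only label among 1, ...,
  n with residue 0.\<close>

lemma admissible_ice_path:
  assumes n: "n \<ge> 1" and adm: "\<sigma> \<in> admissible_states n q z lam mu"
  obtains m where "ice_path n (columns lam) (columns mu) m" "\<sigma> = (\<lambda>c. decorate n (m c))"
proof -
  let ?S = "columns lam" and ?K = "columns mu"
  have fin: "finite {c. \<sigma> c \<noteq> (Plus, 0)}"
    and ok: "\<And>c. delta_weight n q z (\<sigma> c) (spin_of (c \<in> ?S)) (\<sigma> (c - 1)) (spin_of (c \<in> ?K)) \<noteq> None"
    using adm by (auto simp: admissible_states_def vertex_weight_def column_spin_eq)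
  obtain b where b: "\<And>c. c \<in> {c. \<sigma> c \<noteq> (Plus, 0)} \<Longrightarrow> c < b"
    using finite_int_set_bound [OF fin] by blast
  have next_label: "\<exists>m'\<le>n. \<sigma> (c - 1) = decorate n m'" if "m \<le> n" "\<sigma> c = decorate n m" for m c
  proof -
    have "step_next n m (c \<in> ?S) (c \<in> ?K) \<le> n"
      using that n by (auto simp: step_next_def)
    moreover have "\<sigma> (c - 1) = decorate n (step_next n m (c \<in> ?S) (c \<in> ?K))"
      using ok [of c] that n by (auto simp: delta_weight_decorate split: if_splits)
    ultimately show ?thesis
      by blast
  qed
  have ge: "\<exists>m\<le>n. \<sigma> c = decorate n m" if "c \<ge> b" for c
    using b [of c] that by (auto simp: decorate_def intro!: exI [of _ 0])
  have "\<exists>m\<le>n. \<sigma> c = decorate n m" if "c \<le> b" for c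
    using that
  proof (induction c rule: int_le_induct)
    case base
    show ?case by (rule ge) simp
  next
    case (step c)
    then show ?case using next_label by blast
  qed
  then have "\<forall>c. \<exists>m\<le>n. \<sigma> c = decorate n m"
    using ge linear by blast
  then obtain m where m: "\<And>c. m c \<le> n" "\<And>c. \<sigma> c = decorate n (m c)"
    by metis
  have "{c. m c \<noteq> 0} \<subseteq> {c. \<sigma> c \<noteq> (Plus, 0)}"
    by (auto simp: m(2) decorate_def)
  then have "finite {c. m c \<noteq> 0}"
    using fin finite_subset by blast
  moreover have "step_ok n (m c) (c \<in> ?S) (c \<in> ?K) \<and> m (c - 1) = step_next n (m c) (c \<in> ?S) (c \<in> ?K)" for c
  proof -
    have "step_next n (m c) (c \<in> ?S) (c \<in> ?K) \<le> n"
      using m(1) [of c] n by (auto simp: step_next_def)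
    then show ?thesis
      using ok [of c] m n
      by (simp add: delta_weight_decorate decorate_inject split: if_splits)
  qed
  ultimately have "ice_path n ?S ?K m"
    using m(1) by (simp add: ice_path_def)
  then show ?thesis
    using m(2) that by blast
qed

text \<open>The factors \<open>z ^ (m - 1)\<close> telescope along a row; \<open>m - 1\<close> is 0 for the label \<open>m = 0\<close>.\<close>

lemma raw_weight_gauge:
  assumes "n \<ge> 1" "m \<le> n"
  shows "raw_weight n t z m s k * z ^ (m - 1) = step_weight n t (z ^ n) m s k * z ^ (step_next n m s k - 1)"
proof -
  have "z * z ^ (m - 1) = z ^ m" if "m > 0"
    using that by (cases m) auto
  then show ?thesis
    using assms
    by (cases "m = 0"; cases "m = n"; cases s; cases k)
      (simp_all add: raw_weight_def step_weight_def step_next_def step_ok_def mult_ac)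
qed

lemma prod_raw_weight:
  assumes "n \<ge> 1" "ice_path n S K m"
  shows "(\<Prod>d\<in>{c - int N<..c}. raw_weight n t z (m d) (d \<in> S) (d \<in> K)) * z ^ (m c - 1) =
    (\<Prod>d\<in>{c - int N<..c}. step_weight n t (z ^ n) (m d) (d \<in> S) (d \<in> K)) * z ^ (m (c - int N) - 1)"
proof (induction N)
  case (Suc N)
  let ?d = "c - int N"
  have *: "{c - int (Suc N)<..c} = insert ?d {?d<..c}"
    by auto
  have m: "m ?d \<le> n" "m (?d - 1) = step_next n (m ?d) (?d \<in> S) (?d \<in> K)"
    using assms(2) by (simp_all add: ice_path_def)
  have **: "c - int (Suc N) = ?d - 1" by simp
  let ?P = "\<Prod>d\<in>{?d<..c}. raw_weight n t z (m d) (d \<in> S) (d \<in> K)"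
  let ?Q = "\<Prod>d\<in>{?d<..c}. step_weight n t (z ^ n) (m d) (d \<in> S) (d \<in> K)"
  let ?p = "raw_weight n t z (m ?d) (?d \<in> S) (?d \<in> K)"
  let ?q = "step_weight n t (z ^ n) (m ?d) (?d \<in> S) (?d \<in> K)"
  have "?p * ?P * z ^ (m c - 1) = ?p * (?Q * z ^ (m ?d - 1))"
    by (simp only: mult.assoc Suc)
  also have "\<dots> = ?Q * (?p * z ^ (m ?d - 1))"
    by (simp only: mult_ac)
  also have "\<dots> = ?q * ?Q * z ^ (m (?d - 1) - 1)"
    unfolding raw_weight_gauge [OF assms(1) m(1)] m(2) by (simp only: mult_ac)
  finally show ?case
    unfolding * unfolding ** by (simp only: prod.insert finite_greaterThanAtMost_int greaterThanAtMost_iff simp_thms less_irrefl)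
qed simp

lemma ice_path_support_interval:
  assumes "ice_path n S K m"
  obtains c N where "{c. m c \<noteq> 0} \<subseteq> {c - int N<..c}" "m c = 0" "m (c - int N) = 0"
proof -
  have fin: "finite {c. m c \<noteq> 0}"
    using assms by (simp add: ice_path_def)
  obtain b where b: "\<And>c. c \<in> {c. m c \<noteq> 0} \<Longrightarrow> c < b"
    using finite_int_set_bound [OF fin] by blast
  obtain b' where b': "\<And>c. c \<in> uminus ` {c. m c \<noteq> 0} \<Longrightarrow> c < b'"
    using finite_int_set_bound [OF finite_imageI [OF fin, of uminus]] by blast
  \<comment> \<open>If the support is empty, \<open>b\<close> and \<open>b'\<close> are unrelated;
    the minimum keeps the length of the interval nonnegative.\<close>
  define l where "l = min b (- b')"
  have "c < b \<and> - b' < c" if "m c \<noteq> 0" for c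
    using b [of c] b' [of "- c"] that by auto
  note bd = this
  have "{c. m c \<noteq> 0} \<subseteq> {l<..b}"
    using bd by (fastforce simp: l_def)
  moreover have "m b = 0" "m l = 0"
    using bd [of b] bd [of l] by (auto simp: l_def)
  moreover have "b - int (nat (b - l)) = l"
    by (simp add: l_def)
  ultimately show ?thesis
    using that [of b "nat (b - l)"] by simp
qed

text \<open>The interval is chosen with label 0 at both ends, so the gauge factors there are 1 and
  the telescoped products with parameters \<open>z\<close> and \<open>z ^ n\<close> are
  equal.\<close>

lemma delta_entry_eq_ice:
  assumes n: "n \<ge> 1"
  shows "delta_entry n q z mu lam = ice n (- q) (z ^ n) (columns lam) (columns mu)"
proof (cases "\<exists>m. ice_path n (columns lam) (columns mu) m")
  case True
  then obtain m where m: "ice_path n (columns lam) (columns mu) m"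
    by blast
  have "\<sigma> = (\<lambda>c. decorate n (m c))" if "\<sigma> \<in> admissible_states n q z lam mu" for \<sigma>
    using admissible_ice_path [OF n that] ice_path_unique [OF m] by metis
  then have adm: "admissible_states n q z lam mu = {\<lambda>c. decorate n (m c)}"
    using ice_path_admissible [OF n m] by blast
  have w: "the (vertex_weight n q z lam mu (\<lambda>c. decorate n (m c)) c) =
      raw_weight n (- q) z (m c) (c \<in> columns lam) (c \<in> columns mu)" for c
    using m n by (simp add: vertex_weight_def column_spin_eq delta_weight_decorate ice_path_def)
  have 1: "raw_weight n (- q) z (m c) (c \<in> columns lam) (c \<in> columns mu) = 1" if "m c = 0" for c
    using ice_path_step_weight_0 [OF m that, of "- q" 1] that by (simp add: raw_weight_def)
  obtain c N where cN: "{c. m c \<noteq> 0} \<subseteq> {c - int N<..c}" "m c = 0" "m (c - int N) = 0"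
    using ice_path_support_interval [OF m] .
  have "delta_entry n q z mu lam =
      Prod_any (\<lambda>c. raw_weight n (- q) z (m c) (c \<in> columns lam) (c \<in> columns mu))"
    by (simp add: delta_entry_def adm w)
  also have "\<dots> = (\<Prod>d\<in>{c - int N<..c}. raw_weight n (- q) z (m d) (d \<in> columns lam) (d \<in> columns mu))"
    by (rule Prod_any.expand_superset) (use cN(1) 1 in blast)+
  also have "\<dots> = (\<Prod>d\<in>{c - int N<..c}. step_weight n (- q) (z ^ n) (m d) (d \<in> columns lam) (d \<in> columns mu))"
    using prod_raw_weight [OF n m, where c = c and N = N and t = "- q" and z = z] cN by simp
  also have "\<dots> = ice n (- q) (z ^ n) (columns lam) (columns mu)"
    by (rule ice_eq_prod_superset [OF m, symmetric]) (use cN in auto)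
  finally show ?thesis .
next
  case False
  then have "admissible_states n q z lam mu = {}"
    using admissible_ice_path [OF n] by blast
  with False show ?thesis
    by (simp add: delta_entry_def ice_eq_0)
qed

section \<open>Flows\<close>

text \<open>An element \<open>x\<close> of \<open>F\<close> is a step from \<open>x\<close> to
  \<open>x - int n\<close>. The equation is conservation of particles at column \<open>c\<close>:
  departures plus final occupation equal arrivals plus initial occupation. The indicators allow at
  most one particle on each side.\<close>

definition flow :: "nat \<Rightarrow> int set \<Rightarrow> int set \<Rightarrow> int set \<Rightarrow> bool" where
  "flow n S K F \<longleftrightarrow> finite F \<and>
     (\<forall>c. of_bool (c \<in> F) + of_bool (c \<in> K) = (of_bool (c + int n \<in> F) + of_bool (c \<in> S) :: nat))"

definition separated :: "nat \<Rightarrow> int set \<Rightarrow> bool" where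
  "separated n F \<longleftrightarrow> (\<forall>x\<in>F. \<forall>y\<in>F. y < x \<longrightarrow> y + int n \<le> x)"

lemma flow_cases:
  assumes "flow n S K F"
  obtains "c \<in> F" "c + int n \<in> F" "c \<in> K \<longleftrightarrow> c \<in> S"
  | "c \<in> F" "c + int n \<notin> F" "c \<notin> K" "c \<in> S"
  | "c \<notin> F" "c + int n \<in> F" "c \<in> K" "c \<notin> S"
  | "c \<notin> F" "c + int n \<notin> F" "c \<in> K \<longleftrightarrow> c \<in> S"
proof -
  have "of_bool (c \<in> F) + of_bool (c \<in> K) = (of_bool (c + int n \<in> F) + of_bool (c \<in> S) :: nat)"
    using assms by (simp add: flow_def)
  then show ?thesis
    using that by (cases "c \<in> F"; cases "c + int n \<in> F"; cases "c \<in> K"; cases "c \<in> S") auto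
qed

text \<open>At the largest column where two flows differ the arrivals still agree, and conservation
  then makes the departures agree as well.\<close>

lemma flow_unique:
  assumes n: "n \<ge> 1" and "flow n S K F" "flow n S K F'"
  shows "F = F'"
proof (rule ccontr)
  define D where "D = (F - F') \<union> (F' - F)"
  assume "F \<noteq> F'"
  then have "D \<noteq> {}" "finite D"
    using assms by (auto simp: D_def flow_def)
  then have "Max D \<in> D" "Max D + int n \<notin> D"
    using Max_ge [of D "Max D + int n"] n by auto
  then show False
    using assms(3)
    by (cases rule: flow_cases [OF assms(2), of "Max D"]; cases rule: flow_cases [OF assms(3), of "Max D"])
      (auto simp: D_def)
qed

lemma ice_path_next:
  "ice_path n S K m \<Longrightarrow> m (c - 1) = step_next n (m c) (c \<in> S) (c \<in> K)"
  by (simp add: ice_path_def)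

lemma ice_path_ok:
  "ice_path n S K m \<Longrightarrow> step_ok n (m c) (c \<in> S) (c \<in> K)"
  by (simp add: ice_path_def)

lemma ice_path_le:
  "ice_path n S K m \<Longrightarrow> m c \<le> n"
  by (simp add: ice_path_def)

lemma ice_path_after_start:
  assumes "ice_path n S K m" "m (x - 1) = 1" "1 \<le> j" "j \<le> n"
  shows "m (x - int j) = j"
  using assms(3,4)
proof (induction j rule: dec_induct)
  case base
  then show ?case
    using assms(2) by simp
next
  case (step j)
  have "m (x - int j - 1) = Suc j"
    using step ice_path_next [OF assms(1), of "x - int j"] by (simp add: step_next_def)
  then show ?case
    by (simp add: algebra_simps)
qed

lemma ice_path_before:
  assumes "n \<ge> 1" "ice_path n S K m" "m c = j" "1 \<le> j"
  shows "m (c + int j - 1) = 1"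
  using assms(4,3)
proof (induction j arbitrary: c rule: dec_induct)
  case (step j)
  have "m (c + 1) = j"
    using step ice_path_next [OF assms(2), of "c + 1"] by (auto simp: step_next_def split: if_splits)
  then show ?case
    using step.IH [of "c + 1"] by (simp add: algebra_simps)
qed simp

text \<open>A nonzero label is the distance travelled: label \<open>j\<close> on the left edge of
  \<open>c\<close> means that the current step began at column \<open>c + int j\<close>.\<close>

lemma ice_path_carry_iff:
  assumes "n \<ge> 1" "ice_path n S K m" "1 \<le> j" "j \<le> n"
  shows "m c = j \<longleftrightarrow> m (c + int j - 1) = 1"
  using ice_path_before [OF assms(1,2)] ice_path_after_start [OF assms(2), of "c + int j" j] assms(3,4)
  by auto

text \<open>A step starts at \<open>c\<close> when the edge to the right of \<open>c\<close> has
  label 1, and a step arrives at \<open>c\<close> when the edge to its left has label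
  \<open>n\<close>. Conservation is then a check of the three kinds of labels. Separation holds
  because an edge carries a single label.\<close>

lemma ice_path_flow:
  assumes n: "n \<ge> 1" and m: "ice_path n S K m"
  defines "F \<equiv> {c. m (c - 1) = 1}"
  shows "flow n S K F" "separated n F"
proof -
  have "F \<subseteq> (\<lambda>c. c + 1) ` {c. m c \<noteq> 0}"
  proof
    fix c assume "c \<in> F"
    then show "c \<in> (\<lambda>c. c + 1) ` {c. m c \<noteq> 0}"
      by (intro image_eqI [of _ _ "c - 1"]) (simp_all add: F_def)
  qed
  moreover have "finite {c. m c \<noteq> 0}"
    using m by (simp add: ice_path_def)
  ultimately have fin: "finite F"
    using finite_subset by blast
  have "of_bool (c \<in> F) + of_bool (c \<in> K) = (of_bool (c + int n \<in> F) + of_bool (c \<in> S) :: nat)" for c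
  proof -
    have in_iff: "c + int n \<in> F \<longleftrightarrow> m c = n" "c \<in> F \<longleftrightarrow> step_next n (m c) (c \<in> S) (c \<in> K) = 1"
      using ice_path_carry_iff [OF n m n, of c] ice_path_next [OF m, of c] by (simp_all add: F_def)
    consider "m c = 0" | "0 < m c" "m c < n" | "m c = n"
      using ice_path_le [OF m, of c] by linarith
    then show ?thesis
      unfolding in_iff using ice_path_ok [OF m, of c] n
      by cases (cases "c \<in> S"; cases "c \<in> K"; simp add: step_next_def step_ok_def)+
  qed
  with fin show "flow n S K F"
    by (simp add: flow_def)
  show "separated n F"
    unfolding separated_def
  proof (intro ballI impI)
    fix x y assume xy: "x \<in> F" "y \<in> F" "y < x"
    show "y + int n \<le> x"
    proof (rule ccontr)
      assume *: "\<not> y + int n \<le> x"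
      \<comment> \<open>The left edge of column \<open>y - 1\<close> has distance \<open>j\<close>
        from \<open>x\<close>, so it would have to carry both the label \<open>j > 1\<close> and the
        label 1.\<close>
      define j where "j = nat (x - y + 1)"
      have "m (x - int j) = j"
        using xy * by (intro ice_path_after_start [OF m]) (auto simp: F_def j_def)
      moreover have "x - int j = y - 1" "j \<noteq> 1"
        using xy by (auto simp: j_def)
      ultimately show False
        using xy by (simp add: F_def)
    qed
  qed
qed

text \<open>The label at \<open>c\<close> is recovered as the distance to a start at most
  \<open>n\<close> columns to the left; separation leaves at most one candidate.\<close>

lemma flow_ice_path:
  assumes n: "n \<ge> 1" and F: "flow n S K F" and sep: "separated n F"
  obtains m where "ice_path n S K m" "F = {c. m (c - 1) = 1}"
proof -
  define P where "P = (\<lambda>c j. 1 \<le> j \<and> j \<le> n \<and> c + int j \<in> F)"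
  define m where "m = (\<lambda>c. if \<exists>j. P c j then THE j. P c j else 0)"
  have uniq: "j = j'" if "P c j" "P c j'" for c j j'
  proof (rule ccontr)
    assume "j \<noteq> j'"
    then have "c + int j < c + int j' \<or> c + int j' < c + int j"
      by auto
    then show False
      using sep that unfolding separated_def P_def by fastforce
  qed
  have mP: "m c = j" if "P c j" for c j
  proof -
    have "(THE j. P c j) = j"
      using that uniq by blast
    then show ?thesis
      using that by (auto simp: m_def)
  qed
  have m0: "m c = 0" if "\<And>j. \<not> P c j" for c
    using that by (auto simp: m_def)
  have nP: "\<not> P c j" if "m c = 0" for c j
    using mP [of c j] that by (auto simp: P_def)
  have Pm: "P c (m c)" if "m c \<noteq> 0" for c
    using that mP m0 by metis
  have "{c. m c \<noteq> 0} \<subseteq> (\<Union>j\<in>{1..n}. (\<lambda>x. x - int j) ` F)"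
  proof
    fix c assume "c \<in> {c. m c \<noteq> 0}"
    then have "P c (m c)"
      using Pm by simp
    then show "c \<in> (\<Union>j\<in>{1..n}. (\<lambda>x. x - int j) ` F)"
      by (intro UN_I [of "m c"] image_eqI [of _ _ "c + int (m c)"]) (auto simp: P_def)
  qed
  then have fin: "finite {c. m c \<noteq> 0}"
    by (rule finite_subset) (use F in \<open>auto simp: flow_def\<close>)
  have P1: "P (c - 1) 1 \<longleftrightarrow> c \<in> F" for c
    using n by (simp add: P_def)
  have le: "m c \<le> n" for c
    using Pm [of c] by (cases "m c = 0") (auto simp: P_def)
  have "step_ok n (m c) (c \<in> S) (c \<in> K) \<and> m (c - 1) = step_next n (m c) (c \<in> S) (c \<in> K)" for c
  proof -
    have n_iff: "m c = n \<longleftrightarrow> c + int n \<in> F"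
      using mP [of c n] Pm [of c] n by (auto simp: P_def)
    consider "m c = 0" | "0 < m c" "m c < n" | "m c = n"
      using le [of c] by linarith
    then show ?thesis
    proof cases
      case 1
      then have "c + int n \<notin> F"
        using n_iff n by auto
      moreover have "m (c - 1) = 0" if "c \<notin> F"
      proof (rule m0)
        fix j show "\<not> P (c - 1) j"
        proof
          assume "P (c - 1) j"
          moreover from this have "j \<noteq> 1"
            using P1 that by auto
          ultimately have "P c (j - 1)"
            by (auto simp: P_def of_nat_diff algebra_simps)
          then show False
            using nP 1 by blast
        qed
      qed
      moreover have "m (c - 1) = 1" if "c \<in> F"
        using mP [of "c - 1" 1] P1 that by simp
      ultimately show ?thesis
        using 1 by (cases rule: flow_cases [OF F, of c]) (auto simp: step_ok_def step_next_def)
    next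
      case 2
      then have "P c (m c)"
        using Pm by simp
      then have "c \<notin> F" "P (c - 1) (Suc (m c))"
        using 2 sep by (fastforce simp: P_def separated_def)+
      moreover from 2 have "c + int n \<notin> F"
        using n_iff by auto
      ultimately show ?thesis
        using 2 mP [of "c - 1" "Suc (m c)"]
        by (cases rule: flow_cases [OF F, of c]) (auto simp: step_ok_def step_next_def)
    next
      case 3
      then have cn: "c + int n \<in> F"
        using n_iff by simp
      have "m (c - 1) = 0" if "c \<notin> F"
      proof (rule m0)
        fix j show "\<not> P (c - 1) j"
        proof
          assume P: "P (c - 1) j"
          moreover from this have "j \<noteq> 1"
            using P1 that by auto
          moreover have "c - 1 + int j + int n \<le> c + int n" if "c - 1 + int j < c + int n"
            using sep cn P that unfolding P_def separated_def by blast
          ultimately show False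
            by (auto simp: P_def)
        qed
      qed
      moreover have "m (c - 1) = 1" if "c \<in> F"
        using mP [of "c - 1" 1] P1 that by simp
      ultimately show ?thesis
        using 3 cn n by (cases rule: flow_cases [OF F, of c]) (auto simp: step_ok_def step_next_def)
    qed
  qed
  then have "ice_path n S K m"
    using fin le by (simp add: ice_path_def)
  moreover have "F = {c. m (c - 1) = 1}"
  proof (intro set_eqI iffI)
    fix c assume "c \<in> F"
    then show "c \<in> {c. m (c - 1) = 1}"
      using mP [of "c - 1" 1] P1 by simp
  next
    fix c assume "c \<in> {c. m (c - 1) = 1}"
    then show "c \<in> F"
      using Pm [of "c - 1"] P1 [of c] by simp
  qed
  ultimately show ?thesis
    using that by blast
qed

text \<open>The steps cover disjoint intervals. Inside one of them the labels are below
  \<open>n\<close> and each particle passed costs \<open>t\<close>. The label \<open>n\<close> sits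
  at \<open>x - int n\<close> and gives the last factor: \<open>1 - t\<^sup>2\<close> if the path
  ends there, otherwise \<open>g(0) = - t\<^sup>2\<close> or 1 according to whether that column is
  occupied.\<close>

lemma ice_eq_flow_prod:
  assumes n: "n \<ge> 1" and F: "flow n S K F" and sep: "separated n F"
  shows "ice n t Z S K = (\<Prod>x\<in>F. Z * t ^ card {d \<in> {x - int n<..<x}. d \<in> S} *
     (if x - int n \<in> F then if x - int n \<in> S then - t\<^sup>2 else 1 else 1 - t\<^sup>2))"
proof -
  obtain m where m: "ice_path n S K m" and Fm: "F = {c. m (c - 1) = 1}"
    using flow_ice_path [OF n F sep] .
  have fin: "finite F"
    using F by (simp add: flow_def)
  let ?w = "\<lambda>c. step_weight n t Z (m c) (c \<in> S) (c \<in> K)"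
  have supp: "{c. m c \<noteq> 0} = (\<Union>x\<in>F. {x - int n..<x})"
  proof (intro equalityI subsetI)
    fix c assume "c \<in> {c. m c \<noteq> 0}"
    then have "c + int (m c) \<in> F" "m c \<noteq> 0"
      using ice_path_before [OF n m, of c "m c"] Fm by simp_all
    then show "c \<in> (\<Union>x\<in>F. {x - int n..<x})"
      using ice_path_le [OF m, of c] by (intro UN_I [of "c + int (m c)"]) auto
  next
    fix c assume "c \<in> (\<Union>x\<in>F. {x - int n..<x})"
    then obtain x where x: "x \<in> F" "x - int n \<le> c" "c < x"
      by auto
    then have "m (x - int (nat (x - c))) = nat (x - c)"
      by (intro ice_path_after_start [OF m]) (auto simp: Fm)
    with x show "c \<in> {c. m c \<noteq> 0}"
      by simp
  qed
  have disj: "\<forall>x\<in>F. \<forall>y\<in>F. x \<noteq> y \<longrightarrow> {x - int n..<x} \<inter> {y - int n..<y} = {}"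
  proof (intro ballI impI)
    fix x y assume "x \<in> F" "y \<in> F" "x \<noteq> y"
    then have "y + int n \<le> x \<or> x + int n \<le> y"
      using sep by (auto simp: separated_def neq_iff)
    then show "{x - int n..<x} \<inter> {y - int n..<y} = {}"
      by auto
  qed
  have "ice n t Z S K = (\<Prod>c\<in>(\<Union>x\<in>F. {x - int n..<x}). ?w c)"
    unfolding supp [symmetric] by (rule ice_eq_prod [OF m])
  also have "\<dots> = (\<Prod>x\<in>F. \<Prod>c\<in>{x - int n..<x}. ?w c)"
    by (rule prod.UNION_disjoint) (use fin disj in auto)
  also have "\<dots> = (\<Prod>x\<in>F. Z * t ^ card {d \<in> {x - int n<..<x}. d \<in> S} *
     (if x - int n \<in> F then if x - int n \<in> S then - t\<^sup>2 else 1 else 1 - t\<^sup>2))"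
  proof (rule prod.cong [OF refl])
    fix x assume x: "x \<in> F"
    have carry: "m c = nat (x - c)" if "x - int n \<le> c" "c < x" for c
    proof -
      have "m (x - int (nat (x - c))) = nat (x - c)"
        using that x by (intro ice_path_after_start [OF m]) (auto simp: Fm)
      with that show ?thesis
        by simp
    qed
    have int: "{x - int n..<x} = insert (x - int n) {x - int n<..<x}"
      using n by auto
    have "?w c = (if c \<in> S then t else 1)" if "c \<in> {x - int n<..<x}" for c
    proof -
      have "0 < m c" "m c < n"
        using that carry [of c] by auto
      then show ?thesis
        using ice_path_ok [OF m, of c] by (simp add: step_weight_def)
    qed
    then have "(\<Prod>c\<in>{x - int n<..<x}. ?w c) = (\<Prod>c\<in>{x - int n<..<x}. if c \<in> S then t else 1)"
      by (intro prod.cong) auto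
    also have "\<dots> = t ^ card {d \<in> {x - int n<..<x}. d \<in> S}"
      by (simp add: prod.If_cases Int_def)
    finally have 1: "(\<Prod>c\<in>{x - int n<..<x}. ?w c) = t ^ card {d \<in> {x - int n<..<x}. d \<in> S}" .
    have "m (x - int n) = n"
      using carry [of "x - int n"] n by simp
    moreover have "x - int n + int n \<in> F"
      using x by simp
    ultimately have "?w (x - int n) =
       Z * (if x - int n \<in> F then if x - int n \<in> S then - t\<^sup>2 else 1 else 1 - t\<^sup>2)"
      using n ice_path_ok [OF m, of "x - int n"]
      by (cases rule: flow_cases [OF F, of "x - int n"]) (auto simp: step_weight_def)
    with 1 show "(\<Prod>c\<in>{x - int n..<x}. ?w c) = Z * t ^ card {d \<in> {x - int n<..<x}. d \<in> S} *
     (if x - int n \<in> F then if x - int n \<in> S then - t\<^sup>2 else 1 else 1 - t\<^sup>2)"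
      unfolding int by simp
  qed
  finally show ?thesis .
qed

lemma ice_eq_0_if_not_separated:
  assumes n: "n \<ge> 1" and F: "flow n S K F" and "\<not> separated n F"
  shows "ice n t Z S K = 0"
  using assms ice_path_flow [OF n] flow_unique [OF n F] by (intro ice_eq_0) metis

lemma ice_eq_0_if_no_flow:
  assumes n: "n \<ge> 1" and "\<And>F. \<not> flow n S K F"
  shows "ice n t Z S K = 0"
  using assms ice_path_flow(1) [OF n] by (intro ice_eq_0) blast

section \<open>Horizontal and vertical moves of particles\<close>

text \<open>Since larger starts move first, column \<open>c - int n\<close> still has its initial
  occupation when \<open>c\<close> moves, whereas \<open>c\<close> may have been filled before by a
  move from \<open>c + int n\<close>. Thus a particle can make several horizontal moves.\<close>

definition hmoves :: "nat \<Rightarrow> int set \<Rightarrow> int set \<Rightarrow> bool" where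
  "hmoves n S M \<longleftrightarrow> finite M \<and> (\<forall>c\<in>M. (c \<in> S \<or> c + int n \<in> M) \<and> c - int n \<notin> S)"

definition hresult :: "nat \<Rightarrow> int set \<Rightarrow> int set \<Rightarrow> int set" where
  "hresult n S M = {c. (c \<in> S \<or> c + int n \<in> M) \<and> c \<notin> M}"

definition hspin :: "nat \<Rightarrow> int set \<Rightarrow> int set \<Rightarrow> nat" where
  "hspin n S M = (\<Sum>c\<in>M. card {d \<in> {c - int n<..<c}. d \<in> S \<or> d + int n \<in> M})"

text \<open>Horizontal moves are made in the order of decreasing starting points, vertical moves in the order
  of increasing ones; the spin of a move counts the particles between start and end at that time.\<close>

definition vmoves :: "nat \<Rightarrow> int set \<Rightarrow> int set \<Rightarrow> bool" where
  "vmoves n K M \<longleftrightarrow> finite M \<and> (\<forall>c\<in>M. c \<in> K \<and> (c - int n \<notin> K \<or> c - int n \<in> M))"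

definition vresult :: "nat \<Rightarrow> int set \<Rightarrow> int set \<Rightarrow> int set" where
  "vresult n K M = {c. c \<in> K \<and> c \<notin> M \<or> c + int n \<in> M}"

definition vspin :: "nat \<Rightarrow> int set \<Rightarrow> int set \<Rightarrow> nat" where
  "vspin n K M = (\<Sum>c\<in>M. card {d \<in> {c - int n<..<c}. d \<in> K \<and> d \<notin> M})"

text \<open>Why the type of \<open>x\<close> is forced when \<open>x - int n\<close> is also a
  start: if \<open>x - int n\<close> is initially occupied, a horizontal step cannot land on it; if
  it is empty, the particle that leaves it must have come from \<open>x\<close>, and only horizontal
  moves can be chained.\<close>

lemma moves_flow:
  assumes h: "hmoves n S M" and v: "vmoves n (hresult n S M) N"
  defines "U \<equiv> vresult n (hresult n S M) N"
  shows "flow n S U (M \<union> N)" "M \<inter> N = {}"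
    "\<And>x. x \<in> M \<union> N \<Longrightarrow> x - int n \<in> M \<union> N \<Longrightarrow> x \<in> M \<longleftrightarrow> x - int n \<notin> S"
proof -
  show disj: "M \<inter> N = {}"
    using v by (auto simp: vmoves_def hresult_def)
  have hM: "c \<in> M \<longrightarrow> (c \<in> S \<or> c + int n \<in> M) \<and> c - int n \<notin> S" for c
    using h by (simp add: hmoves_def)
  have res: "c \<in> hresult n S M \<longleftrightarrow> (c \<in> S \<or> c + int n \<in> M) \<and> c \<notin> M" for c
    by (simp add: hresult_def)
  have vN: "c \<in> N \<longrightarrow> c \<in> hresult n S M \<and> (c - int n \<notin> hresult n S M \<or> c - int n \<in> N)" for c
    using v by (simp add: vmoves_def)
  have U: "c \<in> U \<longleftrightarrow> c \<in> hresult n S M \<and> c \<notin> N \<or> c + int n \<in> N" for c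
    by (simp add: U_def vresult_def)
  have "of_bool (c \<in> M \<union> N) + of_bool (c \<in> U) =
      (of_bool (c + int n \<in> M \<union> N) + of_bool (c \<in> S) :: nat)" for c
  proof -
    have "(if c \<in> M \<or> c \<in> N then if c + int n \<in> M \<or> c + int n \<in> N then c \<in> U \<longleftrightarrow> c \<in> S else c \<notin> U \<and> c \<in> S
       else if c + int n \<in> M \<or> c + int n \<in> N then c \<in> U \<and> c \<notin> S else c \<in> U \<longleftrightarrow> c \<in> S)"
      using hM [of c] hM [of "c + int n"] vN [of c] vN [of "c + int n"] U [of c]
      unfolding res add_diff_cancel_right' by argo
    then show ?thesis
      unfolding Un_iff of_bool_def by (auto split: if_splits)
  qed
  then show "flow n S U (M \<union> N)"
    using h v by (simp add: flow_def hmoves_def vmoves_def)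
  show "x \<in> M \<longleftrightarrow> x - int n \<notin> S" if "x \<in> M \<union> N" "x - int n \<in> M \<union> N" for x
    using that hM [of x] hM [of "x - int n"] vN [of x] vN [of "x - int n"]
    unfolding res diff_add_cancel Un_iff by argo
qed

text \<open>No condition is imposed on steps \<open>x\<close> with \<open>x - int n\<close> outside
  \<open>F\<close>, so both types are possible for them. All claims are propositional in the
  occupations of \<open>c - int n\<close>, \<open>c\<close> and \<open>c + int n\<close>.\<close>

lemma flow_moves:
  assumes F: "flow n S U F" and "M \<subseteq> F"
    and M: "\<And>x. x \<in> F \<Longrightarrow> x - int n \<in> F \<Longrightarrow> x \<in> M \<longleftrightarrow> x - int n \<notin> S"
  shows "hmoves n S M" "vmoves n (hresult n S M) (F - M)" "vresult n (hresult n S M) (F - M) = U"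
proof -
  have fin: "finite F"
    using F by (simp add: flow_def)
  have at: "(c \<in> F \<and> c + int n \<in> F \<and> (c \<in> U \<longleftrightarrow> c \<in> S)) \<or> (c \<in> F \<and> c + int n \<notin> F \<and> c \<notin> U \<and> c \<in> S) \<or>
      (c \<notin> F \<and> c + int n \<in> F \<and> c \<in> U \<and> c \<notin> S) \<or> (c \<notin> F \<and> c + int n \<notin> F \<and> (c \<in> U \<longleftrightarrow> c \<in> S))" for c
    by (cases rule: flow_cases [OF F, of c]) auto
  have MF: "c \<in> M \<longrightarrow> c \<in> F" "c \<in> F \<and> c + int n \<in> F \<longrightarrow> (c + int n \<in> M \<longleftrightarrow> c \<notin> S)" for c
    using \<open>M \<subseteq> F\<close> M [of "c + int n"] by auto
  have "(c \<in> S \<or> c + int n \<in> M) \<and> c - int n \<notin> S" if "c \<in> M" for c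
    using that at [of c] at [of "c - int n"] MF(1) [of c] MF [of "c + int n"] MF(2) [of c] MF(2) [of "c - int n"]
    unfolding diff_add_cancel by argo
  then show "hmoves n S M"
    using finite_subset [OF \<open>M \<subseteq> F\<close> fin] unfolding hmoves_def by blast
  have res: "c \<in> hresult n S M \<longleftrightarrow> (c \<in> S \<or> c + int n \<in> M) \<and> c \<notin> M" for c
    by (simp add: hresult_def)
  have "c \<in> hresult n S M \<and> (c - int n \<notin> hresult n S M \<or> c - int n \<in> F - M)" if "c \<in> F - M" for c
    using that at [of c] at [of "c - int n"] MF(1) [of c] MF [of "c + int n"] MF(2) [of c] MF [of "c - int n"]
    unfolding diff_add_cancel res Diff_iff by argo
  then show "vmoves n (hresult n S M) (F - M)"
    using fin unfolding vmoves_def by blast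
  have "c \<in> vresult n (hresult n S M) (F - M) \<longleftrightarrow> c \<in> U" for c
    using at [of c] MF [of c] MF(1) [of "c + int n"]
    unfolding vresult_def mem_Collect_eq res Diff_iff
    by (cases "c \<in> F"; cases "c + int n \<in> F"; cases "c \<in> S"; cases "c \<in> M"; cases "c + int n \<in> M"; simp)
  then show "vresult n (hresult n S M) (F - M) = U"
    by blast
qed

text \<open>The factor of a vertical move is \<open>- w\<close> for \<open>w = v Z\<close> with
  \<open>v = t\<^sup>2\<close>.\<close>

definition move_weight :: "nat \<Rightarrow> complex \<Rightarrow> complex \<Rightarrow> int set \<Rightarrow> int set \<Rightarrow> int set \<Rightarrow> complex" where
  "move_weight n t Z S M N =
     t ^ (hspin n S M + vspin n (hresult n S M) N) * Z ^ card M * (- (t\<^sup>2 * Z)) ^ card N"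

text \<open>Double counting of the pairs with \<open>x - int n < c < x\<close>: on the left by the
  step \<open>c\<close> that passes the end of \<open>x\<close>, on the right by the step
  \<open>x\<close> whose interval contains \<open>c\<close>.\<close>

lemma prod_power_crossings:
  fixes t :: "'a::comm_monoid_mult" and F X :: "int set"
  assumes "finite F" "finite X"
  shows "(\<Prod>c\<in>F. t ^ card {x \<in> X. x - int n \<in> {c - int n<..<c}}) =
    (\<Prod>x\<in>X. t ^ card ({x - int n<..<x} \<inter> F))"
proof -
  have card_eq: "card {x \<in> A. P x} = (\<Sum>x\<in>A. of_bool (P x))" if "finite A" for A :: "int set" and P
    using that by (simp add: sum_of_bool_eq Int_def)
  have "(\<Sum>c\<in>F. card {x \<in> X. x - int n \<in> {c - int n<..<c}}) =
    (\<Sum>c\<in>F. \<Sum>x\<in>X. of_bool (x - int n \<in> {c - int n<..<c}))"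
    by (simp only: card_eq [OF assms(2)])
  also have "\<dots> = (\<Sum>x\<in>X. \<Sum>c\<in>F. of_bool (x - int n \<in> {c - int n<..<c}))"
    by (rule sum.swap)
  also have "\<dots> = (\<Sum>x\<in>X. card {c \<in> F. x - int n \<in> {c - int n<..<c}})"
    by (simp only: card_eq [OF assms(1)])
  also have "\<dots> = (\<Sum>x\<in>X. card ({x - int n<..<x} \<inter> F))"
    by (intro sum.cong refl arg_cong [where f = card]) auto
  finally show ?thesis
    by (simp add: power_sum [symmetric])
qed

text \<open>\<open>L\<close> are the last steps, whose type is free, \<open>A\<close> the forced
  horizontal and \<open>B\<close> the forced vertical ones; \<open>X\<close> is the set of last
  steps chosen to be horizontal. The weight is arranged so that the dependence on \<open>X\<close>
  is a product over \<open>L\<close> of independent factors, which makes the sum over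
  \<open>X\<close> computable.\<close>

lemma move_weight_eq:
  assumes t: "t \<noteq> 0" and F: "flow n S U F"
  defines "L \<equiv> {x \<in> F. x - int n \<notin> F}"
  defines "A \<equiv> {x \<in> F. x - int n \<in> F \<and> x - int n \<notin> S}"
  defines "B \<equiv> {x \<in> F. x - int n \<in> F \<and> x - int n \<in> S}"
  defines "cr \<equiv> \<lambda>x. card ({x - int n<..<x} \<inter> F)"
  assumes X: "X \<subseteq> L"
  shows "move_weight n t Z S (X \<union> A) (F - (X \<union> A)) =
    Z ^ card F *
    (\<Prod>c\<in>F. t ^ card {d \<in> {c - int n<..<c}. d \<in> S \<or> d \<in> F \<and> d + int n \<in> F}) *
    (\<Prod>c\<in>B. - t\<^sup>2 / t ^ cr c) * ((\<Prod>x\<in>X. t ^ cr x) * (\<Prod>x\<in>L - X. - t\<^sup>2 / t ^ cr x))"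
proof -
  define M where "M = X \<union> A"
  define K where "K = hresult n S M"
  have fin: "finite F"
    using F by (simp add: flow_def)
  have sub: "M \<subseteq> F"
    using X by (auto simp: M_def L_def A_def)
  have "x \<in> M \<longleftrightarrow> x - int n \<notin> S" if "x \<in> F" "x - int n \<in> F" for x
    using that X by (auto simp: M_def L_def A_def)
  note mv = flow_moves [OF F sub this]
  have finM: "finite M" "finite X" "finite L" "finite B"
    using sub fin X finite_subset [of X F] by (auto simp: finite_subset L_def B_def)
  define a where "a = (\<lambda>c. card {d \<in> {c - int n<..<c}. d \<in> S \<or> d + int n \<in> M})"
  \<comment> \<open>\<open>a c\<close> is the number of particles that \<open>c\<close> would pass
    as a horizontal step. Only particles already brought to rest by a step of \<open>X\<close>
    depend on the choice of \<open>X\<close>, and their end columns lie outside \<open>S\<close> and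
    \<open>F\<close>.\<close>
  have a_split: "a c = card {d \<in> {c - int n<..<c}. d \<in> S \<or> d \<in> F \<and> d + int n \<in> F} +
      card {x \<in> X. x - int n \<in> {c - int n<..<c}}" for c
  proof -
    have eq: "{d \<in> {c - int n<..<c}. d \<in> S \<or> d + int n \<in> M} =
       {d \<in> {c - int n<..<c}. d \<in> S \<or> d \<in> F \<and> d + int n \<in> F} \<union> {d \<in> {c - int n<..<c}. d + int n \<in> X}"
      by (auto simp: M_def A_def)
    have notS: "d \<notin> S \<and> d \<notin> F" if "d + int n \<in> X" for d
      using that X by (cases rule: flow_cases [OF F, of d]) (auto simp: L_def)
    have "bij_betw (\<lambda>d. d + int n) {d \<in> {c - int n<..<c}. d + int n \<in> X} {x \<in> X. x - int n \<in> {c - int n<..<c}}"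
      by (rule bij_betw_byWitness [where f' = "\<lambda>x. x - int n"]) auto
    then have "card {d \<in> {c - int n<..<c}. d + int n \<in> X} = card {x \<in> X. x - int n \<in> {c - int n<..<c}}"
      by (rule bij_betw_same_card)
    moreover have "finite {d \<in> {c - int n<..<c}. P d}" for P
      using finite_greaterThanLessThan_int by (rule finite_subset [rotated]) blast
    ultimately show ?thesis
      unfolding a_def eq using notS by (subst card_Un_disjoint) auto
  qed
  \<comment> \<open>When \<open>c\<close> moves vertically, all particles at starts inside its
    interval have already left, so \<open>cr c\<close> of those counted by \<open>a c\<close> are
    missing.\<close>
  have b: "card {d \<in> {c - int n<..<c}. d \<in> K \<and> d \<notin> F - M} + cr c = a c" for c
  proof -
    have "{d \<in> {c - int n<..<c}. d \<in> K \<and> d \<notin> F - M} \<union> ({c - int n<..<c} \<inter> F) =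
        {d \<in> {c - int n<..<c}. d \<in> S \<or> d + int n \<in> M}"
      using mv(1,2) sub by (auto simp: K_def hresult_def hmoves_def vmoves_def)
    moreover have "{d \<in> {c - int n<..<c}. d \<in> K \<and> d \<notin> F - M} \<inter> ({c - int n<..<c} \<inter> F) = {}"
      by (auto simp: K_def hresult_def)
    moreover have "finite {d \<in> {c - int n<..<c}. d \<in> K \<and> d \<notin> F - M}"
      using finite_greaterThanLessThan_int by (rule finite_subset [rotated]) blast
    ultimately show ?thesis
      using card_Un_disjoint [of "{d \<in> {c - int n<..<c}. d \<in> K \<and> d \<notin> F - M}" "{c - int n<..<c} \<inter> F"]
      unfolding a_def cr_def by (simp only: finite_Int finite_greaterThanLessThan_int simp_thms)
  qed
  have tb: "t ^ card {d \<in> {c - int n<..<c}. d \<in> K \<and> d \<notin> F - M} = t ^ a c / t ^ cr c" for c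
    using t b [of c, symmetric] by (simp add: power_add)
  have FM: "F - M = (L - X) \<union> B" "(L - X) \<inter> B = {}"
    using X by (auto simp: M_def L_def A_def B_def)
  have cardF: "card M + card (F - M) = card F"
    using sub fin by (metis card_Diff_subset card_mono finite_subset le_add_diff_inverse)
  have "- (t\<^sup>2 * Z) = - t\<^sup>2 * Z"
    by simp
  then have neg: "(- (t\<^sup>2 * Z)) ^ card (F - M) = (\<Prod>c\<in>F - M. - t\<^sup>2) * Z ^ card (F - M)"
    by (simp only: power_mult_distrib prod_constant)
  have "move_weight n t Z S M (F - M) =
    Z ^ card M * Z ^ card (F - M) * ((\<Prod>c\<in>M. t ^ a c) * ((\<Prod>c\<in>F - M. t ^ a c / t ^ cr c) * (\<Prod>c\<in>F - M. - t\<^sup>2)))"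
    unfolding move_weight_def hspin_def vspin_def power_add power_sum K_def [symmetric] tb a_def [symmetric] neg
    by (simp only: mult_ac)
  also have "\<dots> = Z ^ card F * ((\<Prod>c\<in>M. t ^ a c) * (\<Prod>c\<in>F - M. t ^ a c * (- t\<^sup>2 / t ^ cr c)))"
    unfolding cardF [symmetric] power_add prod.distrib [symmetric] by simp
  also have "\<dots> = Z ^ card F * ((\<Prod>c\<in>F. t ^ a c) * (\<Prod>c\<in>F - M. - t\<^sup>2 / t ^ cr c))"
    unfolding prod.distrib prod.subset_diff [OF sub fin, of "\<lambda>c. t ^ a c"] by (simp only: mult_ac)
  also have "(\<Prod>c\<in>F. t ^ a c) =
     (\<Prod>c\<in>F. t ^ card {d \<in> {c - int n<..<c}. d \<in> S \<or> d \<in> F \<and> d + int n \<in> F}) * (\<Prod>x\<in>X. t ^ cr x)"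
    unfolding a_split power_add prod.distrib prod_power_crossings [OF fin finM(2)] cr_def by simp
  also have "(\<Prod>c\<in>F - M. - t\<^sup>2 / t ^ cr c) = (\<Prod>x\<in>L - X. - t\<^sup>2 / t ^ cr x) * (\<Prod>c\<in>B. - t\<^sup>2 / t ^ cr c)"
    unfolding FM(1) using FM(2) finM by (intro prod.union_disjoint) auto
  finally show ?thesis
    unfolding M_def by (simp only: mult_ac)
qed

text \<open>The smallest \<open>x\<close> whose interval contains another start works: if
  \<open>x - int n\<close> were a start or there were two starts inside, one of the starts inside
  would itself be a smaller such element.\<close>

lemma not_separated_obtain:
  assumes n: "n \<ge> 1" and fin: "finite F" and "\<not> separated n F"
  obtains x where "x \<in> F" "x - int n \<notin> F" "card ({x - int n<..<x} \<inter> F) = 1"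
proof -
  define E where "E = {x \<in> F. {x - int n<..<x} \<inter> F \<noteq> {}}"
  obtain x y where "x \<in> F" "y \<in> F" "y < x" "\<not> y + int n \<le> x"
    using assms(3) by (auto simp: separated_def)
  then have "x \<in> F" "y \<in> {x - int n<..<x} \<inter> F"
    by auto
  then have "x \<in> E"
    unfolding E_def by blast
  then have "E \<noteq> {}" "finite E"
    using fin by (auto simp: E_def)
  define x where "x = Min E"
  have xE: "x \<in> E"
    using \<open>E \<noteq> {}\<close> \<open>finite E\<close> by (simp add: x_def)
  have min: "y \<notin> E" if "y < x" for y
    using that \<open>finite E\<close> by (auto simp: x_def dest: Min_le)
  obtain d where d: "d \<in> F" "x - int n < d" "d < x"
    using xE by (auto simp: E_def)
  have notF: "x - int n \<notin> F"
  proof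
    assume "x - int n \<in> F"
    then have "x - int n \<in> {d - int n<..<d} \<inter> F"
      using d by auto
    then have "d \<in> E"
      unfolding E_def using d(1) by blast
    then show False
      using min d(3) by blast
  qed
  have "d' = d" if "d' \<in> F" "x - int n < d'" "d' < x" for d'
  proof (rule ccontr)
    assume "d' \<noteq> d"
    then consider "d < d'" | "d' < d"
      by linarith
    then show False
    proof cases
      case 1
      then have "d \<in> {d' - int n<..<d'} \<inter> F"
        using that d by auto
      then show False
        using min [of d'] that by (auto simp: E_def)
    next
      case 2
      then have "d' \<in> {d - int n<..<d} \<inter> F"
        using that d by auto
      then show False
        using min [of d] d by (auto simp: E_def)
    qed
  qed
  then have "{x - int n<..<x} \<inter> F = {d}"
    unfolding set_eq_iff Int_iff greaterThanLessThan_iff singleton_iff using d by blast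
  then show ?thesis
    using that [OF _ notF] xE by (simp add: E_def)
qed

lemma sum_move_weight:
  assumes n: "n \<ge> 1" and t: "t \<noteq> 0"
  shows "(\<Sum>(M, N) | hmoves n S M \<and> vmoves n (hresult n S M) N \<and> vresult n (hresult n S M) N = U.
     move_weight n t Z S M N) = ice n t Z S U"
proof (cases "\<exists>F. flow n S U F")
  case False
  then have *: "{(M, N). hmoves n S M \<and> vmoves n (hresult n S M) N \<and> vresult n (hresult n S M) N = U} = {}"
    using moves_flow(1) by blast
  show ?thesis
    unfolding * using False by (simp add: ice_eq_0_if_no_flow [OF n])
next
  case True
  then obtain F where F: "flow n S U F"
    by blast
  define L where "L = {x \<in> F. x - int n \<notin> F}"
  define A where "A = {x \<in> F. x - int n \<in> F \<and> x - int n \<notin> S}"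
  define B where "B = {x \<in> F. x - int n \<in> F \<and> x - int n \<in> S}"
  define cr where "cr = (\<lambda>x. card ({x - int n<..<x} \<inter> F))"
  define C where "C = Z ^ card F *
    (\<Prod>c\<in>F. t ^ card {d \<in> {c - int n<..<c}. d \<in> S \<or> d \<in> F \<and> d + int n \<in> F}) *
    (\<Prod>c\<in>B. - t\<^sup>2 / t ^ cr c)"
  have fin: "finite F" "finite L" "finite A" "finite B"
    using F by (simp_all add: flow_def L_def A_def B_def)
  let ?g = "\<lambda>X. (X \<union> A, F - (X \<union> A))"
  have LA: "L \<inter> A = {}"
    by (auto simp: L_def A_def)
  have pairs: "{(M, N). hmoves n S M \<and> vmoves n (hresult n S M) N \<and> vresult n (hresult n S M) N = U} =
      ?g ` Pow L"
  proof (intro equalityI subsetI)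
    fix p assume "p \<in> {(M, N). hmoves n S M \<and> vmoves n (hresult n S M) N \<and> vresult n (hresult n S M) N = U}"
    then obtain M N where p: "p = (M, N)" "hmoves n S M" "vmoves n (hresult n S M) N"
      "vresult n (hresult n S M) N = U"
      by blast
    have "M \<union> N = F"
      using moves_flow(1) [OF p(2,3)] p(4) flow_unique [OF n F] by simp
    with moves_flow(2,3) [OF p(2,3)]
    have MN: "N = F - M" "M \<subseteq> F" "\<And>x. x \<in> F \<Longrightarrow> x - int n \<in> F \<Longrightarrow> x \<in> M \<longleftrightarrow> x - int n \<notin> S"
      by auto
    then have "M = (M \<inter> L) \<union> A"
      by (auto simp: L_def A_def)
    then show "p \<in> ?g ` Pow L"
      using p(1) MN(1) by (intro image_eqI [of _ _ "M \<inter> L"]) auto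
  next
    fix p assume "p \<in> ?g ` Pow L"
    then obtain X where X: "X \<subseteq> L" "p = ?g X"
      by blast
    then have "X \<union> A \<subseteq> F" "\<And>x. x \<in> F \<Longrightarrow> x - int n \<in> F \<Longrightarrow> x \<in> X \<union> A \<longleftrightarrow> x - int n \<notin> S"
      by (auto simp: L_def A_def)
    from flow_moves [OF F this]
    show "p \<in> {(M, N). hmoves n S M \<and> vmoves n (hresult n S M) N \<and> vresult n (hresult n S M) N = U}"
      by (simp add: X(2))
  qed
  have inj: "inj_on ?g (Pow L)"
    using LA by (auto simp: inj_on_def)
  have "(\<Sum>(M, N) | hmoves n S M \<and> vmoves n (hresult n S M) N \<and> vresult n (hresult n S M) N = U.
     move_weight n t Z S M N) = (\<Sum>X\<in>Pow L. move_weight n t Z S (X \<union> A) (F - (X \<union> A)))"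
    unfolding pairs by (subst sum.reindex [OF inj]) simp
  also have "\<dots> = (\<Sum>X\<in>Pow L. C * ((\<Prod>x\<in>X. t ^ cr x) * (\<Prod>x\<in>L - X. - t\<^sup>2 / t ^ cr x)))"
    unfolding C_def B_def cr_def A_def
    by (rule sum.cong [OF refl], subst move_weight_eq [OF t F]) (auto simp: L_def)
  \<comment> \<open>The sum over \<open>X\<close> is the expansion of a product of two-term sums,
    one for each last step.\<close>
  also have "\<dots> = C * (\<Prod>x\<in>L. t ^ cr x + - t\<^sup>2 / t ^ cr x)"
    unfolding prod_add [OF fin(2)] sum_distrib_left ..
  also have "\<dots> = ice n t Z S U"
  proof (cases "separated n F")
    case False
    obtain x where "x \<in> F" "x - int n \<notin> F" "card ({x - int n<..<x} \<inter> F) = 1"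
      using not_separated_obtain [OF n fin(1) False] .
    \<comment> \<open>This is the cancellation at k = 1: the factor is
      \<open>t - t\<^sup>2 / t\<close>.\<close>
    then have "x \<in> L" "t ^ cr x + - t\<^sup>2 / t ^ cr x = 0"
      using t by (simp_all add: L_def cr_def power2_eq_square)
    then have "(\<Prod>x\<in>L. t ^ cr x + - t\<^sup>2 / t ^ cr x) = 0"
      using fin(2) by (rule_tac prod_zero) auto
    then show ?thesis
      by (simp add: ice_eq_0_if_not_separated [OF n F False])
  next
    case True
    \<comment> \<open>Without overlaps \<open>cr\<close> vanishes, and the classes \<open>L\<close>,
      \<open>A\<close> and \<open>B\<close> give exactly the three last factors
      \<open>1 - t\<^sup>2\<close>, 1 and \<open>- t\<^sup>2\<close> of the ice weight.\<close>
    have empty: "{x - int n<..<x} \<inter> F = {}" if "x \<in> F" for x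
      using True that by (force simp: separated_def)
    have B: "(\<Prod>c\<in>B. - t\<^sup>2 / t ^ cr c) = (\<Prod>c\<in>B. - t\<^sup>2)"
      by (intro prod.cong refl) (simp add: B_def cr_def empty)
    have L: "(\<Prod>x\<in>L. t ^ cr x + - t\<^sup>2 / t ^ cr x) = (\<Prod>x\<in>L. 1 - t\<^sup>2)"
      by (intro prod.cong refl) (simp add: L_def cr_def empty)
    have "{d \<in> {c - int n<..<c}. d \<in> S \<or> d \<in> F \<and> d + int n \<in> F} = {d \<in> {c - int n<..<c}. d \<in> S}"
      if "c \<in> F" for c
      using empty [OF that] by auto
    then have a: "(\<Prod>c\<in>F. t ^ card {d \<in> {c - int n<..<c}. d \<in> S \<or> d \<in> F \<and> d + int n \<in> F}) =
        (\<Prod>c\<in>F. t ^ card {d \<in> {c - int n<..<c}. d \<in> S})"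
      by (intro prod.cong refl) simp
    let ?u = "\<lambda>x. if x - int n \<in> F then if x - int n \<in> S then - t\<^sup>2 else 1 else 1 - t\<^sup>2"
    have "(\<Prod>x\<in>F. ?u x) = (\<Prod>x\<in>L \<union> (A \<union> B). ?u x)"
      by (rule prod.cong) (auto simp: L_def A_def B_def)
    also have "\<dots> = (\<Prod>x\<in>L. ?u x) * ((\<Prod>x\<in>A. ?u x) * (\<Prod>x\<in>B. ?u x))"
      using fin by (subst prod.union_disjoint; (subst prod.union_disjoint)?) (auto simp: L_def A_def B_def)
    also have "\<dots> = (\<Prod>x\<in>L. 1 - t\<^sup>2) * ((\<Prod>x\<in>A. 1) * (\<Prod>x\<in>B. - t\<^sup>2))"
      by (intro arg_cong2 [where f = "(*)"] prod.cong refl) (auto simp: L_def A_def B_def)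
    finally have u: "(\<Prod>x\<in>F. ?u x) = (\<Prod>x\<in>L. 1 - t\<^sup>2) * (\<Prod>x\<in>B. - t\<^sup>2)"
      by simp
    have "ice n t Z S U = Z ^ card F * (\<Prod>c\<in>F. t ^ card {d \<in> {c - int n<..<c}. d \<in> S}) * (\<Prod>x\<in>F. ?u x)"
      unfolding ice_eq_flow_prod [OF n F True] prod.distrib by simp
    then show ?thesis
      unfolding C_def B L a u by (simp only: mult_ac)
  qed
  finally show ?thesis .
qed

section \<open>Partitions as sets of columns\<close>

definition count_above :: "int set \<Rightarrow> int \<Rightarrow> nat" where
  "count_above S x = card {c \<in> S. x < c}"

text \<open>The second condition fixes the charge: far down, the count agrees with that of the empty
  partition, whose columns are 0, -1, -2, and so on.\<close>

definition maya :: "int set \<Rightarrow> bool" where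
  "maya S \<longleftrightarrow> (\<forall>x. finite {c \<in> S. x < c}) \<and> (\<exists>l. \<forall>x\<le>l. int (count_above S x) = - x)"

lemma maya_finite: "maya S \<Longrightarrow> finite {c \<in> S. x < c}"
  by (simp add: maya_def)

lemma count_above_step:
  assumes "finite {c \<in> S. x < c}"
  shows "count_above S (x - 1) = count_above S x + of_bool (x \<in> S)"
proof (cases "x \<in> S")
  case True
  then have "{c \<in> S. x - 1 < c} = insert x {c \<in> S. x < c}"
    by auto
  with assms True show ?thesis
    by (simp add: count_above_def)
next
  case False
  then have "c \<noteq> x" if "c \<in> S" for c
    using that by auto
  then have "{c \<in> S. x - 1 < c} = {c \<in> S. x < c}"
    by force
  with False show ?thesis
    by (simp add: count_above_def)
qed

lemma mem_iff_count_above: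
  assumes "finite {c \<in> S. x < c}"
  shows "x \<in> S \<longleftrightarrow> count_above S (x - 1) \<noteq> count_above S x"
  using count_above_step [OF assms] by simp

lemma count_above_antimono:
  assumes "\<And>x. finite {c \<in> S. x < c}" "x \<le> y"
  shows "count_above S y \<le> count_above S x"
  unfolding count_above_def by (rule card_mono) (use assms in auto)

lemma count_above_le_add:
  assumes "\<And>x. finite {c \<in> S. x < c}" "x \<le> y"
  shows "int (count_above S x) \<le> int (count_above S y) + (y - x)"
proof -
  have "card {c \<in> S. x < c} \<le> card ({c \<in> S. y < c} \<union> {x<..y})"
    by (rule card_mono) (use assms in auto)
  also have "\<dots> \<le> card {c \<in> S. y < c} + card {x<..y}"
    by (rule card_Un_le)
  finally show ?thesis
    using assms(2) by (simp add: count_above_def)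
qed

lemma count_above_ge:
  assumes "maya S"
  shows "- x \<le> int (count_above S x)"
proof -
  obtain l where l: "\<And>x. x \<le> l \<Longrightarrow> int (count_above S x) = - x"
    using assms by (auto simp: maya_def)
  show ?thesis
  proof (cases "x \<le> l")
    case False
    then show ?thesis
      using count_above_le_add [of S l x] l [of l] maya_finite [OF assms] by simp
  qed (simp add: l)
qed

lemma part_antimono: "i \<le> j \<Longrightarrow> part lam j \<le> part lam i"
  using part [of lam] by (simp add: antimono_def)

lemma columns_injective: "inj (\<lambda>i. int (part lam i) - int i)"
proof (rule injI)
  fix i j assume *: "int (part lam i) - int i = int (part lam j) - int j"
  show "i = j"
    using * part_antimono [of i j lam] part_antimono [of j i lam] by (cases "i \<le> j") auto
qed

lemma finite_columns_above: "finite {i. x < int (part lam i) - int i}"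
proof (rule finite_subset)
  show "{i. x < int (part lam i) - int i} \<subseteq> {..nat (int (part lam 0) - x)}"
  proof
    fix i assume "i \<in> {i. x < int (part lam i) - int i}"
    then show "i \<in> {..nat (int (part lam 0) - x)}"
      using part_antimono [of 0 i lam] by auto
  qed
qed simp

lemma columns_above_eq: "{c \<in> columns lam. x < c} = (\<lambda>i. int (part lam i) - int i) ` {i. x < int (part lam i) - int i}"
  by (auto simp: columns_def)

text \<open>The numbers \<open>int (part lam i) - int i\<close> decrease strictly in
  \<open>i\<close>, so those above \<open>x\<close> belong to an initial segment of indices.\<close>

lemma less_count_above_columns:
  "i < count_above (columns lam) x \<longleftrightarrow> x < int (part lam i) - int i"
proof -
  let ?I = "{i. x < int (part lam i) - int i}"
  have down: "j \<in> ?I" if "i \<in> ?I" "j \<le> i" for i j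
    using that part_antimono [of j i lam] by auto
  have card: "count_above (columns lam) x = card ?I"
    unfolding count_above_def columns_above_eq
    by (rule card_image) (rule inj_on_subset [OF columns_injective], simp)
  show ?thesis
  proof
    assume "x < int (part lam i) - int i"
    then have "{..i} \<subseteq> ?I"
      using down by blast
    then have "card {..i} \<le> card ?I"
      by (rule card_mono [OF finite_columns_above])
    then show "i < count_above (columns lam) x"
      by (simp add: card)
  next
    assume *: "i < count_above (columns lam) x"
    show "x < int (part lam i) - int i"
    proof (rule ccontr)
      assume "\<not> x < int (part lam i) - int i"
      then have "?I \<subseteq> {..<i}"
        using down by (metis (mono_tags, lifting) lessThan_iff linorder_not_less mem_Collect_eq subsetI)
      then have "card ?I \<le> card {..<i}"
        by (rule card_mono [rotated]) simp
      with * show False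
        by (simp add: card)
    qed
  qed
qed

text \<open>On each diagonal the diagram is cut off at a row given by \<open>count_above\<close>.
  Containment, skew shapes and ribbons thereby become statements on this single counting
  function.\<close>

lemma mem_diagram_iff:
  "(i, j) \<in> diagram lam \<longleftrightarrow> i < count_above (columns lam) (int j - int i)"
  by (simp add: less_count_above_columns diagram_def)

lemma maya_columns: "maya (columns lam)"
  unfolding maya_def
proof (intro conjI allI)
  fix x show "finite {c \<in> columns lam. x < c}"
    unfolding columns_above_eq by (intro finite_imageI finite_columns_above)
next
  have "finite {i. part lam i \<noteq> 0}"
    using part [of lam] by simp
  then obtain k where k: "\<And>i. i \<in> {i. part lam i \<noteq> 0} \<Longrightarrow> i < k"
    using finite_nat_set_iff_bounded by auto
  have "int (count_above (columns lam) x) = - x" if "x \<le> - int k" for x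
  proof -
    have "i < count_above (columns lam) x \<longleftrightarrow> i < nat (- x)" for i
      unfolding less_count_above_columns using that k [of i] by (cases "part lam i = 0") auto
    then have "count_above (columns lam) x = nat (- x)"
      by (metis linorder_neqE_nat less_irrefl)
    then show ?thesis
      using that by simp
  qed
  then show "\<exists>l. \<forall>x\<le>l. int (count_above (columns lam) x) = - x"
    by blast
qed

lemmas finite_columns = maya_finite [OF maya_columns]
lemmas columns_step = count_above_step [OF finite_columns]
lemmas columns_antimono = count_above_antimono [OF finite_columns]
lemmas columns_ge = count_above_ge [OF maya_columns]

lemma count_above_inject:
  assumes "maya S" "maya S'" "\<And>x. count_above S x = count_above S' x"
  shows "S = S'"
  using assms mem_iff_count_above [OF maya_finite [OF assms(1)]]
    mem_iff_count_above [OF maya_finite [OF assms(2)]] by auto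

lemma diagram_subset_iff:
  "diagram mu \<subseteq> diagram lam \<longleftrightarrow>
     (\<forall>x. count_above (columns mu) x \<le> count_above (columns lam) x)"
proof
  assume "\<forall>x. count_above (columns mu) x \<le> count_above (columns lam) x"
  then show "diagram mu \<subseteq> diagram lam"
    using less_le_trans by (force simp: mem_diagram_iff)
next
  assume sub: "diagram mu \<subseteq> diagram lam"
  show "\<forall>x. count_above (columns mu) x \<le> count_above (columns lam) x"
  proof (rule allI, rule ccontr)
    fix x assume *: "\<not> count_above (columns mu) x \<le> count_above (columns lam) x"
    \<comment> \<open>The first box of content \<open>x\<close> beyond \<open>lam\<close>; its
      column is nonnegative by \<open>columns_ge\<close>.\<close>
    define i where "i = count_above (columns lam) x"
    have "(i, nat (x + int i)) \<in> diagram mu"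
      using * columns_ge [of x lam] by (simp add: mem_diagram_iff i_def)
    then have "(i, nat (x + int i)) \<in> diagram lam"
      using sub by blast
    then show False
      using columns_ge [of x lam] by (simp add: mem_diagram_iff i_def)
  qed
qed

lemma diagram_inject:
  assumes "diagram lam = diagram mu"
  shows "lam = mu"
proof -
  have "j < part lam i \<longleftrightarrow> j < part mu i" for i j
    using assms by (auto simp: diagram_def set_eq_iff)
  then have "part lam i = part mu i" for i
    by (metis linorder_neqE_nat less_irrefl)
  then show ?thesis
    by (simp add: part_inject [symmetric] ext)
qed

lemma columns_inject:
  assumes "columns lam = columns mu"
  shows "lam = mu"
  using assms by (intro diagram_inject) (auto simp: mem_diagram_iff)

text \<open>The row lengths are read off from \<open>mem_diagram_iff\<close>. Boxes of content
  \<open>x\<close> only test rows \<open>i\<close> with \<open>- x \<le> int i\<close>; this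
  suffices because both counts are at least \<open>- x\<close>.\<close>

lemma maya_obtains_partition:
  assumes S: "maya S"
  obtains lam where "columns lam = S"
proof -
  note fin = maya_finite [OF S]
  define p where "p = (\<lambda>i. card {j. i < count_above S (int j - int i)})"
  have row: "{j. i < count_above S (int j - int i)} = {..<p i}" for i
  proof -
    let ?J = "{j. i < count_above S (int j - int i)}"
    have sub: "?J \<subseteq> (\<Union>c\<in>{c \<in> S. - int i < c}. {j. int j - int i < c})"
    proof
      fix j assume "j \<in> ?J"
      then have "card {c \<in> S. int j - int i < c} \<noteq> 0"
        by (simp add: count_above_def)
      then have "{c \<in> S. int j - int i < c} \<noteq> {}"
        by (metis card.empty)
      then show "j \<in> (\<Union>c\<in>{c \<in> S. - int i < c}. {j. int j - int i < c})"
        by force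
    qed
    have fin_row: "finite {j. int j - int i < c}" for c
      by (rule finite_subset [of _ "{..<nat (c + int i)}"]) auto
    have finJ: "finite ?J"
      by (rule finite_subset [OF sub], rule finite_UN_I [OF fin fin_row])
    have down: "j' \<in> ?J" if "j \<in> ?J" "j' \<le> j" for j j'
      using that count_above_antimono [OF fin, of "int j' - int i" "int j - int i"] by simp
    show ?thesis
    proof (cases "?J = {}")
      case False
      have "?J = {..Max ?J}"
      proof (intro equalityI subsetI)
        fix j assume "j \<in> {..Max ?J}"
        then show "j \<in> ?J"
          by (intro down [OF Max_in [OF finJ False]]) simp
      qed (use finJ in simp)
      then obtain m where J: "?J = {..<Suc m}"
        unfolding lessThan_Suc_atMost by blast
      have "p i = Suc m"
        unfolding p_def J by simp
      with J show ?thesis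
        by simp
    qed (simp add: p_def)
  qed
  have p_iff: "j < p i \<longleftrightarrow> i < count_above S (int j - int i)" for i j
    using row [of i] by (auto simp: set_eq_iff)
  have anti: "antimono p"
  proof (rule antimonoI, rule ccontr)
    fix i i' :: nat assume "i \<le> i'" "\<not> p i' \<le> p i"
    then have "i' < count_above S (int (p i) - int i')" "\<not> i < count_above S (int (p i) - int i)"
      using p_iff [of "p i" i'] p_iff [of "p i" i] by auto
    then show False
      using count_above_le_add [OF fin, of "int (p i) - int i'" "int (p i) - int i"] \<open>i \<le> i'\<close> by simp
  qed
  obtain l where l: "\<And>x. x \<le> l \<Longrightarrow> int (count_above S x) = - x"
    using S by (auto simp: maya_def)
  have "{i. p i \<noteq> 0} \<subseteq> {..nat (- l)}"
  proof
    fix i assume "i \<in> {i. p i \<noteq> 0}"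
    then have "i < count_above S (- int i)"
      using p_iff [of 0 i] by simp
    then show "i \<in> {..nat (- l)}"
      using l [of "- int i"] by (cases "- int i \<le> l") auto
  qed
  then have "finite {i. p i \<noteq> 0}"
    by (rule finite_subset) simp
  with anti have part: "part (Abs_partition p) = p"
    by (simp add: Abs_partition_inverse)
  have less: "i < count_above (columns (Abs_partition p)) x \<longleftrightarrow> i < count_above S x"
    if "- x \<le> int i" for i x
    using p_iff [of "nat (x + int i)" i] that by (auto simp: less_count_above_columns part)
  have "count_above (columns (Abs_partition p)) x = count_above S x" for x
    using less [of x "count_above S x"] less [of x "count_above (columns (Abs_partition p)) x"]
      count_above_ge [OF S, of x] columns_ge [of x "Abs_partition p"]
    by (metis linorder_neqE_nat less_irrefl)
  then have "columns (Abs_partition p) = S"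
    using count_above_inject maya_columns S by blast
  then show ?thesis
    using that by blast
qed

text \<open>Transposition sends the box in row \<open>i\<close> of content \<open>x\<close> to the
  box in row \<open>x + i\<close> of content \<open>- x\<close>.\<close>

lemma count_above_conjugate:
  "int (count_above (columns (conjugate lam)) x) = int (count_above (columns lam) (- x)) - x"
proof -
  let ?a = "count_above (columns (conjugate lam)) x"
  let ?b = "count_above (columns lam) (- x)"
  have iff: "i < ?a \<longleftrightarrow> x + int i < int ?b" if "0 \<le> x + int i" for i
  proof -
    have "i < ?a \<longleftrightarrow> (i, nat (x + int i)) \<in> diagram (conjugate lam)"
      using that by (simp add: mem_diagram_iff)
    also have "\<dots> \<longleftrightarrow> (nat (x + int i), i) \<in> diagram lam"
      by (force simp: diagram_conjugate image_iff)
    also have "\<dots> \<longleftrightarrow> x + int i < int ?b"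
      using that by (simp add: mem_diagram_iff algebra_simps nat_less_iff)
    finally show ?thesis .
  qed
  have "0 \<le> x + int ?a"
    using columns_ge [of x "conjugate lam"] by simp
  moreover have "0 \<le> int ?b - x"
    using columns_ge [of "- x" lam] by simp
  ultimately show ?thesis
    using iff [of ?a] iff [of "nat (int ?b - x)"] by linarith
qed

text \<open>Conjugation exchanges particles and holes and reverses the line. This follows by
  comparing the preceding identity at \<open>c - 1\<close> and at \<open>c\<close>.\<close>

lemma columns_conjugate: "columns (conjugate lam) = {c. 1 - c \<notin> columns lam}"
proof -
  have "c \<in> columns (conjugate lam) \<longleftrightarrow> 1 - c \<notin> columns lam" for c
    using columns_step [of "conjugate lam" c] columns_step [of lam "1 - c"]
      count_above_conjugate [of lam c] count_above_conjugate [of lam "c - 1"]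
    by (auto simp: of_bool_def split: if_splits)
  then show ?thesis
    by blast
qed

lemma conjugate_conjugate: "conjugate (conjugate lam) = lam"
  by (rule diagram_inject) (simp add: diagram_conjugate image_image)

section \<open>Ribbons\<close>

definition content :: "box \<Rightarrow> int" where
  "content b = int (snd b) - int (fst b)"

definition move :: "nat \<Rightarrow> int \<Rightarrow> int set \<Rightarrow> int set" where
  "move n c S = insert (c - int n) (S - {c})"

lemma mem_diagram_content:
  "b \<in> diagram lam \<longleftrightarrow> fst b < count_above (columns lam) (content b)"
  by (cases b) (simp add: mem_diagram_iff content_def)

lemma box_eq_iff: "b = b' \<longleftrightarrow> fst b = fst b' \<and> content b = content b'"
  by (cases b; cases b') (auto simp: content_def)

lemma count_above_move:
  assumes n: "n \<ge> 1" and fin: "\<And>x. finite {c \<in> S. x < c}" and c: "c \<in> S" "c - int n \<notin> S"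
  shows "int (count_above (move n c S) x) = int (count_above S x) - of_bool (c - int n \<le> x \<and> x < c)"
proof -
  have 1: "{d \<in> move n c S. x < d} = {d \<in> S. x < d}" if "c \<le> x"
    using that n by (auto simp: move_def)
  have 2: "{d \<in> move n c S. x < d} = {d \<in> S. x < d} - {c}" if "c - int n \<le> x" "x < c"
    using that n by (auto simp: move_def)
  have 3: "{d \<in> move n c S. x < d} = insert (c - int n) ({d \<in> S. x < d} - {c})" if "x < c - int n"
    using that n by (auto simp: move_def)
  have "x < c \<Longrightarrow> card {d \<in> S. x < d} \<ge> 1"
    using fin [of x] c by (auto simp: Suc_le_eq card_gt_0_iff)
  then show ?thesis
    using fin [of x] c n
    by (cases "c \<le> x"; cases "c - int n \<le> x")
      (auto simp: count_above_def 1 2 3 of_nat_diff card.insert_remove card_Diff_singleton_if split: if_splits)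
qed

lemma maya_move:
  assumes n: "n \<ge> 1" and S: "maya S" and c: "c \<in> S" "c - int n \<notin> S"
  shows "maya (move n c S)"
proof -
  note fin = maya_finite [OF S]
  obtain l where l: "\<And>x. x \<le> l \<Longrightarrow> int (count_above S x) = - x"
    using S by (auto simp: maya_def)
  have "finite {d \<in> move n c S. x < d}" for x
    by (rule finite_subset [of _ "insert (c - int n) {d \<in> S. x < d}"]) (use fin in \<open>auto simp: move_def\<close>)
  moreover have "int (count_above (move n c S) x) = - x" if "x \<le> min l (c - int n - 1)" for x
    using that l [of x] by (simp add: count_above_move [OF n fin c])
  ultimately show ?thesis
    unfolding maya_def by blast
qed

lemma move_obtains_partition:
  assumes "n \<ge> 1" "c \<in> columns lam" "c - int n \<notin> columns lam"
  obtains lam' where "columns lam' = move n c (columns lam)"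
  using maya_obtains_partition [OF maya_move [OF assms(1) maya_columns assms(2,3)]] .

text \<open>A ribbon contains one box \<open>(\<rho> x, \<rho> x + x)\<close> of each content \<open>x\<close> from \<open>c - n\<close> to \<open>c - 1\<close>.\<close>

definition strip_of :: "nat \<Rightarrow> int \<Rightarrow> (int \<Rightarrow> int) \<Rightarrow> box set" where
  "strip_of n c \<rho> = (\<lambda>x. (nat (\<rho> x), nat (\<rho> x + x))) ` {c - int n..<c}"

text \<open>Here \<open>\<rho> x\<close> is the row of the box of content \<open>x\<close>. Passing
  to content \<open>x - 1\<close> means going one box left, with the same row, or one box
  down.\<close>

definition rim_path :: "nat \<Rightarrow> int \<Rightarrow> (int \<Rightarrow> int) \<Rightarrow> bool" where
  "rim_path n c \<rho> \<longleftrightarrow> (\<forall>x\<in>{c - int n..<c}. 0 \<le> \<rho> x \<and> 0 \<le> \<rho> x + x) \<and>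
     (\<forall>x. c - int n < x \<longrightarrow> x < c \<longrightarrow> \<rho> (x - 1) = \<rho> x \<or> \<rho> (x - 1) = \<rho> x + 1)"

lemma rim_path_mono:
  assumes \<rho>: "rim_path n c \<rho>" and "c - int n \<le> x" "x \<le> y" "y < c"
  shows "\<rho> y \<le> \<rho> x \<and> \<rho> x + x \<le> \<rho> y + y"
  using assms(3,4)
proof (induction y rule: int_ge_induct)
  case (step y)
  moreover have "\<rho> (y + 1 - 1) = \<rho> (y + 1) \<or> \<rho> (y + 1 - 1) = \<rho> (y + 1) + 1"
    using \<rho> step assms(2) unfolding rim_path_def by (metis add.commute add_strict_increasing order_le_less_trans zero_less_one zless_add1_eq)
  ultimately show ?case
    by auto
qed simp

lemma mem_strip_of:
  assumes "rim_path n c \<rho>"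
  shows "b \<in> strip_of n c \<rho> \<longleftrightarrow> c - int n \<le> content b \<and> content b < c \<and> int (fst b) = \<rho> (content b)"
proof
  assume "b \<in> strip_of n c \<rho>"
  then show "c - int n \<le> content b \<and> content b < c \<and> int (fst b) = \<rho> (content b)"
    using assms by (auto simp: strip_of_def rim_path_def content_def)
next
  assume "c - int n \<le> content b \<and> content b < c \<and> int (fst b) = \<rho> (content b)"
  then show "b \<in> strip_of n c \<rho>"
    unfolding strip_of_def by (intro image_eqI [of _ _ "content b"]) (auto simp: content_def prod_eq_iff)
qed

lemma card_strip_of:
  assumes "rim_path n c \<rho>"
  shows "card (strip_of n c \<rho>) = n"
proof -
  have "inj_on (\<lambda>x. (nat (\<rho> x), nat (\<rho> x + x))) {c - int n..<c}"
  proof (rule inj_onI)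
    fix x y assume "x \<in> {c - int n..<c}" "y \<in> {c - int n..<c}"
      and *: "(nat (\<rho> x), nat (\<rho> x + x)) = (nat (\<rho> y), nat (\<rho> y + y))"
    then have "0 \<le> \<rho> x" "0 \<le> \<rho> y" "0 \<le> \<rho> x + x" "0 \<le> \<rho> y + y"
      using assms by (auto simp: rim_path_def)
    then show "x = y"
      using * by (simp add: eq_nat_nat_iff)
  qed
  then show ?thesis
    by (simp add: strip_of_def card_image)
qed

lemma top_right_strip_of:
  assumes n: "n \<ge> 1" and \<rho>: "rim_path n c \<rho>"
  shows "top_right_box (strip_of n c \<rho>) = (nat (\<rho> (c - 1)), nat (\<rho> (c - 1) + (c - 1)))"
proof -
  have mono: "\<rho> (c - 1) \<le> \<rho> x \<and> \<rho> x + x \<le> \<rho> (c - 1) + (c - 1)" if "x \<in> {c - int n..<c}" for x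
    using rim_path_mono [OF \<rho>, of x "c - 1"] that by auto
  have mem: "c - 1 \<in> {c - int n..<c}"
    using n by simp
  have "Min (fst ` strip_of n c \<rho>) = nat (\<rho> (c - 1))"
    unfolding strip_of_def image_image using mem mono by (intro Min_eqI) (auto simp: nat_mono)
  moreover have "Max (snd ` strip_of n c \<rho>) = nat (\<rho> (c - 1) + (c - 1))"
    unfolding strip_of_def image_image using mem mono by (intro Max_eqI) (auto intro: nat_mono)
  ultimately show ?thesis
    by (simp add: top_right_box_def)
qed

lemma connected_strip_of:
  assumes n: "n \<ge> 1" and \<rho>: "rim_path n c \<rho>"
  shows "connected_boxes (strip_of n c \<rho>)"
proof -
  let ?R = "strip_of n c \<rho>"
  let ?r = "{(x, y). x \<in> ?R \<and> y \<in> ?R \<and> adjacent_boxes x y}"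
  let ?b = "\<lambda>x. (nat (\<rho> x), nat (\<rho> x + x))"
  have mem: "?b x \<in> ?R" if "x \<in> {c - int n..<c}" for x
    using that by (auto simp: strip_of_def)
  have adj: "(?b (x - 1), ?b x) \<in> ?r \<and> (?b x, ?b (x - 1)) \<in> ?r" if "c - int n < x" "x < c" for x
  proof -
    have cases: "\<rho> (x - 1) = \<rho> x \<or> \<rho> (x - 1) = \<rho> x + 1"
      and pos: "0 \<le> \<rho> x" "0 \<le> \<rho> (x - 1) + (x - 1)"
      using \<rho> that by (auto simp: rim_path_def)
    have "nat (\<rho> x + x) = Suc (nat (\<rho> x + (x - 1)))" if "\<rho> (x - 1) = \<rho> x"
      using pos that by (subst Suc_nat_eq_nat_zadd1) simp_all
    moreover have "nat (\<rho> x + 1) = Suc (nat (\<rho> x))"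
      using pos by (subst Suc_nat_eq_nat_zadd1) (simp_all add: add.commute)
    moreover have "\<rho> x + 1 + (x - 1) = \<rho> x + x"
      by simp
    ultimately have "adjacent_boxes (?b (x - 1)) (?b x) \<and> adjacent_boxes (?b x) (?b (x - 1))"
      using cases unfolding adjacent_boxes_def fst_conv snd_conv by metis
    moreover have "?b x \<in> ?R" "?b (x - 1) \<in> ?R"
      by (rule mem; use that in simp)+
    ultimately show ?thesis
      by blast
  qed
  have path: "(?b (c - int n), ?b x) \<in> ?r\<^sup>* \<and> (?b x, ?b (c - int n)) \<in> ?r\<^sup>*" if "c - int n \<le> x" "x < c" for x
    using that
  proof (induction x rule: int_ge_induct)
    case (step x)
    then have "(?b x, ?b (x + 1)) \<in> ?r" "(?b (x + 1), ?b x) \<in> ?r"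
      using adj [of "x + 1"] by (simp_all del: mem_Collect_eq)
    moreover have "(?b (c - int n), ?b x) \<in> ?r\<^sup>*" "(?b x, ?b (c - int n)) \<in> ?r\<^sup>*"
      using step by auto
    ultimately show ?case
      by (blast intro: rtrancl_into_rtrancl converse_rtrancl_into_rtrancl)
  qed simp
  show ?thesis
    unfolding connected_boxes_def
  proof (intro ballI)
    fix b b' assume "b \<in> ?R" "b' \<in> ?R"
    then obtain x y where "b = ?b x" "b' = ?b y" "x \<in> {c - int n..<c}" "y \<in> {c - int n..<c}"
      by (auto simp: strip_of_def)
    then show "(b, b') \<in> ?r\<^sup>*"
      using path [of x] path [of y] rtrancl_trans [of b "?b (c - int n)" ?r b'] by (simp del: mem_Collect_eq)
  qed
qed

text \<open>\<open>P\<close> marks the places where a value different from all earlier ones appears,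
  so one plus their number is the number of values.\<close>

lemma card_image_changes:
  fixes f :: "int \<Rightarrow> 'a"
  assumes "\<And>x. a < x \<Longrightarrow> x \<le> a + int k \<Longrightarrow> \<not> P x \<Longrightarrow> f x = f (x - 1)"
    and "\<And>x y. a \<le> y \<Longrightarrow> y < x \<Longrightarrow> x \<le> a + int k \<Longrightarrow> P x \<Longrightarrow> f y \<noteq> f x"
  shows "card (f ` {a..a + int k}) = Suc (card {x. a < x \<and> x \<le> a + int k \<and> P x})"
  using assms
proof (induction k)
  case 0
  have "{x. a < x \<and> x \<le> a \<and> P x} = {}"
    by auto
  then show ?case
    by (simp del: Collect_empty_eq)
next
  case (Suc k)
  let ?z = "a + int (Suc k)"
  have fin: "finite {x. a < x \<and> x \<le> a + int k \<and> P x}"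
    by (rule finite_subset [of _ "{a..a + int k}"]) auto
  have IH: "card (f ` {a..a + int k}) = Suc (card {x. a < x \<and> x \<le> a + int k \<and> P x})"
    by (rule Suc.IH) (use Suc.prems in auto)
  have int: "{a..?z} = insert ?z {a..a + int k}"
    by auto
  show ?case
  proof (cases "P ?z")
    case True
    then have "{x. a < x \<and> x \<le> ?z \<and> P x} = insert ?z {x. a < x \<and> x \<le> a + int k \<and> P x}"
      by (auto simp: le_less)
    moreover have "f ?z \<notin> f ` {a..a + int k}"
      using Suc.prems(2) [of _ ?z] True by fastforce
    ultimately show ?thesis
      unfolding int image_insert using IH fin by simp
  next
    case False
    then have "{x. a < x \<and> x \<le> ?z \<and> P x} = {x. a < x \<and> x \<le> a + int k \<and> P x}"
      by (auto simp: le_less)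
    moreover have "f ?z = f (a + int k)"
      using Suc.prems(1) [of ?z] False by (simp add: algebra_simps)
    then have "f ?z \<in> f ` {a..a + int k}"
      by simp
    ultimately show ?thesis
      unfolding int image_insert using IH by (simp add: insert_absorb)
  qed
qed

text \<open>Walking towards smaller contents, a step down opens a new row and a step left a new
  column. Rows and columns are therefore counted by complementary sets; the column count serves the
  vertical strips.\<close>

lemma ribbon_spin_strip_of:
  assumes n: "n \<ge> 1" and \<rho>: "rim_path n c \<rho>"
    and up: "\<And>x. c - int n < x \<Longrightarrow> x < c \<Longrightarrow> P x \<longleftrightarrow> \<rho> (x - 1) = \<rho> x + 1"
  shows "ribbon_spin (strip_of n c \<rho>) = card {x \<in> {c - int n<..<c}. P x}"
    and "ribbon_spin (prod.swap ` strip_of n c \<rho>) = card {x \<in> {c - int n<..<c}. \<not> P x}"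
proof -
  have int: "{c - int n..<c} = {c - int n..c - int n + int (n - 1)}"
    using n by (auto simp: of_nat_diff)
  have pos: "0 \<le> \<rho> x \<and> 0 \<le> \<rho> x + x" if "c - int n \<le> x" "x < c" for x
    using \<rho> that by (simp add: rim_path_def)
  have step: "\<rho> (x - 1) = \<rho> x \<or> \<rho> (x - 1) = \<rho> x + 1" if "c - int n < x" "x < c" for x
    using \<rho> that by (simp add: rim_path_def)
  have mono: "\<rho> y \<le> \<rho> x \<and> \<rho> x + x \<le> \<rho> y + y" if "c - int n \<le> x" "x \<le> y" "y < c" for x y
    by (rule rim_path_mono [OF \<rho> that])
  have "card ((\<lambda>x. nat (\<rho> x)) ` {c - int n..c - int n + int (n - 1)}) =
    Suc (card {x. c - int n < x \<and> x \<le> c - int n + int (n - 1) \<and> P x})"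
  proof (rule card_image_changes)
    fix x assume "c - int n < x" "x \<le> c - int n + int (n - 1)" "\<not> P x"
    then show "nat (\<rho> x) = nat (\<rho> (x - 1))"
      using step [of x] up [of x] n by (simp add: of_nat_diff)
  next
    fix x y assume *: "c - int n \<le> y" "y < x" "x \<le> c - int n + int (n - 1)" "P x"
    then have "\<rho> (x - 1) = \<rho> x + 1" "\<rho> (x - 1) \<le> \<rho> y" "0 \<le> \<rho> x"
      using up [of x] mono [of y "x - 1"] pos [of x] n by (simp_all add: of_nat_diff)
    then show "nat (\<rho> y) \<noteq> nat (\<rho> x)"
      by linarith
  qed
  also have "{x. c - int n < x \<and> x \<le> c - int n + int (n - 1) \<and> P x} = {x \<in> {c - int n<..<c}. P x}"
    using n by (auto simp: of_nat_diff)
  finally show "ribbon_spin (strip_of n c \<rho>) = card {x \<in> {c - int n<..<c}. P x}"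
    by (simp add: ribbon_spin_def strip_of_def image_image int)
  have "card ((\<lambda>x. nat (\<rho> x + x)) ` {c - int n..c - int n + int (n - 1)}) =
    Suc (card {x. c - int n < x \<and> x \<le> c - int n + int (n - 1) \<and> \<not> P x})"
  proof (rule card_image_changes)
    fix x assume "c - int n < x" "x \<le> c - int n + int (n - 1)" "\<not> \<not> P x"
    then have "\<rho> (x - 1) = \<rho> x + 1"
      using up [of x] n by (simp add: of_nat_diff)
    then show "nat (\<rho> x + x) = nat (\<rho> (x - 1) + (x - 1))"
      by simp
  next
    fix x y assume *: "c - int n \<le> y" "y < x" "x \<le> c - int n + int (n - 1)" "\<not> P x"
    then have "\<rho> (x - 1) = \<rho> x" "\<rho> y + y \<le> \<rho> (x - 1) + (x - 1)" "0 \<le> \<rho> x + x" "0 \<le> \<rho> y + y"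
      using step [of x] up [of x] mono [of y "x - 1"] pos [of x] pos [of y] n by (simp_all add: of_nat_diff)
    then show "nat (\<rho> y + y) \<noteq> nat (\<rho> x + x)"
      by linarith
  qed
  also have "{x. c - int n < x \<and> x \<le> c - int n + int (n - 1) \<and> \<not> P x} = {x \<in> {c - int n<..<c}. \<not> P x}"
    using n by (auto simp: of_nat_diff)
  finally show "ribbon_spin (prod.swap ` strip_of n c \<rho>) = card {x \<in> {c - int n<..<c}. \<not> P x}"
    by (simp add: ribbon_spin_def strip_of_def image_image int)
qed

text \<open>The row of the last box of content \<open>x\<close>, provided that such a box
  exists.\<close>

definition rim :: "partition \<Rightarrow> int \<Rightarrow> int" where
  "rim lam x = int (count_above (columns lam) x) - 1"

lemma rim_path_rim:
  assumes "diagram mu \<subseteq> diagram lam"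
    and "\<And>x. c - int n \<le> x \<Longrightarrow> x < c \<Longrightarrow> count_above (columns mu) x < count_above (columns lam) x"
  shows "rim_path n c (rim lam)"
  unfolding rim_path_def
proof (intro conjI ballI allI impI)
  fix x assume "x \<in> {c - int n..<c}"
  then have "count_above (columns mu) x < count_above (columns lam) x"
    using assms(2) by simp
  then show "0 \<le> rim lam x" "0 \<le> rim lam x + x"
    using columns_ge [of x mu] by (simp_all add: rim_def)
next
  fix x
  show "rim lam (x - 1) = rim lam x \<or> rim lam (x - 1) = rim lam x + 1"
    using columns_step [of lam x] by (simp add: rim_def)
qed

lemma diagram_move:
  assumes n: "n \<ge> 1" and c: "c \<in> columns lam" "c - int n \<notin> columns lam"
    and mu: "columns mu = move n c (columns lam)"
  shows "diagram mu \<subseteq> diagram lam" "rim_path n c (rim lam)"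
    "diagram lam - diagram mu = strip_of n c (rim lam)"
proof -
  have cnt: "int (count_above (columns mu) x) =
      int (count_above (columns lam) x) - of_bool (c - int n \<le> x \<and> x < c)" for x
    unfolding mu by (rule count_above_move [OF n finite_columns c])
  show sub: "diagram mu \<subseteq> diagram lam"
    unfolding diagram_subset_iff
  proof
    fix x show "count_above (columns mu) x \<le> count_above (columns lam) x"
      using cnt [of x] by (cases "c - int n \<le> x \<and> x < c") simp_all
  qed
  show \<rho>: "rim_path n c (rim lam)"
  proof (rule rim_path_rim [OF sub])
    fix x assume "c - int n \<le> x" "x < c"
    then show "count_above (columns mu) x < count_above (columns lam) x"
      using cnt [of x] by simp
  qed
  show "diagram lam - diagram mu = strip_of n c (rim lam)"
  proof (rule set_eqI)
    fix b
    show "b \<in> diagram lam - diagram mu \<longleftrightarrow> b \<in> strip_of n c (rim lam)"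
      unfolding mem_strip_of [OF \<rho>] Diff_iff mem_diagram_content rim_def
      using cnt [of "content b"] by (auto simp: of_bool_def split: if_splits)
  qed
qed

lemma no_square_of_content:
  assumes "\<And>b b'. b \<in> R \<Longrightarrow> b' \<in> R \<Longrightarrow> content b = content b' \<Longrightarrow> b = b'"
  shows "\<nexists>i j. {(i, j), (i, Suc j), (Suc i, j), (Suc i, Suc j)} \<subseteq> R"
  using assms by (fastforce simp: content_def)

lemma ribbon_move:
  assumes n: "n \<ge> 1" and c: "c \<in> columns lam" "c - int n \<notin> columns lam"
    and mu: "columns mu = move n c (columns lam)"
  shows "ribbon n (diagram lam - diagram mu)"
proof -
  note d = diagram_move [OF assms]
  have "skew_shape (diagram lam - diagram mu)"
    using d(1) by (auto simp: skew_shape_def)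
  moreover have "\<nexists>i j. {(i, j), (i, Suc j), (Suc i, j), (Suc i, Suc j)} \<subseteq> diagram lam - diagram mu"
    by (rule no_square_of_content) (simp add: d(3) mem_strip_of [OF d(2)] box_eq_iff)
  ultimately show ?thesis
    unfolding ribbon_def d(3)
    using connected_strip_of [OF n d(2)] card_strip_of [OF d(2)] by simp
qed

lemma remove_ribbon_move:
  assumes "n \<ge> 1" "c \<in> columns lam" "c - int n \<notin> columns lam" "columns mu = move n c (columns lam)"
  shows "remove_ribbon n lam mu"
  using ribbon_move [OF assms] diagram_move(1) [OF assms] by (simp add: remove_ribbon_def)

lemma adjacent_content:
  "adjacent_boxes b b' \<Longrightarrow> content b' = content b + 1 \<or> content b' = content b - 1"
  by (auto simp: adjacent_boxes_def content_def)

text \<open>A discrete intermediate value theorem: the content changes by exactly 1 between adjacent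
  boxes.\<close>

lemma connected_contents:
  assumes conn: "connected_boxes R" and "b \<in> R" "b' \<in> R" "content b < x" "x < content b'"
  obtains d where "d \<in> R" "content d = x"
proof (rule ccontr)
  assume no: "\<not> thesis"
  have "(b, b') \<in> {(x, y). x \<in> R \<and> y \<in> R \<and> adjacent_boxes x y}\<^sup>*"
    using conn assms(2,3) by (simp add: connected_boxes_def)
  then have "content b' < x"
  proof (induction rule: rtrancl_induct)
    case (step y z)
    then have "content z \<noteq> x"
      using no that by blast
    then show ?case
      using step adjacent_content [of y z] by auto
  qed (rule assms(4))
  with assms(5) show False
    by simp
qed

text \<open>The absence of a square block leaves at most one box on each diagonal, and connectedness
  makes the contents an interval of length \<open>n\<close>. So the two counting functions differ by
  the indicator of that interval, and one particle has moved from its upper to its lower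
  end.\<close>

lemma remove_ribbon_obtains_move:
  assumes n: "n \<ge> 1" and rem: "remove_ribbon n lam mu"
  obtains c where "c \<in> columns lam" "c - int n \<notin> columns lam" "columns mu = move n c (columns lam)"
proof -
  define R where "R = diagram lam - diagram mu"
  have sub: "diagram mu \<subseteq> diagram lam" and rib: "ribbon n R"
    using rem by (simp_all add: remove_ribbon_def R_def)
  let ?N = "count_above (columns lam)" and ?N' = "count_above (columns mu)"
  have le: "?N' x \<le> ?N x" for x
    using sub by (simp add: diagram_subset_iff)
  have memR: "b \<in> R \<longleftrightarrow> ?N' (content b) \<le> fst b \<and> fst b < ?N (content b)" for b
    by (auto simp: R_def mem_diagram_content)
  have le1: "?N x \<le> ?N' x + 1" for x
  proof (rule ccontr)
    \<comment> \<open>Two boxes on one diagonal force their two common neighbours into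
      \<open>R\<close>, because the counts of both shapes change by at most 1 from one diagonal to
      the next.\<close>
    assume *: "\<not> ?N x \<le> ?N' x + 1"
    define i where "i = ?N' x"
    define j where "j = nat (int i + x)"
    have j: "int j = int i + x"
      using columns_ge [of x mu] by (simp add: j_def i_def)
    have "?N' (x + 1) \<le> ?N' x" "?N x \<le> ?N (x + 1) + 1" "?N' (x - 1) \<le> ?N' x + 1" "?N x \<le> ?N (x - 1)"
      using columns_step [of mu "x + 1"] columns_step [of lam "x + 1"] columns_step [of mu x] columns_step [of lam x]
      by simp_all
    then have "{(i, j), (i, Suc j), (Suc i, j), (Suc i, Suc j)} \<subseteq> R"
      using * j by (simp add: memR content_def i_def algebra_simps)
    then show False
      using rib by (auto simp: ribbon_def)
  qed
  define X where "X = content ` R"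
  have X: "x \<in> X \<longleftrightarrow> ?N x = ?N' x + 1" for x
  proof
    assume "?N x = ?N' x + 1"
    then have "(?N' x, nat (int (?N' x) + x)) \<in> R"
      using columns_ge [of x mu] by (simp add: memR content_def)
    then show "x \<in> X"
      using columns_ge [of x mu] by (force simp: X_def content_def image_iff)
  next
    assume "x \<in> X"
    then show "?N x = ?N' x + 1"
      using le1 [of x] by (auto simp: X_def memR)
  qed
  have "inj_on content R"
  proof (rule inj_onI)
    fix b b' assume "b \<in> R" "b' \<in> R" "content b = content b'"
    then show "b = b'"
      using le1 [of "content b"] by (simp add: memR box_eq_iff)
  qed
  then have cardX: "card X = n"
    using rib by (simp add: X_def card_image ribbon_def)
  then have X0: "X \<noteq> {}" "finite X"
    using n by (auto simp: card_ge_0_finite)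
  have conv: "x \<in> X" if "a \<in> X" "b \<in> X" "a < x" "x < b" for a b x
    using that connected_contents [of R] rib unfolding X_def ribbon_def by (metis (no_types, lifting) imageE imageI)
  define c where "c = Max X + 1"
  have Xint: "X = {Min X..Max X}"
  proof (intro equalityI subsetI)
    fix x assume "x \<in> {Min X..Max X}"
    then have "x = Min X \<or> x = Max X \<or> Min X < x \<and> x < Max X"
      by auto
    then show "x \<in> X"
      using conv [of "Min X" "Max X" x] Min_in [OF X0(2,1)] Max_in [OF X0(2,1)] by blast
  qed (use X0 in auto)
  then have "card X = nat (Max X - Min X + 1)"
    by (metis card_atLeastAtMost_int add.commute add_diff_eq)
  then have "Min X = c - int n"
    using cardX n by (simp add: c_def)
  then have X_iff: "x \<in> X \<longleftrightarrow> c - int n \<le> x \<and> x < c" for x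
    unfolding c_def by (subst Xint) auto
  have diff: "int (?N' x) = int (?N x) - of_bool (c - int n \<le> x \<and> x < c)" for x
    using X [of x] X_iff [of x] le [of x] le1 [of x] by (auto simp: of_bool_def)
  have mem: "of_bool (x \<in> columns mu) = of_bool (x \<in> columns lam) -
      of_bool (c - int n \<le> x - 1 \<and> x - 1 < c) + (of_bool (c - int n \<le> x \<and> x < c) :: int)" for x
    using columns_step [of mu x] columns_step [of lam x] diff [of x] diff [of "x - 1"] by simp
  have "c \<in> columns lam" "c - int n \<notin> columns lam"
    using mem [of c] mem [of "c - int n"] n by (auto simp: of_bool_def split: if_splits)
  moreover have "x \<in> columns mu \<longleftrightarrow> x \<in> move n c (columns lam)" for x
    using mem [of x] n by (auto simp: move_def of_bool_def split: if_splits)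
  ultimately show ?thesis
    using that by blast
qed

section \<open>Horizontal ribbon strips\<close>

lemma ribbon_obtains_strip:
  assumes n: "n \<ge> 1" and R: "ribbon n R"
  obtains c \<rho> where "rim_path n c \<rho>" "R = strip_of n c \<rho>"
proof -
  obtain lam mu where "diagram mu \<subseteq> diagram lam" "R = diagram lam - diagram mu"
    using R by (auto simp: ribbon_def skew_shape_def)
  then have "remove_ribbon n lam mu"
    using R by (simp add: remove_ribbon_def)
  then obtain c where c: "c \<in> columns lam" "c - int n \<notin> columns lam" "columns mu = move n c (columns lam)"
    using remove_ribbon_obtains_move [OF n] by blast
  show ?thesis
    using that [OF diagram_move(2) [OF n c]] diagram_move(3) [OF n c] \<open>R = _\<close> by simp
qed

lemma finite_diagram: "finite (diagram lam)"
proof (rule finite_subset)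
  have "finite {i. part lam i \<noteq> 0}"
    using part [of lam] by simp
  then show "finite ({i. part lam i \<noteq> 0} \<times> {..<part lam 0})"
    by simp
  show "diagram lam \<subseteq> {i. part lam i \<noteq> 0} \<times> {..<part lam 0}"
  proof
    fix b assume "b \<in> diagram lam"
    then show "b \<in> {i. part lam i \<noteq> 0} \<times> {..<part lam 0}"
      using part_antimono [of 0 "fst b" lam] by (auto simp: diagram_def)
  qed
qed

lemma finite_decomposition:
  assumes "horizontal_decomposition n lam mu D"
  shows "finite D"
  by (rule finite_subset [of _ "Pow (diagram lam)"])
    (use assms finite_diagram in \<open>auto simp: horizontal_decomposition_def\<close>)

text \<open>Among the ribbons of a horizontal strip, the one whose head has the largest content runs
  along the rim of the outer shape, so it can be removed first.\<close>

lemma horizontal_decomposition_first: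
  assumes n: "n \<ge> 1" and D: "horizontal_decomposition n lam mu D" and "D \<noteq> {}"
  obtains c lam' where "c \<in> columns lam" "c - int n \<notin> columns lam"
    "columns lam' = move n c (columns lam)" "strip_of n c (rim lam) \<in> D"
    "horizontal_decomposition n lam' mu (D - {strip_of n c (rim lam)})"
    "\<And>x. c \<le> x \<Longrightarrow> count_above (columns mu) x = count_above (columns lam) x"
    "count_above (columns mu) (c - 1) < count_above (columns lam) (c - 1)"
proof -
  let ?N = "\<lambda>x. int (count_above (columns lam) x)" and ?N' = "\<lambda>x. int (count_above (columns mu) x)"
  have sub: "diagram mu \<subseteq> diagram lam" and Un: "\<Union>D = diagram lam - diagram mu"
    and disj: "pairwise disjnt D" and rib: "\<And>R. R \<in> D \<Longrightarrow> ribbon n R"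
    and head: "\<And>R i j. R \<in> D \<Longrightarrow> top_right_box R = (i, j) \<Longrightarrow> i = 0 \<or> (i - 1, j) \<in> diagram mu"
    using D by (auto simp: horizontal_decomposition_def)
  have le: "?N' x \<le> ?N x" for x
    using sub by (simp add: diagram_subset_iff)
  have "\<forall>R\<in>D. \<exists>c \<rho>. rim_path n c \<rho> \<and> R = strip_of n c \<rho>"
    using ribbon_obtains_strip [OF n rib] by metis
  then obtain cc rr where rr: "\<And>R. R \<in> D \<Longrightarrow> rim_path n (cc R) (rr R)"
    and R_eq: "\<And>R. R \<in> D \<Longrightarrow> R = strip_of n (cc R) (rr R)"
    by metis
  define box where "box = (\<lambda>r x. (nat r, nat (r + x)))"
  have memR: "box r x \<in> R \<longleftrightarrow> cc R - int n \<le> x \<and> x < cc R \<and> r = rr R x"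
    if "R \<in> D" "0 \<le> r" "0 \<le> r + x" for R r x
    using mem_strip_of [OF rr [OF that(1)], of "box r x"] R_eq [OF that(1)] that(2,3)
    by (auto simp: box_def content_def)
  have mem_lam: "box r x \<in> diagram lam \<longleftrightarrow> r < ?N x" "box r x \<in> diagram mu \<longleftrightarrow> r < ?N' x"
    if "0 \<le> r" "0 \<le> r + x" for r x
    using that by (auto simp: box_def mem_diagram_iff nat_less_iff)
  have rr_pos: "0 \<le> rr R x" "0 \<le> rr R x + x" if "R \<in> D" "cc R - int n \<le> x" "x < cc R" for R x
    using rr [OF that(1)] that(2,3) by (auto simp: rim_path_def)
  have rr_bounds: "?N' x \<le> rr R x" "rr R x < ?N x" if "R \<in> D" "cc R - int n \<le> x" "x < cc R" for R x
  proof -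
    have "box (rr R x) x \<in> \<Union>D"
      using memR [OF that(1) rr_pos [OF that]] that by auto
    then show "?N' x \<le> rr R x" "rr R x < ?N x"
      using mem_lam [OF rr_pos [OF that]] unfolding Un by auto
  qed
  have cover: "\<exists>R\<in>D. cc R - int n \<le> x \<and> x < cc R \<and> r = rr R x"
    if "?N' x \<le> r" "r < ?N x" for r x
  proof -
    have r: "0 \<le> r" "0 \<le> r + x"
      using that columns_ge [of x mu] by linarith+
    then have "box r x \<in> \<Union>D"
      using mem_lam [OF r] that unfolding Un by auto
    then show ?thesis
      using memR r by auto
  qed
  have distinct: "rr R x \<noteq> rr R' x"
    if "R \<in> D" "R' \<in> D" "R \<noteq> R'" "cc R - int n \<le> x" "x < cc R" "cc R' - int n \<le> x" "x < cc R'" for R R' x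
  proof
    assume eq: "rr R x = rr R' x"
    have "box (rr R x) x \<in> R" "box (rr R x) x \<in> R'"
      using memR [OF that(1) rr_pos [OF that(1,4,5)]] memR [OF that(2) rr_pos [OF that(2,6,7)]] that eq by auto
    then show False
      using disj that(1-3) by (auto simp: pairwise_def disjnt_def)
  qed
  \<comment> \<open>The head of \<open>R\<close> has content \<open>cc R - 1\<close>, so the box
    above it has content \<open>cc R\<close>. The head condition thus bounds the row of the head by
    the count of \<open>mu\<close> at \<open>cc R\<close>.\<close>
  have hd: "rr R (cc R - 1) \<le> ?N' (cc R)" if "R \<in> D" for R
  proof -
    let ?e = "cc R - 1"
    have e: "cc R - int n \<le> ?e" "?e < cc R"
      using n by auto
    note pos = rr_pos [OF that e]
    have "top_right_box R = box (rr R ?e) ?e"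
      using top_right_strip_of [OF n rr [OF that]] R_eq [OF that] by (simp add: box_def)
    then have "nat (rr R ?e) = 0 \<or> (nat (rr R ?e) - 1, nat (rr R ?e + ?e)) \<in> diagram mu"
      using head [OF that] by (simp add: box_def)
    then show ?thesis
    proof
      assume "nat (rr R ?e) = 0"
      then show ?thesis
        using pos by simp
    next
      assume *: "(nat (rr R ?e) - 1, nat (rr R ?e + ?e)) \<in> diagram mu"
      show ?thesis
      proof (cases "rr R ?e = 0")
        case False
        then have "int (nat (rr R ?e) - 1) = rr R ?e - 1"
          using pos by simp
        then have "rr R ?e - 1 < ?N' (cc R)"
          using * pos by (simp add: mem_diagram_iff)
        then show ?thesis
          by simp
      qed simp
    qed
  qed
  have stepN: "?N (x - 1) = ?N x \<or> ?N (x - 1) = ?N x + 1" "?N' (x - 1) = ?N' x \<or> ?N' (x - 1) = ?N' x + 1" for x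
    using columns_step [of lam x] columns_step [of mu x] by auto
  define c where "c = Max (cc ` D)"
  have finD: "finite D"
    by (rule finite_decomposition [OF D])
  have "c \<in> cc ` D"
    unfolding c_def using finD \<open>D \<noteq> {}\<close> by (intro Max_in) auto
  then obtain R where R: "R \<in> D" "cc R = c"
    by blast
  have max: "cc R' \<le> c" if "R' \<in> D" for R'
    using finD that by (simp add: c_def)
  \<comment> \<open>If \<open>R\<close> left the rim, the box of \<open>lam\<close> after it on the
    diagonal would belong to some \<open>R'\<close>. Then \<open>R'\<close> stays below
    \<open>R\<close> up to its own head, which is in the first row or directly below
    \<open>mu\<close>; this would put a box of \<open>R\<close> inside \<open>mu\<close>.\<close>
  have rim: "rr R x = ?N x - 1" if x: "c - int n \<le> x" "x < c" for x
  proof (rule ccontr)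
    assume "rr R x \<noteq> ?N x - 1"
    then have "?N' x \<le> rr R x + 1" "rr R x + 1 < ?N x"
      using rr_bounds [of R x] R x by auto
    then obtain R' where R': "R' \<in> D" "cc R' - int n \<le> x" "x < cc R'" "rr R x + 1 = rr R' x"
      using cover by metis
    then have "R' \<noteq> R"
      by auto
    have above: "rr R y < rr R' y" if "x \<le> y" "y < cc R'" for y
      using that
    proof (induction y rule: int_ge_induct)
      case base
      then show ?case
        using R'(4) by simp
    next
      case (step y)
      have "rr R' (y + 1 - 1) = rr R' (y + 1) \<or> rr R' (y + 1 - 1) = rr R' (y + 1) + 1"
        using rr [OF R'(1)] step R'(2) unfolding rim_path_def by (smt (verit))
      moreover have "y + 1 < c"
        using step max [OF R'(1)] by simp
      then have "rr R (y + 1) \<le> rr R y"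
        using rim_path_mono [OF rr [OF R(1)], of y "y + 1"] R step x by auto
      moreover have "rr R (y + 1) \<noteq> rr R' (y + 1)"
        using \<open>R' \<noteq> R\<close> R R' step x \<open>y + 1 < c\<close> by (intro distinct) auto
      ultimately show ?case
        using step by auto
    qed
    let ?e = "cc R' - 1"
    have e: "x \<le> ?e" "?e < cc R'"
      using R' by auto
    then have "rr R ?e < rr R' ?e"
      by (rule above)
    also have "\<dots> \<le> ?N' (cc R')"
      by (rule hd [OF R'(1)])
    also have "\<dots> \<le> ?N' ?e"
      using columns_antimono [of ?e "cc R'" mu] by simp
    also have "\<dots> \<le> rr R ?e"
      using rr_bounds(1) [OF R(1), of ?e] e max [OF R'(1)] R x by simp
    finally show False
      by simp
  qed
  have c1: "?N' (c - 1) \<le> rr R (c - 1)" "rr R (c - 1) = ?N (c - 1) - 1"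
    using rr_bounds(1) [OF R(1), of "c - 1"] rim [of "c - 1"] R n by auto
  have eq_above: "?N' x = ?N x" if "c \<le> x" for x
  proof (rule ccontr)
    assume "?N' x \<noteq> ?N x"
    then obtain R' where "R' \<in> D" "x < cc R'"
      using cover [of x "?N' x"] le [of x] by auto
    then show False
      using max [of R'] that by simp
  qed
  have cS: "c \<in> columns lam"
  proof (rule ccontr)
    assume "c \<notin> columns lam"
    then have "?N (c - 1) = ?N c"
      using columns_step [of lam c] by simp
    then show False
      using c1 eq_above [of c] stepN(2) [of c] by auto
  qed
  \<comment> \<open>Otherwise the box directly below the tail of \<open>R\<close> lies in some
    \<open>R'\<close>. It cannot be the head of \<open>R'\<close>, since the box above it is in
    \<open>R\<close> and not in \<open>mu\<close>; and \<open>R'\<close> cannot continue to content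
    \<open>c - n\<close>, where its box would be in \<open>R\<close> or outside
    \<open>lam\<close>.\<close>
  have cnS: "c - int n \<notin> columns lam"
  proof
    assume "c - int n \<in> columns lam"
    then have step: "?N (c - int n - 1) = ?N (c - int n) + 1"
      using columns_step [of lam "c - int n"] by simp
    let ?k = "rr R (c - int n)"
    have x: "c - int n \<le> c - int n" "c - int n < c"
      using n by auto
    have k: "?k = ?N (c - int n) - 1" "?N' (c - int n) \<le> ?k"
      using rim [OF x] rr_bounds(1) [OF R(1), of "c - int n"] R x by auto
    then obtain R' where R': "R' \<in> D" "cc R' - int n \<le> c - int n - 1" "c - int n - 1 < cc R'"
        "?k + 1 = rr R' (c - int n - 1)"
      using cover [of "c - int n - 1" "?k + 1"] step stepN(2) [of "c - int n"] by auto
    have "R' \<noteq> R"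
      using R'(2) R by auto
    show False
    proof (cases "cc R' = c - int n")
      case True
      then show False
        using hd [OF R'(1)] R'(4) k by auto
    next
      case False
      then have y: "cc R' - int n \<le> c - int n" "c - int n < cc R'"
        using R' by auto
      have "rr R' (c - int n - 1) = rr R' (c - int n) \<or> rr R' (c - int n - 1) = rr R' (c - int n) + 1"
        using rr [OF R'(1)] y R'(2) by (auto simp: rim_path_def)
      moreover have "rr R' (c - int n) < ?N (c - int n)"
        by (rule rr_bounds(2) [OF R'(1) y])
      moreover have "?k \<noteq> rr R' (c - int n)"
        using distinct [OF R(1) R'(1) \<open>R' \<noteq> R\<close>[symmetric]] R y x by auto
      ultimately show False
        using R'(4) k by linarith
    qed
  qed
  obtain lam' where lam': "columns lam' = move n c (columns lam)"
    using move_obtains_partition [OF n cS cnS] .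
  note dm = diagram_move [OF n cS cnS lam']
  have RR: "R = strip_of n c (rim lam)"
  proof -
    have "strip_of n c (rr R) = strip_of n c (rim lam)"
      unfolding strip_of_def using rim by (intro image_cong refl) (simp add: rim_def)
    then show ?thesis
      using R_eq [OF R(1)] R(2) by simp
  qed
  have sub': "diagram mu \<subseteq> diagram lam'"
  proof -
    have "R \<subseteq> diagram lam - diagram mu"
      using R(1) Un by blast
    then show ?thesis
      using sub unfolding RR dm(3) [symmetric] by blast
  qed
  have "\<Union>(D - {R}) = diagram lam' - diagram mu"
  proof -
    have "\<Union>(D - {R}) = \<Union>D - R"
      using disj R(1) by (auto simp: pairwise_def disjnt_def)
    also have "\<dots> = diagram lam' - diagram mu"
      unfolding Un RR dm(3) [symmetric] using dm(1) by auto
    finally show ?thesis .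
  qed
  then have "horizontal_decomposition n lam' mu (D - {R})"
    using D sub' by (auto simp: horizontal_decomposition_def intro: pairwise_subset)
  moreover have "count_above (columns mu) (c - 1) < count_above (columns lam) (c - 1)"
    using c1 by simp
  moreover have "count_above (columns mu) x = count_above (columns lam) x" if "c \<le> x" for x
    using eq_above [OF that] by simp
  ultimately show ?thesis
    using that [OF cS cnS lam'] R(1) unfolding RR by blast
qed

lemma horizontal_decomposition_empty:
  assumes "horizontal_decomposition n lam mu {}"
  shows "lam = mu"
  using assms by (intro diagram_inject) (auto simp: horizontal_decomposition_def)

lemma horizontal_decomposition_refl:
  assumes "n \<ge> 1" "horizontal_decomposition n lam lam D"
  shows "D = {}"
proof (rule ccontr)
  assume "D \<noteq> {}"
  then obtain R where "R \<in> D" "R = {}"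
    using assms(2) by (auto simp: horizontal_decomposition_def)
  then have "card ({} :: box set) = n"
    using assms(2) by (auto simp: horizontal_decomposition_def ribbon_def)
  with assms(1) show False
    by simp
qed

text \<open>The first ribbon is determined by the shapes alone: \<open>c - 1\<close> is the largest
  content at which the counts of \<open>lam\<close> and \<open>mu\<close> differ, and the ribbon
  follows the rim.\<close>

lemma horizontal_decomposition_unique:
  assumes n: "n \<ge> 1" and "horizontal_decomposition n lam mu D" "horizontal_decomposition n lam mu D'"
  shows "D = D'"
  using finite_decomposition [OF assms(2)] assms(2,3)
proof (induction D arbitrary: lam D' rule: finite_psubset_induct)
  case (psubset D)
  show ?case
  proof (cases "D = {} \<or> D' = {}")
    case True
    then have "lam = mu"
      using psubset.prems horizontal_decomposition_empty by blast
    then show ?thesis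
      using psubset.prems horizontal_decomposition_refl [OF n] by blast
  next
    case False
    then have ne: "D \<noteq> {}" "D' \<noteq> {}"
      by auto
    from horizontal_decomposition_first [OF n psubset.prems(1) ne(1)]
    obtain c lam1 where 1: "columns lam1 = move n c (columns lam)" "strip_of n c (rim lam) \<in> D"
      "horizontal_decomposition n lam1 mu (D - {strip_of n c (rim lam)})"
      "\<And>x. c \<le> x \<Longrightarrow> count_above (columns mu) x = count_above (columns lam) x"
      "count_above (columns mu) (c - 1) < count_above (columns lam) (c - 1)"
      by metis
    from horizontal_decomposition_first [OF n psubset.prems(2) ne(2)]
    obtain c' lam2 where 2: "columns lam2 = move n c' (columns lam)" "strip_of n c' (rim lam) \<in> D'"
      "horizontal_decomposition n lam2 mu (D' - {strip_of n c' (rim lam)})"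
      "\<And>x. c' \<le> x \<Longrightarrow> count_above (columns mu) x = count_above (columns lam) x"
      "count_above (columns mu) (c' - 1) < count_above (columns lam) (c' - 1)"
      by metis
    have "\<not> c \<le> c' - 1" "\<not> c' \<le> c - 1"
      using 1(4) [of "c' - 1"] 1(5) 2(4) [of "c - 1"] 2(5) by auto
    then have c: "c' = c"
      by simp
    then have "lam2 = lam1"
      using 1(1) 2(1) by (intro columns_inject) simp
    moreover have "D - {strip_of n c (rim lam)} \<subset> D"
      using 1(2) by blast
    ultimately have "D - {strip_of n c (rim lam)} = D' - {strip_of n c (rim lam)}"
      using psubset.IH [OF _ 1(3)] 2(3) c by blast
    then show ?thesis
      using 1(2) 2(2) c by blast
  qed
qed

text \<open>Like \<open>hspin\<close>, but with holes in place of particles. It counts the columns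
  of the ribbons minus 1, which become rows after conjugation.\<close>

definition hcospin :: "nat \<Rightarrow> int set \<Rightarrow> int set \<Rightarrow> nat" where
  "hcospin n S M = (\<Sum>c\<in>M. card {d \<in> {c - int n<..<c}. \<not> (d \<in> S \<or> d + int n \<in> M)})"

text \<open>The largest start moves first. It influences the others only by changing
  \<open>S\<close> into \<open>move n c S\<close>, because \<open>c\<close> itself lies in none of
  the intervals of the smaller starts.\<close>

lemma hmoves_insert:
  assumes n: "n \<ge> 1" and lt_all: "\<forall>d\<in>M. d < c" and c: "c \<in> S" "c - int n \<notin> S"
  shows "hmoves n S (insert c M) \<longleftrightarrow> hmoves n (move n c S) M"
    and "hresult n S (insert c M) = hresult n (move n c S) M"
    and "finite M \<Longrightarrow> hspin n S (insert c M) = card {d \<in> {c - int n<..<c}. d \<in> S} + hspin n (move n c S) M"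
    and "finite M \<Longrightarrow> hcospin n S (insert c M) = card {d \<in> {c - int n<..<c}. d \<notin> S} + hcospin n (move n c S) M"
proof -
  have lt: "d < c" if "d \<in> M" for d
    using lt_all that by blast
  have cM: "c \<notin> M" "c + int n \<notin> M"
    using lt [of c] lt [of "c + int n"] by auto
  have shift: "d + int n = c \<longleftrightarrow> d = c - int n" for d
    by auto
  have occ: "d \<in> S \<or> d + int n \<in> insert c M \<longleftrightarrow> d \<in> move n c S \<or> d + int n \<in> M" if "d \<noteq> c" for d
    using that shift [of d] by (auto simp: move_def)
  have "((d \<in> S \<or> d + int n \<in> insert c M) \<and> d - int n \<notin> S) \<longleftrightarrow>
      ((d \<in> move n c S \<or> d + int n \<in> M) \<and> d - int n \<notin> move n c S)" if "d \<in> M" for d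
    using occ [of d] lt [OF that] n by (auto simp: move_def)
  then show "hmoves n S (insert c M) \<longleftrightarrow> hmoves n (move n c S) M"
    unfolding hmoves_def using c by auto
  have "(d \<in> S \<or> d + int n \<in> insert c M) \<and> d \<notin> insert c M \<longleftrightarrow> (d \<in> move n c S \<or> d + int n \<in> M) \<and> d \<notin> M" for d
    using occ [of d] cM n by (cases "d = c") (auto simp: move_def)
  then show "hresult n S (insert c M) = hresult n (move n c S) M"
    unfolding hresult_def by blast
  have first: "d \<in> S \<or> d + int n \<in> insert c M \<longleftrightarrow> d \<in> S" if "d \<in> {c - int n<..<c}" for d
    using that lt [of "d + int n"] by auto
  have first_set: "{d \<in> {c - int n<..<c}. d \<in> S \<or> d + int n \<in> insert c M} = {d \<in> {c - int n<..<c}. d \<in> S}"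
    "{d \<in> {c - int n<..<c}. \<not> (d \<in> S \<or> d + int n \<in> insert c M)} = {d \<in> {c - int n<..<c}. d \<notin> S}"
    using first by blast+
  have rest: "d \<in> S \<or> d + int n \<in> insert c M \<longleftrightarrow> d \<in> move n c S \<or> d + int n \<in> M"
    if "x \<in> M" "d \<in> {x - int n<..<x}" for x d
    using that lt [of x] by (intro occ) auto
  have rest_set: "{d \<in> {x - int n<..<x}. d \<in> S \<or> d + int n \<in> insert c M} =
       {d \<in> {x - int n<..<x}. d \<in> move n c S \<or> d + int n \<in> M}"
    "{d \<in> {x - int n<..<x}. \<not> (d \<in> S \<or> d + int n \<in> insert c M)} =
       {d \<in> {x - int n<..<x}. \<not> (d \<in> move n c S \<or> d + int n \<in> M)}" if "x \<in> M" for x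
    using rest [OF that] by blast+
  show "hspin n S (insert c M) = card {d \<in> {c - int n<..<c}. d \<in> S} + hspin n (move n c S) M" if "finite M"
    unfolding hspin_def sum.insert [OF that cM(1)] first_set
    by (intro arg_cong2 [where f = "(+)"] refl sum.cong arg_cong [where f = card] rest_set)
  show "hcospin n S (insert c M) = card {d \<in> {c - int n<..<c}. d \<notin> S} + hcospin n (move n c S) M" if "finite M"
    unfolding hcospin_def sum.insert [OF that cM(1)] first_set
    by (intro arg_cong2 [where f = "(+)"] refl sum.cong arg_cong [where f = card] rest_set)
qed

lemma rim_spin:
  assumes n: "n \<ge> 1" and c: "c \<in> columns lam" "c - int n \<notin> columns lam"
  shows "ribbon_spin (strip_of n c (rim lam)) = card {d \<in> {c - int n<..<c}. d \<in> columns lam}"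
    and "ribbon_spin (prod.swap ` strip_of n c (rim lam)) = card {d \<in> {c - int n<..<c}. d \<notin> columns lam}"
    and "card (strip_of n c (rim lam)) = n"
proof -
  obtain lam' where "columns lam' = move n c (columns lam)"
    using move_obtains_partition [OF n c] .
  note \<rho> = diagram_move(2) [OF n c this]
  have up: "d \<in> columns lam \<longleftrightarrow> rim lam (d - 1) = rim lam d + 1" for d
    using columns_step [of lam d] by (simp add: rim_def)
  show "ribbon_spin (strip_of n c (rim lam)) = card {d \<in> {c - int n<..<c}. d \<in> columns lam}"
    "ribbon_spin (prod.swap ` strip_of n c (rim lam)) = card {d \<in> {c - int n<..<c}. d \<notin> columns lam}"
    using up by (intro ribbon_spin_strip_of [OF n \<rho>]; blast)+
  show "card (strip_of n c (rim lam)) = n"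
    by (rule card_strip_of [OF \<rho>])
qed

text \<open>The ribbons are removed one by one from the right. The clause on the counts at
  \<open>d - 1\<close> is there for the induction: it places the starts of the remaining ribbons
  below the first one. The chain of single ribbon removals is kept for the statement on
  cores.\<close>

lemma horizontal_decomposition_hmoves:
  assumes n: "n \<ge> 1" and D: "horizontal_decomposition n lam mu D"
  shows "\<exists>M. hmoves n (columns lam) M \<and> columns mu = hresult n (columns lam) M \<and>
     (\<forall>d\<in>M. count_above (columns mu) (d - 1) < count_above (columns lam) (d - 1)) \<and>
     (\<Sum>R\<in>D. ribbon_spin R) = hspin n (columns lam) M \<and>
     (\<Sum>R\<in>D. ribbon_spin (prod.swap ` R)) = hcospin n (columns lam) M \<and>
     card (diagram lam - diagram mu) = n * card M \<and> (remove_ribbon n)\<^sup>*\<^sup>* lam mu"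
  using finite_decomposition [OF D] D
proof (induction D arbitrary: lam rule: finite_psubset_induct)
  case (psubset D)
  show ?case
  proof (cases "D = {}")
    case True
    then have "lam = mu"
      using psubset.prems horizontal_decomposition_empty by blast
    then show ?thesis
      using True by (intro exI [of _ "{}"]) (simp add: hmoves_def hresult_def hspin_def hcospin_def)
  next
    case False
    from horizontal_decomposition_first [OF n psubset.prems False]
    obtain c lam' where c: "c \<in> columns lam" "c - int n \<notin> columns lam"
      and lam': "columns lam' = move n c (columns lam)" and RD: "strip_of n c (rim lam) \<in> D"
      and D': "horizontal_decomposition n lam' mu (D - {strip_of n c (rim lam)})"
      and above: "\<And>x. c \<le> x \<Longrightarrow> count_above (columns mu) x = count_above (columns lam) x"
      and less: "count_above (columns mu) (c - 1) < count_above (columns lam) (c - 1)"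
      by metis
    let ?R = "strip_of n c (rim lam)"
    have "D - {?R} \<subset> D"
      using RD by blast
    from psubset.IH [OF this D'] obtain M where
      M: "hmoves n (columns lam') M" "columns mu = hresult n (columns lam') M"
        "\<And>d. d \<in> M \<Longrightarrow> count_above (columns mu) (d - 1) < count_above (columns lam') (d - 1)"
        "(\<Sum>R\<in>D - {?R}. ribbon_spin R) = hspin n (columns lam') M"
        "(\<Sum>R\<in>D - {?R}. ribbon_spin (prod.swap ` R)) = hcospin n (columns lam') M"
        "card (diagram lam' - diagram mu) = n * card M" "(remove_ribbon n)\<^sup>*\<^sup>* lam' mu"
      by blast
    have finM: "finite M"
      using M(1) by (simp add: hmoves_def)
    have cnt: "int (count_above (columns lam') x) =
        int (count_above (columns lam) x) - of_bool (c - int n \<le> x \<and> x < c)" for x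
      unfolding lam' by (rule count_above_move [OF n finite_columns c])
    \<comment> \<open>From content \<open>c - 1\<close> on, the count of \<open>lam'\<close> no
      longer exceeds that of \<open>mu\<close>, so a start \<open>d \<ge> c\<close> would violate
      the strict inequality at \<open>d - 1\<close>.\<close>
    have lt: "d < c" if "d \<in> M" for d
    proof (rule ccontr)
      assume "\<not> d < c"
      show False
      proof (cases "d = c")
        case True
        have "count_above (columns lam') (c - 1) = count_above (columns mu) c"
          using cnt [of "c - 1"] above [of c] columns_step [of lam c] c n by simp
        also have "\<dots> \<le> count_above (columns mu) (c - 1)"
          by (rule columns_antimono) simp
        finally show False
          using M(3) [OF that] True by simp
      next
        case False
        then have "count_above (columns lam') (d - 1) = count_above (columns mu) (d - 1)"
          using cnt [of "d - 1"] above [of "d - 1"] \<open>\<not> d < c\<close> by simp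
        then show False
          using M(3) [OF that] by simp
      qed
    qed
    then have "\<forall>d\<in>M. d < c"
      by blast
    note ins = hmoves_insert [OF n this c]
    have cM: "c \<notin> M"
      using lt [of c] by auto
    have "count_above (columns mu) (d - 1) < count_above (columns lam) (d - 1)" if "d \<in> insert c M" for d
    proof (cases "d = c")
      case False
      then have "d \<in> M"
        using that by simp
      then show ?thesis
        using M(3) [of d] cnt [of "d - 1"] by (simp add: of_bool_def split: if_splits)
    qed (simp add: less)
    moreover have "(\<Sum>R\<in>D. ribbon_spin R) = hspin n (columns lam) (insert c M)"
      unfolding ins(3) [OF finM] sum.remove [OF psubset.hyps RD] M(4) lam' rim_spin(1) [OF n c] ..
    moreover have "(\<Sum>R\<in>D. ribbon_spin (prod.swap ` R)) = hcospin n (columns lam) (insert c M)"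
      unfolding ins(4) [OF finM] sum.remove [OF psubset.hyps RD] M(5) lam' rim_spin(2) [OF n c] ..
    moreover have "card (diagram lam - diagram mu) = n * card (insert c M)"
    proof -
      have "diagram mu \<subseteq> diagram lam'"
        using D' by (simp add: horizontal_decomposition_def)
      then have "diagram lam - diagram mu = ?R \<union> (diagram lam' - diagram mu)"
        "?R \<inter> (diagram lam' - diagram mu) = {}"
        using diagram_move(1) [OF n c lam'] diagram_move(3) [OF n c lam', symmetric] by auto
      moreover have "finite ?R" "finite (diagram lam' - diagram mu)"
        using finite_diagram diagram_move(3) [OF n c lam'] by (metis finite_Diff)+
      ultimately have "card (diagram lam - diagram mu) = card ?R + n * card M"
        by (simp only: card_Un_disjoint M(6))
      then show ?thesis
        using cM finM by (simp add: rim_spin(3) [OF n c])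
    qed
    moreover have "(remove_ribbon n)\<^sup>*\<^sup>* lam mu"
      using remove_ribbon_move [OF n c lam'] M(7) by (rule converse_rtranclp_into_rtranclp)
    moreover have "hmoves n (columns lam) (insert c M)" "columns mu = hresult n (columns lam) (insert c M)"
      using ins(1,2) M(1,2) lam' by simp_all
    ultimately show ?thesis
      by blast
  qed
qed

text \<open>The last clause says that nothing changes to the right of all starts; it provides the
  head condition for the next ribbon in the induction.\<close>

lemma hmoves_horizontal_decomposition:
  assumes n: "n \<ge> 1" and "hmoves n (columns lam) M"
  shows "\<exists>mu D. columns mu = hresult n (columns lam) M \<and> horizontal_decomposition n lam mu D \<and>
     (\<forall>x. (\<forall>d\<in>M. d \<le> x) \<longrightarrow> count_above (columns mu) x = count_above (columns lam) x)"
proof -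
  have "finite M"
    using assms(2) by (simp add: hmoves_def)
  then show ?thesis
    using assms(2)
  proof (induction M arbitrary: lam rule: finite_psubset_induct)
    case (psubset M)
    show ?case
    proof (cases "M = {}")
      case True
      then show ?thesis
        by (intro exI [of _ lam] exI [of _ "{}"]) (simp add: hresult_def horizontal_decomposition_def)
    next
      case False
      define c where "c = Max M"
      define M' where "M' = M - {c}"
      have cM: "c \<in> M" and le: "\<And>d. d \<in> M \<Longrightarrow> d \<le> c"
        using False psubset.hyps by (simp_all add: c_def)
      have M: "M = insert c M'"
        using cM by (auto simp: M'_def)
      have lt: "d < c" if "d \<in> M'" for d
        using that le [of d] by (simp add: M'_def)
      have "c + int n \<notin> M"
        using le [of "c + int n"] n by auto
      then have c: "c \<in> columns lam" "c - int n \<notin> columns lam"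
        using psubset.prems cM by (auto simp: hmoves_def)
      have "\<forall>d\<in>M'. d < c"
        using lt by blast
      note ins = hmoves_insert [OF n this c]
      obtain lam' where lam': "columns lam' = move n c (columns lam)"
        using move_obtains_partition [OF n c] .
      have sub_M: "M' \<subset> M"
        using cM by (auto simp: M'_def)
      have "hmoves n (columns lam') M'"
        using psubset.prems ins(1) M lam' by simp
      from psubset.IH [OF sub_M this] obtain mu D where mu: "columns mu = hresult n (columns lam') M'"
        and D: "horizontal_decomposition n lam' mu D"
        and above: "\<And>x. (\<forall>d\<in>M'. d \<le> x) \<Longrightarrow> count_above (columns mu) x = count_above (columns lam') x"
        by blast
      have cnt: "int (count_above (columns lam') x) =
          int (count_above (columns lam) x) - of_bool (c - int n \<le> x \<and> x < c)" for x
        unfolding lam' by (rule count_above_move [OF n finite_columns c])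
      have above': "count_above (columns mu) x = count_above (columns lam) x" if "c \<le> x" for x
        using above [of x] cnt [of x] lt that by force
      let ?R = "strip_of n c (rim lam)"
      note dm = diagram_move [OF n c lam']
      have sub: "diagram mu \<subseteq> diagram lam'" and Un: "\<Union>D = diagram lam' - diagram mu"
        using D by (simp_all add: horizontal_decomposition_def)
      have "\<Union>(insert ?R D) = diagram lam - diagram mu"
        using sub Un dm(1) dm(3) [symmetric] by auto
      moreover have "pairwise disjnt (insert ?R D)"
      proof -
        have "disjnt ?R R'" if "R' \<in> D" for R'
          using that Un dm(3) [symmetric] by (auto simp: disjnt_def)
        then show ?thesis
          using D by (auto simp: pairwise_insert horizontal_decomposition_def disjnt_sym)
      qed
      moreover have "ribbon n ?R"
        using ribbon_move [OF n c lam'] dm(3) by simp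
      \<comment> \<open>The head lies in row \<open>count_above (columns lam) c\<close>, and
        \<open>mu\<close> has the same count at \<open>c\<close>; hence the box above the head, of
        content \<open>c\<close>, is the last one of \<open>mu\<close> on its diagonal.\<close>
      moreover have "case top_right_box ?R of (i, j) \<Rightarrow> i = 0 \<or> (i - 1, j) \<in> diagram mu"
      proof -
        have r: "rim lam (c - 1) = int (count_above (columns lam) c)"
          using columns_step [of lam c] c by (simp add: rim_def)
        have pos: "0 \<le> rim lam (c - 1) + (c - 1)"
          using dm(2) n by (simp add: rim_path_def)
        have "(nat (rim lam (c - 1)) - 1, nat (rim lam (c - 1) + (c - 1))) \<in> diagram mu"
          if "nat (rim lam (c - 1)) \<noteq> 0"
          using that pos above' [of c] unfolding r by (simp add: mem_diagram_iff of_nat_diff)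
        then show ?thesis
          unfolding top_right_strip_of [OF n dm(2)] by auto
      qed
      ultimately have "horizontal_decomposition n lam mu (insert ?R D)"
        using D sub dm(1) by (auto simp: horizontal_decomposition_def)
      moreover have "columns mu = hresult n (columns lam) M"
        unfolding M ins(2) mu lam' ..
      moreover have "\<forall>x. (\<forall>d\<in>M. d \<le> x) \<longrightarrow> count_above (columns mu) x = count_above (columns lam) x"
        using above' cM by blast
      ultimately show ?thesis
        by blast
    qed
  qed
qed

section \<open>Vertical ribbon strips and cores\<close>

lemma horizontal_stripD:
  assumes n: "n \<ge> 1" and "horizontal_strip n lam mu"
  obtains M where "hmoves n (columns lam) M" "columns mu = hresult n (columns lam) M"
    "horizontal_spin n lam mu = hspin n (columns lam) M"
    "card (diagram lam - diagram mu) = n * card M" "(remove_ribbon n)\<^sup>*\<^sup>* lam mu"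
proof -
  obtain D where D: "horizontal_decomposition n lam mu D"
    using assms(2) by (auto simp: horizontal_strip_def)
  have the: "(THE D. horizontal_decomposition n lam mu D) = D"
    by (rule the_equality, rule D, rule horizontal_decomposition_unique [OF n _ D])
  from horizontal_decomposition_hmoves [OF n D] show ?thesis
    using that unfolding horizontal_spin_def the by (elim exE conjE)
qed

lemma hmoves_strip:
  assumes "n \<ge> 1" "hmoves n (columns lam) M"
  obtains mu where "columns mu = hresult n (columns lam) M" "horizontal_strip n lam mu"
  using hmoves_horizontal_decomposition [OF assms] that by (auto simp: horizontal_strip_def)

text \<open>As for flows, the largest start in the symmetric difference sees the same arrivals on
  both sides, so the result at that column tells whether it moves.\<close>

lemma hmoves_unique:
  assumes n: "n \<ge> 1" and "hmoves n S M" "hmoves n S M'" "hresult n S M = hresult n S M'"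
  shows "M = M'"
proof (rule ccontr)
  define D where "D = (M - M') \<union> (M' - M)"
  assume "M \<noteq> M'"
  then have "D \<noteq> {}" "finite D"
    using assms(2,3) by (auto simp: D_def hmoves_def)
  then have x: "Max D \<in> D" "Max D + int n \<notin> D"
    using Max_ge [of D "Max D + int n"] n by auto
  have "(Max D \<in> S \<or> Max D + int n \<in> M) \<and> Max D \<notin> M \<longleftrightarrow> (Max D \<in> S \<or> Max D + int n \<in> M') \<and> Max D \<notin> M'"
    using assms(4) unfolding hresult_def by blast
  moreover have "Max D \<in> M \<longrightarrow> Max D \<in> S \<or> Max D + int n \<in> M" "Max D \<in> M' \<longrightarrow> Max D \<in> S \<or> Max D + int n \<in> M'"
    using assms(2,3) by (auto simp: hmoves_def)
  ultimately show False
    using x unfolding D_def by blast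
qed

definition reflect :: "int set \<Rightarrow> int set" where
  "reflect S = {c. 1 - c \<notin> S}"

text \<open>When a particle goes from \<open>c\<close> to \<open>c - int n\<close>, a hole goes from
  \<open>c - int n\<close> to \<open>c\<close>. Under \<open>c \<mapsto> 1 - c\<close> it becomes a
  particle that starts at \<open>1 - (c - int n)\<close>.\<close>

definition flip :: "nat \<Rightarrow> int set \<Rightarrow> int set" where
  "flip n N = (\<lambda>c. int n + 1 - c) ` N"

lemma columns_conjugate_reflect: "columns (conjugate lam) = reflect (columns lam)"
  by (simp add: columns_conjugate reflect_def)

lemma reflect_reflect: "reflect (reflect S) = S"
  by (simp add: reflect_def)

lemma mem_flip: "c \<in> flip n N \<longleftrightarrow> int n + 1 - c \<in> N"
  by (force simp: flip_def)

lemma flip_flip: "flip n (flip n N) = N"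
  by (auto simp: mem_flip)

lemma inj_flip: "inj_on (\<lambda>c. int n + 1 - c) A"
  by (auto simp: inj_on_def)

lemma card_flip: "card (flip n N) = card N"
  unfolding flip_def by (rule card_image [OF inj_flip])

lemma finite_flip: "finite (flip n N) \<longleftrightarrow> finite N"
  unfolding flip_def by (rule finite_image_iff [OF inj_flip])

text \<open>The reflection reverses the order of the columns, so moves made in increasing order of
  the starts become moves made in decreasing order.\<close>

lemma vmoves_iff_hmoves: "vmoves n K N \<longleftrightarrow> hmoves n (reflect K) (flip n N)"
proof -
  have "(\<forall>c\<in>flip n N. P c) \<longleftrightarrow> (\<forall>c\<in>N. P (int n + 1 - c))" for P
    by (simp add: flip_def)
  then show ?thesis
    unfolding vmoves_def hmoves_def finite_flip by (auto simp: reflect_def mem_flip algebra_simps)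
qed

lemma vresult_eq_hresult:
  assumes "vmoves n K N"
  shows "reflect (vresult n K N) = hresult n (reflect K) (flip n N)"
proof (rule set_eqI)
  fix c
  have 1: "1 - c + int n \<in> N \<longrightarrow> 1 - c \<notin> K \<or> 1 - c \<in> N" "1 - c \<in> N \<longrightarrow> 1 - c \<in> K"
    using assms by (force simp: vmoves_def)+
  have 2: "int n + 1 - (c + int n) = 1 - c" "int n + 1 - c = 1 - c + int n"
    by simp_all
  show "c \<in> reflect (vresult n K N) \<longleftrightarrow> c \<in> hresult n (reflect K) (flip n N)"
    using 1 unfolding reflect_def hresult_def vresult_def mem_flip mem_Collect_eq 2 by blast
qed

text \<open>The particles passed by a vertical move are the holes passed by the corresponding
  horizontal move of the conjugate. This fits the convention that spins of vertical strips count
  rows of the original shape.\<close>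

lemma vspin_eq_hcospin: "vspin n K N = hcospin n (reflect K) (flip n N)"
proof -
  have "card {d \<in> {c - int n<..<c}. d \<in> K \<and> d \<notin> N} =
    card {d \<in> {int n + 1 - c - int n<..<int n + 1 - c}. \<not> (d \<in> reflect K \<or> d + int n \<in> flip n N)}" for c
    by (rule bij_betw_same_card, rule bij_betw_byWitness [where f = "\<lambda>d. 1 - d" and f' = "\<lambda>d. 1 - d"])
      (auto simp: reflect_def mem_flip algebra_simps)
  then show ?thesis
    unfolding vspin_def hcospin_def flip_def
    by (subst sum.reindex [OF inj_flip]) (simp add: flip_def [symmetric])
qed

lemma remove_ribbon_conjugate:
  assumes n: "n \<ge> 1" and "remove_ribbon n lam mu"
  shows "remove_ribbon n (conjugate lam) (conjugate mu)"
proof -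
  obtain c where c: "c \<in> columns lam" "c - int n \<notin> columns lam" "columns mu = move n c (columns lam)"
    using remove_ribbon_obtains_move [OF assms] .
  show ?thesis
  proof (rule remove_ribbon_move [OF n])
    show "int n + 1 - c \<in> columns (conjugate lam)" "int n + 1 - c - int n \<notin> columns (conjugate lam)"
      using c by (simp_all add: columns_conjugate)
    have "1 - d \<notin> move n c (columns lam) \<longleftrightarrow> d \<in> move n (int n + 1 - c) {c. 1 - c \<notin> columns lam}" for d
    proof -
      have "1 - d = c \<longleftrightarrow> d = 1 - c" "1 - d = c - int n \<longleftrightarrow> d = int n + 1 - c"
        by auto
      then show ?thesis
        using n c by (auto simp: move_def)
    qed
    then show "columns (conjugate mu) = move n (int n + 1 - c) (columns (conjugate lam))"
      unfolding columns_conjugate c(3) by blast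
  qed
qed

lemma remove_ribbons_conjugate:
  assumes "n \<ge> 1" "(remove_ribbon n)\<^sup>*\<^sup>* lam mu"
  shows "(remove_ribbon n)\<^sup>*\<^sup>* (conjugate lam) (conjugate mu)"
  using assms(2)
  by induction (auto intro: rtranclp.rtrancl_into_rtrancl remove_ribbon_conjugate [OF assms(1)])

text \<open>Everything is transported from the conjugate shapes. Only the spin changes its form: the
  ribbons of the conjugate have to be transposed back, which is why the column counts
  \<open>hcospin\<close> appear.\<close>

lemma vertical_stripD:
  assumes n: "n \<ge> 1" and "vertical_strip n lam mu"
  obtains N where "vmoves n (columns lam) N" "columns mu = vresult n (columns lam) N"
    "vertical_spin n lam mu = vspin n (columns lam) N"
    "card (diagram lam - diagram mu) = n * card N" "(remove_ribbon n)\<^sup>*\<^sup>* lam mu"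
proof -
  let ?sw = "(`) (prod.swap :: box \<Rightarrow> box)"
  have swsw: "?sw (?sw R) = R" for R
    by (simp add: image_image)
  then have inj: "inj_on ?sw A" for A
    by (metis inj_onI)
  obtain D where D: "vertical_decomposition n lam mu D"
    using assms(2) by (auto simp: vertical_strip_def)
  then have hD: "horizontal_decomposition n (conjugate lam) (conjugate mu) (?sw ` D)"
    by (simp add: vertical_decomposition_def)
  have the: "(THE D. vertical_decomposition n lam mu D) = D"
  proof (rule the_equality)
    show "vertical_decomposition n lam mu D"
      by (rule D)
  next
    fix D' assume "vertical_decomposition n lam mu D'"
    then have "?sw ` D' = ?sw ` D"
      unfolding vertical_decomposition_def by (rule horizontal_decomposition_unique [OF n _ hD])
    then show "D' = D"
      by (simp only: inj_image_eq_iff [OF inj])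
  qed
  from horizontal_decomposition_hmoves [OF n hD] obtain M where
    M: "hmoves n (columns (conjugate lam)) M" "columns (conjugate mu) = hresult n (columns (conjugate lam)) M"
      "(\<Sum>R\<in>?sw ` D. ribbon_spin (?sw R)) = hcospin n (columns (conjugate lam)) M"
      "card (diagram (conjugate lam) - diagram (conjugate mu)) = n * card M"
      "(remove_ribbon n)\<^sup>*\<^sup>* (conjugate lam) (conjugate mu)"
    by blast
  define N where "N = flip n M"
  have M_eq: "M = flip n N"
    by (simp add: N_def flip_flip)
  have v: "vmoves n (columns lam) N"
    using M(1) by (simp add: vmoves_iff_hmoves columns_conjugate_reflect M_eq)
  have "reflect (columns mu) = reflect (vresult n (columns lam) N)"
    using M(2) by (simp add: vresult_eq_hresult [OF v] columns_conjugate_reflect M_eq)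
  then have "columns mu = vresult n (columns lam) N"
    by (metis reflect_reflect)
  moreover have "(\<Sum>R\<in>?sw ` D. ribbon_spin (?sw R)) = (\<Sum>R\<in>D. ribbon_spin R)"
    unfolding sum.reindex [OF inj] o_def swsw ..
  then have "vertical_spin n lam mu = vspin n (columns lam) N"
    using M(3) unfolding vertical_spin_def the vspin_eq_hcospin columns_conjugate_reflect M_eq by simp
  moreover have "card (diagram lam - diagram mu) = n * card N"
  proof -
    have "diagram (conjugate lam) - diagram (conjugate mu) = ?sw (diagram lam - diagram mu)"
      by (auto simp: diagram_conjugate)
    then have "card (diagram (conjugate lam) - diagram (conjugate mu)) = card (diagram lam - diagram mu)"
      by (simp add: card_image)
    then show ?thesis
      using M(4) by (simp add: M_eq card_flip)
  qed
  moreover have "(remove_ribbon n)\<^sup>*\<^sup>* lam mu"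
    using remove_ribbons_conjugate [OF n M(5)] by (simp add: conjugate_conjugate)
  ultimately show ?thesis
    using that v by blast
qed

lemma vmoves_strip:
  assumes n: "n \<ge> 1" and v: "vmoves n (columns lam) N"
  obtains mu where "columns mu = vresult n (columns lam) N" "vertical_strip n lam mu"
proof -
  let ?sw = "(`) (prod.swap :: box \<Rightarrow> box)"
  have "hmoves n (columns (conjugate lam)) (flip n N)"
    using v by (simp add: vmoves_iff_hmoves columns_conjugate_reflect)
  from hmoves_horizontal_decomposition [OF n this] obtain mu D where
    mu: "columns mu = hresult n (columns (conjugate lam)) (flip n N)"
    and D: "horizontal_decomposition n (conjugate lam) mu D"
    by blast
  have "reflect (columns mu) = vresult n (columns lam) N"
    using mu vresult_eq_hresult [OF v] by (metis columns_conjugate_reflect reflect_reflect)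
  then have "columns (conjugate mu) = vresult n (columns lam) N"
    by (simp add: columns_conjugate_reflect)
  moreover have "?sw ` (?sw ` D) = D"
    by (simp add: image_image)
  then have "vertical_decomposition n lam (conjugate mu) (?sw ` D)"
    using D by (simp add: vertical_decomposition_def conjugate_conjugate)
  ultimately show ?thesis
    using that by (auto simp: vertical_strip_def)
qed

lemma vmoves_unique:
  assumes "n \<ge> 1" "vmoves n K N" "vmoves n K N'" "vresult n K N = vresult n K N'"
  shows "N = N'"
proof -
  have "flip n N = flip n N'"
  proof (rule hmoves_unique [OF assms(1)])
    show "hmoves n (reflect K) (flip n N)" "hmoves n (reflect K) (flip n N')"
      using assms(2,3) unfolding vmoves_iff_hmoves by blast+
    show "hresult n (reflect K) (flip n N) = hresult n (reflect K) (flip n N')"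
      using vresult_eq_hresult [OF assms(2)] vresult_eq_hresult [OF assms(3)] assms(4) by metis
  qed
  then show ?thesis
    by (metis flip_flip)
qed

section \<open>Existence and invariance of the n-core\<close>

lemma remove_ribbon_diamond:
  assumes n: "n \<ge> 1" and "remove_ribbon n lam a" "remove_ribbon n lam b" "a \<noteq> b"
  obtains d where "remove_ribbon n a d" "remove_ribbon n b d"
proof -
  let ?S = "columns lam"
  obtain x where x: "x \<in> ?S" "x - int n \<notin> ?S" "columns a = move n x ?S"
    using remove_ribbon_obtains_move [OF n assms(2)] .
  obtain y where y: "y \<in> ?S" "y - int n \<notin> ?S" "columns b = move n y ?S"
    using remove_ribbon_obtains_move [OF n assms(3)] .
  have "x \<noteq> y"
    using x(3) y(3) assms(4) columns_inject by metis
  \<comment> \<open>Distinct starts have distinct targets, so each of the two moves stays possible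
    after the other.\<close>
  have ya: "y \<in> columns a" "y - int n \<notin> columns a"
    using x y \<open>x \<noteq> y\<close> by (auto simp: move_def)
  have xb: "x \<in> columns b" "x - int n \<notin> columns b"
    using x y \<open>x \<noteq> y\<close> by (auto simp: move_def)
  have "move n y (columns a) = move n x (columns b)"
    using x y \<open>x \<noteq> y\<close> by (auto simp: move_def)
  moreover obtain d where "columns d = move n y (columns a)"
    using move_obtains_partition [OF n ya] .
  ultimately show ?thesis
    using that remove_ribbon_move [OF n ya] remove_ribbon_move [OF n xb] by metis
qed

lemma remove_ribbon_card:
  assumes "n \<ge> 1" "remove_ribbon n lam mu"
  shows "card (diagram mu) < card (diagram lam)"
proof (rule psubset_card_mono [OF finite_diagram])
  have "card (diagram lam - diagram mu) = n"
    using assms(2) by (simp add: remove_ribbon_def ribbon_def)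
  then have "diagram lam - diagram mu \<noteq> {}"
    using assms(1) by (metis card.empty not_one_le_zero)
  then show "diagram mu \<subset> diagram lam"
    using assms(2) by (auto simp: remove_ribbon_def)
qed

lemma remove_ribbons_subset:
  "(remove_ribbon n)\<^sup>*\<^sup>* lam mu \<Longrightarrow> diagram mu \<subseteq> diagram lam"
  by (induction rule: rtranclp_induct) (auto simp: remove_ribbon_def)

text \<open>Confluence by induction on the size. If a chain begins with another ribbon than the
  chosen one, the diamond joins the two branches; their normal forms then reach each other, hence
  every partition on one branch reaches the normal form of the other.\<close>

lemma remove_ribbon_normal_form:
  assumes n: "n \<ge> 1"
  shows "\<exists>\<rho>. (remove_ribbon n)\<^sup>*\<^sup>* lam \<rho> \<and>
    (\<forall>\<kappa>. (remove_ribbon n)\<^sup>*\<^sup>* lam \<kappa> \<longrightarrow> (remove_ribbon n)\<^sup>*\<^sup>* \<kappa> \<rho>)"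
proof (induction "card (diagram lam)" arbitrary: lam rule: less_induct)
  case less
  let ?r = "remove_ribbon n"
  show ?case
  proof (cases "\<exists>a. ?r lam a")
    case False
    then have "\<kappa> = lam" if "?r\<^sup>*\<^sup>* lam \<kappa>" for \<kappa>
      using that by (metis converse_rtranclpE)
    then show ?thesis
      by blast
  next
    case True
    then obtain a where a: "?r lam a"
      by blast
    obtain \<rho> where \<rho>: "?r\<^sup>*\<^sup>* a \<rho>" "\<And>\<kappa>. ?r\<^sup>*\<^sup>* a \<kappa> \<Longrightarrow> ?r\<^sup>*\<^sup>* \<kappa> \<rho>"
      using less [OF remove_ribbon_card [OF n a]] by blast
    have lam_\<rho>: "?r\<^sup>*\<^sup>* lam \<rho>"
      using a \<rho>(1) by (rule converse_rtranclp_into_rtranclp)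
    have "?r\<^sup>*\<^sup>* \<kappa> \<rho>" if "?r\<^sup>*\<^sup>* lam \<kappa>" for \<kappa>
      using that
    proof (cases rule: converse_rtranclpE)
      case base
      with lam_\<rho> show ?thesis by simp
    next
      case (step b)
      show ?thesis
      proof (cases "a = b")
        case True
        then show ?thesis
          using step \<rho> by blast
      next
        case False
        obtain d where d: "?r a d" "?r b d"
          using remove_ribbon_diamond [OF n a step(1) False] .
        obtain \<rho>' where \<rho>': "\<And>\<kappa>. ?r\<^sup>*\<^sup>* b \<kappa> \<Longrightarrow> ?r\<^sup>*\<^sup>* \<kappa> \<rho>'"
          using less [OF remove_ribbon_card [OF n step(1)]] by blast
        have "?r\<^sup>*\<^sup>* d \<rho>"
          using d(1) by (intro \<rho>(2)) blast
        then have "?r\<^sup>*\<^sup>* b \<rho>"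
          by (rule converse_rtranclp_into_rtranclp [where r = ?r, OF d(2)])
        then have "?r\<^sup>*\<^sup>* \<rho> \<rho>'"
          by (rule \<rho>')
        then have "?r\<^sup>*\<^sup>* \<rho>' \<rho>"
          by (rule \<rho>(2) [OF rtranclp_trans [OF \<rho>(1)]])
        then show ?thesis
          by (rule rtranclp_trans [OF \<rho>' [OF step(2)]])
      qed
    qed
    then show ?thesis
      using lam_\<rho> by blast
  qed
qed

text \<open>The normal form is reachable from every partition below it in the process, so it is
  contained in all of them and is the smallest one. A partition reachable from \<open>lam\<close>
  has the same normal form.\<close>

lemma n_core_eq:
  assumes n: "n \<ge> 1" and "(remove_ribbon n)\<^sup>*\<^sup>* lam mu"
  shows "n_core n lam = n_core n mu"
proof -
  obtain \<rho> where \<rho>: "(remove_ribbon n)\<^sup>*\<^sup>* lam \<rho>"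
    "\<And>\<kappa>. (remove_ribbon n)\<^sup>*\<^sup>* lam \<kappa> \<Longrightarrow> (remove_ribbon n)\<^sup>*\<^sup>* \<kappa> \<rho>"
    using remove_ribbon_normal_form [OF n] by blast
  have core: "n_core n \<nu> = \<rho>" if "(remove_ribbon n)\<^sup>*\<^sup>* \<nu> \<rho>"
    "\<And>\<kappa>. (remove_ribbon n)\<^sup>*\<^sup>* \<nu> \<kappa> \<Longrightarrow> (remove_ribbon n)\<^sup>*\<^sup>* \<kappa> \<rho>" for \<nu>
    unfolding n_core_def
  proof (rule the_equality)
    show "(remove_ribbon n)\<^sup>*\<^sup>* \<nu> \<rho> \<and> (\<forall>\<kappa>. (remove_ribbon n)\<^sup>*\<^sup>* \<nu> \<kappa> \<longrightarrow> diagram \<rho> \<subseteq> diagram \<kappa>)"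
      using that remove_ribbons_subset by blast
  next
    fix \<rho>' assume *: "(remove_ribbon n)\<^sup>*\<^sup>* \<nu> \<rho>' \<and> (\<forall>\<kappa>. (remove_ribbon n)\<^sup>*\<^sup>* \<nu> \<kappa> \<longrightarrow> diagram \<rho>' \<subseteq> diagram \<kappa>)"
    then have "diagram \<rho>' \<subseteq> diagram \<rho>" "diagram \<rho> \<subseteq> diagram \<rho>'"
      using that remove_ribbons_subset by blast+
    then show "\<rho>' = \<rho>"
      by (intro diagram_inject) blast
  qed
  have "n_core n lam = \<rho>"
    by (rule core) (use \<rho> in blast)+
  moreover have "n_core n mu = \<rho>"
    by (rule core) (use \<rho>(2) assms(2) rtranclp_trans in metis)+
  ultimately show ?thesis
    by simp
qed

section \<open>Super ribbon functions\<close>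

definition strip_pairs :: "nat \<Rightarrow> partition \<Rightarrow> partition \<Rightarrow> partition set" where
  "strip_pairs n lam mu = {\<kappa>. horizontal_strip n lam \<kappa> \<and> vertical_strip n \<kappa> mu}"

definition strip_weight :: "nat \<Rightarrow> complex \<Rightarrow> complex \<Rightarrow> partition \<Rightarrow> partition \<Rightarrow> partition \<Rightarrow> complex" where
  "strip_weight n t Z lam \<kappa> mu =
     t ^ (horizontal_spin n lam \<kappa> + vertical_spin n \<kappa> mu) *
     Z ^ (card (diagram lam - diagram \<kappa>) div n) * (- (t\<^sup>2 * Z)) ^ (card (diagram \<kappa> - diagram mu) div n)"

text \<open>The intermediate partition and the pair of move sets determine each other, because a set
  of moves is determined by its initial and final configuration.\<close>

lemma sum_strip_weight:
  assumes n: "n \<ge> 1" and t: "t \<noteq> 0"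
  shows "(\<Sum>\<kappa>\<in>strip_pairs n lam mu. strip_weight n t Z lam \<kappa> mu) = ice n t Z (columns lam) (columns mu)"
proof -
  let ?S = "columns lam" and ?U = "columns mu"
  let ?P = "{(M, N). hmoves n ?S M \<and> vmoves n (hresult n ?S M) N \<and> vresult n (hresult n ?S M) N = ?U}"
  \<comment> \<open>The second component does not enter, since the horizontal moves alone produce
    the intermediate partition. The choice is harmless because columns determine a
    partition.\<close>
  define kap where "kap = (\<lambda>(M, N :: int set). SOME \<kappa>. columns \<kappa> = hresult n ?S M)"
  have kap: "columns (kap (M, N)) = hresult n ?S M \<and> horizontal_strip n lam (kap (M, N))"
    if hm: "hmoves n ?S M" for M N
  proof -
    obtain \<kappa> where \<kappa>: "columns \<kappa> = hresult n ?S M" "horizontal_strip n lam \<kappa>"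
      using hmoves_strip [OF n hm] .
    then have "columns (kap (M, N)) = hresult n ?S M"
      unfolding kap_def prod.case by (rule_tac someI [of "\<lambda>\<kappa>. columns \<kappa> = hresult n ?S M"])
    then show ?thesis
      using \<kappa> columns_inject by metis
  qed
  have inj: "inj_on kap ?P"
  proof (rule inj_onI)
    fix p p' assume p: "p \<in> ?P" "p' \<in> ?P" and eq: "kap p = kap p'"
    obtain M N M' N' where pp: "p = (M, N)" "p' = (M', N')"
      by (metis surj_pair)
    then have *: "hmoves n ?S M" "vmoves n (hresult n ?S M) N" "vresult n (hresult n ?S M) N = ?U"
      "hmoves n ?S M'" "vmoves n (hresult n ?S M') N'" "vresult n (hresult n ?S M') N' = ?U"
      using p by simp_all
    have "hresult n ?S M = hresult n ?S M'"
      using kap [OF *(1), of N] kap [OF *(4), of N'] eq pp by simp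
    then have M: "M = M'"
      by (rule hmoves_unique [OF n *(1,4)])
    then have "N = N'"
      using *(2,3,5,6) vmoves_unique [OF n, of "hresult n ?S M" N N'] by simp
    with M show "p = p'"
      by (simp add: pp)
  qed
  have image: "kap ` ?P = strip_pairs n lam mu"
  proof (intro equalityI subsetI)
    fix \<kappa> assume "\<kappa> \<in> kap ` ?P"
    then obtain M N where MN: "\<kappa> = kap (M, N)" "hmoves n ?S M" "vmoves n (hresult n ?S M) N"
      "vresult n (hresult n ?S M) N = ?U"
      by blast
    have \<kappa>: "columns \<kappa> = hresult n ?S M" "horizontal_strip n lam \<kappa>"
      using kap [OF MN(2), of N] MN(1) by simp_all
    have "vmoves n (columns \<kappa>) N"
      using MN(3) \<kappa>(1) by simp
    then obtain mu' where "columns mu' = vresult n (columns \<kappa>) N" "vertical_strip n \<kappa> mu'"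
      using vmoves_strip [OF n] by metis
    moreover from this have "mu' = mu"
      using MN(4) \<kappa>(1) by (intro columns_inject) simp
    ultimately show "\<kappa> \<in> strip_pairs n lam mu"
      using \<kappa>(2) by (simp add: strip_pairs_def)
  next
    fix \<kappa> assume "\<kappa> \<in> strip_pairs n lam mu"
    then have h: "horizontal_strip n lam \<kappa>" and v: "vertical_strip n \<kappa> mu"
      by (simp_all add: strip_pairs_def)
    obtain M where M: "hmoves n ?S M" "columns \<kappa> = hresult n ?S M"
      using horizontal_stripD [OF n h] by metis
    obtain N where N: "vmoves n (columns \<kappa>) N" "?U = vresult n (columns \<kappa>) N"
      using vertical_stripD [OF n v] by metis
    have kap_eq: "kap (M, N) = \<kappa>"
      using kap [OF M(1), of N] M(2) by (intro columns_inject) simp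
    have "(M, N) \<in> ?P"
      using M N by simp
    then show "\<kappa> \<in> kap ` ?P"
      unfolding kap_eq [symmetric] by (rule imageI)
  qed
  have weight: "strip_weight n t Z lam (kap (M, N)) mu = move_weight n t Z ?S M N" if "(M, N) \<in> ?P" for M N
  proof -
    define \<kappa> where "\<kappa> = kap (M, N)"
    have "\<kappa> \<in> strip_pairs n lam mu"
      unfolding \<kappa>_def image [symmetric] using that by (rule imageI)
    then have h: "horizontal_strip n lam \<kappa>" and v: "vertical_strip n \<kappa> mu"
      by (simp_all add: strip_pairs_def)
    have MN: "hmoves n ?S M" "vmoves n (hresult n ?S M) N" "vresult n (hresult n ?S M) N = ?U"
      using that by simp_all
    have \<kappa>: "columns \<kappa> = hresult n ?S M"
      using kap [OF MN(1), of N] by (simp add: \<kappa>_def)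
    obtain M' where M': "hmoves n ?S M'" "columns \<kappa> = hresult n ?S M'" "horizontal_spin n lam \<kappa> = hspin n ?S M'"
      "card (diagram lam - diagram \<kappa>) = n * card M'"
      using horizontal_stripD [OF n h] by metis
    obtain N' where N': "vmoves n (columns \<kappa>) N'" "?U = vresult n (columns \<kappa>) N'"
      "vertical_spin n \<kappa> mu = vspin n (columns \<kappa>) N'" "card (diagram \<kappa> - diagram mu) = n * card N'"
      using vertical_stripD [OF n v] by metis
    have "M' = M"
      using hmoves_unique [OF n M'(1) MN(1)] M'(2) \<kappa> by simp
    moreover have "N' = N"
      using vmoves_unique [OF n N'(1), of N] MN \<kappa> N'(2) by simp
    ultimately show ?thesis
      unfolding \<kappa>_def [symmetric] strip_weight_def move_weight_def
      using n M'(3,4) N'(3,4) \<kappa> by simp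
  qed
  have "(\<Sum>\<kappa>\<in>strip_pairs n lam mu. strip_weight n t Z lam \<kappa> mu) = (\<Sum>p\<in>?P. strip_weight n t Z lam (kap p) mu)"
    unfolding image [symmetric] sum.reindex [OF inj] o_def ..
  also have "\<dots> = (\<Sum>(M, N)\<in>?P. move_weight n t Z ?S M N)"
    using weight by (intro sum.cong refl) (auto simp del: mem_Collect_eq)
  also have "\<dots> = ice n t Z ?S ?U"
    by (rule sum_move_weight [OF n t])
  finally show ?thesis .
qed

text \<open>Here \<open>U\<close> is any set of integers. This is needed for the spins between two
  rows, which a priori need not come from a partition.\<close>

lemma ice_nonzero:
  assumes n: "n \<ge> 1" and t: "t \<noteq> 0" and ne: "ice n t Z (columns lam) U \<noteq> 0"
  obtains mu where "columns mu = U" "(remove_ribbon n)\<^sup>*\<^sup>* lam mu"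
proof -
  let ?S = "columns lam"
  have "{(M, N). hmoves n ?S M \<and> vmoves n (hresult n ?S M) N \<and> vresult n (hresult n ?S M) N = U} \<noteq> {}"
    using ne unfolding sum_move_weight [OF n t, symmetric] by (metis (no_types, lifting) sum.empty)
  then obtain M N where MN: "hmoves n ?S M" "vmoves n (hresult n ?S M) N" "vresult n (hresult n ?S M) N = U"
    by blast
  obtain \<kappa> where \<kappa>: "columns \<kappa> = hresult n ?S M" "horizontal_strip n lam \<kappa>"
    using hmoves_strip [OF n MN(1)] .
  have "vmoves n (columns \<kappa>) N"
    using MN(2) \<kappa>(1) by simp
  then obtain mu where mu: "columns mu = vresult n (columns \<kappa>) N" "vertical_strip n \<kappa> mu"
    using vmoves_strip [OF n] by metis
  have "(remove_ribbon n)\<^sup>*\<^sup>* lam \<kappa>" "(remove_ribbon n)\<^sup>*\<^sup>* \<kappa> mu"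
    using horizontal_stripD [OF n \<kappa>(2)] vertical_stripD [OF n mu(2)] by metis+
  then have "(remove_ribbon n)\<^sup>*\<^sup>* lam mu"
    by (rule rtranclp_trans)
  then show ?thesis
    using that mu(1) MN(3) \<kappa>(1) by simp
qed

lemma ice_columns_nonzero:
  assumes "n \<ge> 1" "t \<noteq> 0" "ice n t Z (columns lam) (columns mu) \<noteq> 0"
  shows "(remove_ribbon n)\<^sup>*\<^sup>* lam mu"
  using ice_nonzero [OF assms] columns_inject by metis

section \<open>Commutation on the level of partitions\<close>

definition subpartitions :: "partition \<Rightarrow> partition set" where
  "subpartitions lam = {\<kappa>. diagram \<kappa> \<subseteq> diagram lam}"

lemma finite_subpartitions: "finite (subpartitions lam)"
proof (rule finite_imageD)
  show "finite (diagram ` subpartitions lam)"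
    by (rule finite_subset [of _ "Pow (diagram lam)"]) (auto simp: subpartitions_def finite_diagram)
  show "inj_on diagram (subpartitions lam)"
    by (rule inj_onI) (rule diagram_inject)
qed

lemma ice_eq_0_unless_subpartition:
  assumes "n \<ge> 1" "t \<noteq> 0" "mu \<notin> subpartitions lam"
  shows "ice n t Z (columns lam) (columns mu) = 0"
proof (rule ccontr)
  assume "ice n t Z (columns lam) (columns mu) \<noteq> 0"
  then have "diagram mu \<subseteq> diagram lam"
    by (intro remove_ribbons_subset [OF ice_columns_nonzero [OF assms(1,2)]])
  with assms(3) show False
    by (simp add: subpartitions_def)
qed

lemma subpartition_columns:
  assumes "\<kappa> \<in> subpartitions lam" and l: "\<And>i. l \<le> i \<Longrightarrow> part lam i = 0"
  shows "d \<le> - int l \<Longrightarrow> d \<in> columns \<kappa>" "d > int (part lam 0) \<Longrightarrow> d \<notin> columns \<kappa>"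
proof -
  have le: "part \<kappa> i \<le> part lam i" for i
  proof (rule ccontr)
    assume "\<not> part \<kappa> i \<le> part lam i"
    then have "(i, part lam i) \<in> diagram \<kappa> - diagram lam"
      by (simp add: diagram_def)
    then show False
      using assms(1) by (auto simp: subpartitions_def)
  qed
  show "d \<in> columns \<kappa>" if "d \<le> - int l"
    unfolding columns_def using that l [of "nat (- d)"] le [of "nat (- d)"]
    by (intro image_eqI [of _ _ "nat (- d)"]) auto
  show "d \<notin> columns \<kappa>" if "d > int (part lam 0)"
  proof
    assume "d \<in> columns \<kappa>"
    then obtain i where "d = int (part \<kappa> i) - int i"
      by (auto simp: columns_def)
    then show False
      using that le [of i] part_antimono [of 0 i lam] by simp
  qed
qed

text \<open>All partitions inside \<open>lam\<close> have the same columns outside a fixed finite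
  window, so the sum over partitions becomes the sum over subsets of the window that defines
  \<open>two_rows\<close>.\<close>

lemma ice_commute:
  assumes n: "n \<ge> 1" and t: "t \<noteq> 0"
  shows "(\<Sum>\<kappa>\<in>subpartitions lam. ice n t Z (columns lam) (columns \<kappa>) * ice n t W (columns \<kappa>) (columns mu)) =
    (\<Sum>\<kappa>\<in>subpartitions lam. ice n t W (columns lam) (columns \<kappa>) * ice n t Z (columns \<kappa>) (columns mu))"
proof (cases "mu \<in> subpartitions lam")
  case False
  have "ice n t Z (columns lam) (columns \<kappa>) * ice n t W (columns \<kappa>) (columns mu) = 0"
    if "\<kappa> \<in> subpartitions lam" for \<kappa> Z W
  proof -
    have "mu \<notin> subpartitions \<kappa>"
      using False that by (auto simp: subpartitions_def)
    then show ?thesis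
      by (simp add: ice_eq_0_unless_subpartition [OF n t])
  qed
  then have "(\<Sum>\<kappa>\<in>subpartitions lam. ice n t Z (columns lam) (columns \<kappa>) * ice n t W (columns \<kappa>) (columns mu)) = 0" for Z W
    by (intro sum.neutral) blast
  then show ?thesis
    by metis
next
  case True
  have "finite {i. part lam i \<noteq> 0}"
    using part [of lam] by simp
  then obtain l where "\<And>i. i \<in> {i. part lam i \<noteq> 0} \<Longrightarrow> i < l"
    using finite_nat_set_iff_bounded by auto
  then have l: "part lam i = 0" if "l \<le> i" for i
    using that by (metis (mono_tags) leD mem_Collect_eq)
  define c where "c = int (part lam 0)"
  define N where "N = part lam 0 + l"
  have cN: "c - int N = - int l"
    by (simp add: c_def N_def)
  let ?win = "{c - int N<..c}"
  have low: "d \<in> columns \<kappa>" if "\<kappa> \<in> subpartitions lam" "d \<le> c - int N" for \<kappa> d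
    using that unfolding cN by (intro subpartition_columns(1) [where lam = lam and l = l]) (simp_all add: l)
  have high: "d \<notin> columns \<kappa>" if "\<kappa> \<in> subpartitions lam" "d > c" for \<kappa> d
    using that unfolding c_def by (intro subpartition_columns(2) [where lam = lam and l = l]) (simp_all add: l)
  have lam_sub: "lam \<in> subpartitions lam"
    by (simp add: subpartitions_def)
  have row: "row n t Z (columns \<kappa>) (columns \<kappa>') c N 0 = ice n t Z (columns \<kappa>) (columns \<kappa>')"
    if "\<kappa> \<in> subpartitions lam" "\<kappa>' \<in> subpartitions lam" for \<kappa> \<kappa>' Z
  proof (rule row_eq_ice [OF n])
    fix d assume "d \<notin> ?win"
    then have "d \<le> c - int N \<or> c < d"
      by auto
    then show "d \<in> columns \<kappa> \<longleftrightarrow> d \<in> columns \<kappa>'"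
      using low [OF that(1)] low [OF that(2)] high [OF that(1)] high [OF that(2)] by blast
  qed (use low [OF that(1)] high [OF that(1)] in auto)
  have transfer: "(\<Sum>\<kappa>\<in>subpartitions lam. ice n t Z (columns lam) (columns \<kappa>) * ice n t W (columns \<kappa>) (columns mu)) =
     two_rows n t Z W (columns lam) (columns mu) c N 0 0" for Z W
  proof -
    let ?f = "\<lambda>B. row n t Z (columns lam) B c N 0 * row n t W B (columns mu) c N 0"
    let ?w = "\<lambda>\<kappa>. columns \<kappa> \<inter> ?win"
    have restrict: "?f (?w \<kappa>) = ?f (columns \<kappa>)" for \<kappa>
      by (intro arg_cong2 [where f = "(*)"] row_cong) auto
    have inj: "inj_on ?w (subpartitions lam)"
    proof (rule inj_onI)
      fix \<kappa> \<kappa>' assume \<kappa>: "\<kappa> \<in> subpartitions lam" "\<kappa>' \<in> subpartitions lam" and eq: "?w \<kappa> = ?w \<kappa>'"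
      have "d \<in> columns \<kappa> \<longleftrightarrow> d \<in> columns \<kappa>'" for d
      proof (cases "d \<in> ?win")
        case True
        then show ?thesis
          using eq by blast
      next
        case False
        then have "d \<le> c - int N \<or> c < d"
          by auto
        then show ?thesis
          using low [OF \<kappa>(1)] low [OF \<kappa>(2)] high [OF \<kappa>(1)] high [OF \<kappa>(2)] by blast
      qed
      then show "\<kappa> = \<kappa>'"
        by (intro columns_inject) blast
    qed
    have outside: "?f B = 0" if "B \<in> Pow ?win - ?w ` subpartitions lam" for B
    proof (rule ccontr)
      assume "?f B \<noteq> 0"
      then have ne: "row n t Z (columns lam) B c N 0 \<noteq> 0"
        by auto
      \<comment> \<open>Below the window every column must be occupied; with these columns added, a
        nonzero row becomes a nonzero ice entry and \<open>B\<close> turns out to come from a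
        partition inside \<open>lam\<close>.\<close>
      let ?B = "B \<union> {..c - int N}"
      have "row n t Z (columns lam) ?B c N 0 = row n t Z (columns lam) B c N 0"
        by (rule row_cong) auto
      moreover have "row n t Z (columns lam) ?B c N 0 = ice n t Z (columns lam) ?B"
      proof (rule row_eq_ice [OF n])
        fix d assume "d \<notin> ?win"
        then have "d \<le> c - int N \<or> c < d"
          by auto
        then show "d \<in> columns lam \<longleftrightarrow> d \<in> ?B"
          using low [OF lam_sub] high [OF lam_sub] that by fastforce
      qed (use low [OF lam_sub] high [OF lam_sub] in auto)
      ultimately have "ice n t Z (columns lam) ?B \<noteq> 0"
        using ne by simp
      then obtain \<kappa> where \<kappa>: "columns \<kappa> = ?B" "(remove_ribbon n)\<^sup>*\<^sup>* lam \<kappa>"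
        using ice_nonzero [OF n t] by metis
      have "\<kappa> \<in> subpartitions lam"
        using remove_ribbons_subset [OF \<kappa>(2)] by (simp add: subpartitions_def)
      moreover have "?w \<kappa> = B"
        using that unfolding \<kappa>(1) by auto
      ultimately show False
        using that by blast
    qed
    have "two_rows n t Z W (columns lam) (columns mu) c N 0 0 = (\<Sum>B\<in>Pow ?win. ?f B)"
      by (rule sum_row_row_eq_two_rows [symmetric])
    also have "\<dots> = (\<Sum>B\<in>?w ` subpartitions lam. ?f B)"
      by (rule sum.mono_neutral_right) (use outside in auto)
    also have "\<dots> = (\<Sum>\<kappa>\<in>subpartitions lam. ?f (columns \<kappa>))"
      unfolding sum.reindex [OF inj] o_def restrict ..
    also have "\<dots> = (\<Sum>\<kappa>\<in>subpartitions lam. ice n t Z (columns lam) (columns \<kappa>) * ice n t W (columns \<kappa>) (columns mu))"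
      by (intro sum.cong refl) (simp add: row lam_sub True)
    finally show ?thesis ..
  qed
  show ?thesis
    unfolding transfer by (rule two_rows_commute [OF n])
qed

section \<open>Products of transfer matrices\<close>

lemma lookup_delta_transfer:
  assumes n: "n \<ge> 1" and q: "q \<noteq> 0"
  shows "Poly_Mapping.lookup (delta_transfer n q z x) mu =
    (\<Sum>lam\<in>Poly_Mapping.keys x. Poly_Mapping.lookup x lam * delta_entry n q z mu lam)"
proof -
  have "Poly_Mapping.lookup (Sum_any (\<lambda>\<kappa>. Poly_Mapping.single \<kappa> (a * delta_entry n q z \<kappa> lam))) mu =
      a * delta_entry n q z mu lam" for a lam
  proof -
    have sup: "{\<kappa>. Poly_Mapping.single \<kappa> (a * delta_entry n q z \<kappa> lam) \<noteq> 0} \<subseteq> insert mu (subpartitions lam)"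
      using ice_eq_0_unless_subpartition [OF n, of "- q"] q
      by (auto simp: delta_entry_eq_ice [OF n])
    show ?thesis
      unfolding Sum_any.expand_superset [OF _ sup, simplified finite_insert finite_subpartitions, OF TrueI]
      by (simp add: lookup_sum lookup_single when_def finite_subpartitions)
  qed
  then show ?thesis
    by (simp add: delta_transfer_def lookup_sum)
qed

lemma metaplectic_function_Nil: "metaplectic_function n q lam mu [] = of_bool (lam = mu)"
  by (simp add: metaplectic_function_def ket_def lookup_single when_def)

lemma metaplectic_function_Cons_keys:
  assumes "n \<ge> 1" "q \<noteq> 0"
  shows "metaplectic_function n q lam mu (z # zs) =
    (\<Sum>\<kappa> | metaplectic_function n q lam \<kappa> zs \<noteq> 0.
       metaplectic_function n q lam \<kappa> zs * ice n (- q) (z ^ n) (columns \<kappa>) (columns mu))"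
proof -
  have keys: "Poly_Mapping.keys x = {\<kappa>. Poly_Mapping.lookup x \<kappa> \<noteq> 0}" for x :: fock
    by (auto simp: in_keys_iff)
  show ?thesis
    by (simp add: metaplectic_function_def lookup_delta_transfer [OF assms] keys delta_entry_eq_ice [OF assms(1)])
qed

lemma metaplectic_function_nonzero:
  assumes n: "n \<ge> 1" and q: "q \<noteq> 0" and "metaplectic_function n q lam mu zs \<noteq> 0"
  shows "(remove_ribbon n)\<^sup>*\<^sup>* lam mu"
  using assms(3)
proof (induction zs arbitrary: mu)
  case Nil
  then show ?case
    by (simp add: metaplectic_function_Nil split: if_splits)
next
  case (Cons z zs)
  obtain \<kappa> where "metaplectic_function n q lam \<kappa> zs \<noteq> 0" "ice n (- q) (z ^ n) (columns \<kappa>) (columns mu) \<noteq> 0"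
    using sum.not_neutral_contains_not_neutral [OF Cons.prems [unfolded metaplectic_function_Cons_keys [OF n q]]]
    by auto
  then have "(remove_ribbon n)\<^sup>*\<^sup>* lam \<kappa>" "(remove_ribbon n)\<^sup>*\<^sup>* \<kappa> mu"
    using Cons.IH ice_columns_nonzero [OF n, of "- q"] q by simp_all
  then show ?case
    by (rule rtranclp_trans)
qed

text \<open>The index set may be any finite superset, so that a single set serves for all partitions
  inside a given one.\<close>

lemma metaplectic_function_Cons:
  assumes n: "n \<ge> 1" and q: "q \<noteq> 0" and "subpartitions lam \<subseteq> Q" "finite Q"
  shows "metaplectic_function n q lam mu (z # zs) =
    (\<Sum>\<kappa>\<in>Q. metaplectic_function n q lam \<kappa> zs * ice n (- q) (z ^ n) (columns \<kappa>) (columns mu))"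
  unfolding metaplectic_function_Cons_keys [OF n q]
proof (rule sum.mono_neutral_left)
  have "\<kappa> \<in> subpartitions lam" if "metaplectic_function n q lam \<kappa> zs \<noteq> 0" for \<kappa>
    using remove_ribbons_subset [OF metaplectic_function_nonzero [OF n q that]] by (simp add: subpartitions_def)
  then show "{\<kappa>. metaplectic_function n q lam \<kappa> zs \<noteq> 0} \<subseteq> Q"
    using assms(3) by blast
qed (use assms(4) in auto)

text \<open>By definition the first parameter acts last. Commutation lets it act first on
  \<open>lam\<close>, as the outermost strips of a tableau require.\<close>

lemma metaplectic_function_Cons_front:
  assumes n: "n \<ge> 1" and q: "q \<noteq> 0"
  shows "metaplectic_function n q lam mu (z # zs) =
    (\<Sum>\<kappa>\<in>subpartitions lam. ice n (- q) (z ^ n) (columns lam) (columns \<kappa>) * metaplectic_function n q \<kappa> mu zs)"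
proof -
  let ?Q = "subpartitions lam"
  let ?E = "\<lambda>z \<kappa> \<kappa>'. ice n (- q) (z ^ n) (columns \<kappa>) (columns \<kappa>')"
  let ?M = "\<lambda>\<kappa> \<kappa>' zs. metaplectic_function n q \<kappa> \<kappa>' zs"
  have fin: "finite ?Q"
    by (rule finite_subpartitions)
  have Cons: "?M \<kappa> mu (z # zs) = (\<Sum>\<kappa>'\<in>?Q. ?M \<kappa> \<kappa>' zs * ?E z \<kappa>' mu)" if "\<kappa> \<in> ?Q" for \<kappa> mu z zs
    using that fin by (intro metaplectic_function_Cons [OF n q]) (auto simp: subpartitions_def)
  \<comment> \<open>The commutation of entries from \<open>\<kappa>'\<close> is known as a sum over
    \<open>subpartitions \<kappa>'\<close>; the other terms of the larger index set vanish.\<close>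
  have comm: "(\<Sum>\<kappa>\<in>?Q. ?E z \<kappa>' \<kappa> * ?E w \<kappa> mu) = (\<Sum>\<kappa>\<in>?Q. ?E w \<kappa>' \<kappa> * ?E z \<kappa> mu)" if "\<kappa>' \<in> ?Q" for \<kappa>' mu z w
  proof -
    have "(\<Sum>\<kappa>\<in>?Q. ?E z \<kappa>' \<kappa> * ?E w \<kappa> mu) = (\<Sum>\<kappa>\<in>subpartitions \<kappa>'. ?E z \<kappa>' \<kappa> * ?E w \<kappa> mu)" for z w
      using that fin q ice_eq_0_unless_subpartition [OF n, of "- q"]
      by (intro sum.mono_neutral_right) (auto simp: subpartitions_def)
    then show ?thesis
      using ice_commute [OF n, where t = "- q" and lam = \<kappa>' and Z = "z ^ n" and W = "w ^ n" and mu = mu] q by simp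
  qed
  have lamQ: "lam \<in> ?Q"
    by (simp add: subpartitions_def)
  show ?thesis
  proof (induction zs arbitrary: mu z)
    case Nil
    have "?M lam mu [z] = (\<Sum>\<kappa>\<in>?Q. if \<kappa> = lam then ?E z \<kappa> mu else 0)"
      unfolding Cons [OF lamQ] metaplectic_function_Nil by (intro sum.cong refl) simp
    also have "\<dots> = ?E z lam mu"
      using lamQ fin by simp
    also have "\<dots> = (\<Sum>\<kappa>\<in>?Q. if \<kappa> = mu then ?E z lam \<kappa> else 0)"
      using fin q ice_eq_0_unless_subpartition [OF n, of "- q" mu lam] by simp
    also have "\<dots> = (\<Sum>\<kappa>\<in>?Q. ?E z lam \<kappa> * ?M \<kappa> mu [])"
      unfolding metaplectic_function_Nil by (intro sum.cong refl) simp
    finally show ?case .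
  next
    \<comment> \<open>The factors of \<open>w\<close> and \<open>z\<close>, which act last, are
      exchanged; the induction hypothesis then moves \<open>z\<close> in front of
      \<open>ws\<close>.\<close>
    case (Cons w ws)
    have "?M lam mu (z # w # ws) = (\<Sum>\<kappa>\<in>?Q. (\<Sum>\<kappa>'\<in>?Q. ?M lam \<kappa>' ws * ?E w \<kappa>' \<kappa>) * ?E z \<kappa> mu)"
      by (simp only: \<open>\<And>zs z mu \<kappa>. \<kappa> \<in> ?Q \<Longrightarrow> ?M \<kappa> mu (z # zs) = _\<close> lamQ)
    also have "\<dots> = (\<Sum>\<kappa>'\<in>?Q. ?M lam \<kappa>' ws * (\<Sum>\<kappa>\<in>?Q. ?E w \<kappa>' \<kappa> * ?E z \<kappa> mu))"
      unfolding sum_distrib_left sum_distrib_right by (subst sum.swap) (simp only: mult.assoc)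
    also have "\<dots> = (\<Sum>\<kappa>'\<in>?Q. ?M lam \<kappa>' ws * (\<Sum>\<kappa>\<in>?Q. ?E z \<kappa>' \<kappa> * ?E w \<kappa> mu))"
      by (intro sum.cong refl arg_cong2 [where f = "(*)"] comm)
    also have "\<dots> = (\<Sum>\<kappa>\<in>?Q. (\<Sum>\<kappa>'\<in>?Q. ?M lam \<kappa>' ws * ?E z \<kappa>' \<kappa>) * ?E w \<kappa> mu)"
      unfolding sum_distrib_left sum_distrib_right by (subst sum.swap) (simp only: mult.assoc)
    also have "\<dots> = (\<Sum>\<kappa>\<in>?Q. ?M lam \<kappa> (z # ws) * ?E w \<kappa> mu)"
      by (simp only: \<open>\<And>zs z mu \<kappa>. \<kappa> \<in> ?Q \<Longrightarrow> ?M \<kappa> mu (z # zs) = _\<close> lamQ)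
    also have "\<dots> = (\<Sum>\<kappa>\<in>?Q. (\<Sum>\<kappa>'\<in>?Q. ?E z lam \<kappa>' * ?M \<kappa>' \<kappa> ws) * ?E w \<kappa> mu)"
      by (simp only: Cons.IH)
    also have "\<dots> = (\<Sum>\<kappa>'\<in>?Q. ?E z lam \<kappa>' * (\<Sum>\<kappa>\<in>?Q. ?M \<kappa>' \<kappa> ws * ?E w \<kappa> mu))"
      unfolding sum_distrib_left sum_distrib_right by (subst sum.swap) (simp only: mult.assoc)
    also have "\<dots> = (\<Sum>\<kappa>'\<in>?Q. ?E z lam \<kappa>' * ?M \<kappa>' mu (w # ws))"
      by (intro sum.cong refl arg_cong2 [where f = "(*)"] \<open>\<And>zs z mu \<kappa>. \<kappa> \<in> ?Q \<Longrightarrow> ?M \<kappa> mu (z # zs) = _\<close> [symmetric])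
    finally show ?case .
  qed
qed

section \<open>Tableaux by removal of the outermost pair of strips\<close>

lemma super_ribbon_tableaux_0:
  "super_ribbon_tableaux n 0 lam mu = (if lam = mu then {[lam]} else {})"
  by (auto simp: super_ribbon_tableaux_def length_Suc_conv)

text \<open>The partition \<open>\<nu>\<close> is already the head of the shorter tableau. It is
  kept as an index so that the sum over tableaux can be split by \<open>\<nu>\<close> and factored
  into a strip part and a tableau part.\<close>

lemma super_ribbon_tableaux_Suc:
  "super_ribbon_tableaux n (Suc r) lam mu =
     (\<lambda>(\<nu>, \<kappa>, T). lam # \<kappa> # T) ` (SIGMA \<nu>:UNIV. strip_pairs n lam \<nu> \<times> super_ribbon_tableaux n r \<nu> mu)"
  (is "?A = ?f ` ?B")
proof (intro equalityI subsetI)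
  fix T assume T: "T \<in> ?A"
  then have len: "length T = Suc (Suc (2 * r + 1))" and "T ! 0 = lam"
    by (simp_all add: super_ribbon_tableaux_def)
  then obtain \<kappa> T' where T_eq: "T = lam # \<kappa> # T'"
    by (metis length_Suc_conv nth_Cons_0)
  have strips: "horizontal_strip n (T ! (2 * i)) (T ! (2 * i + 1)) \<and> vertical_strip n (T ! (2 * i + 1)) (T ! (2 * i + 2))"
    if "i < Suc r" for i
    using T that by (simp add: super_ribbon_tableaux_def)
  have "T' \<in> super_ribbon_tableaux n r (T' ! 0) mu"
    using T strips [of "Suc _"] by (simp add: super_ribbon_tableaux_def T_eq)
  moreover have "\<kappa> \<in> strip_pairs n lam (T' ! 0)"
    using strips [of 0] by (simp add: T_eq strip_pairs_def numeral_2_eq_2)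
  ultimately show "T \<in> ?f ` ?B"
    unfolding T_eq by (intro image_eqI [of _ _ "(T' ! 0, \<kappa>, T')"]) auto
next
  fix T assume "T \<in> ?f ` ?B"
  then obtain \<nu> \<kappa> T' where T: "T = lam # \<kappa> # T'" "\<kappa> \<in> strip_pairs n lam \<nu>" "T' \<in> super_ribbon_tableaux n r \<nu> mu"
    by auto
  have "horizontal_strip n (T ! (2 * i)) (T ! (2 * i + 1)) \<and> vertical_strip n (T ! (2 * i + 1)) (T ! (2 * i + 2))"
    if "i < Suc r" for i
    using that T by (cases i) (auto simp: super_ribbon_tableaux_def strip_pairs_def numeral_2_eq_2)
  then show "T \<in> ?A"
    using T by (auto simp: super_ribbon_tableaux_def)
qed

lemma strip_pairs_subset:
  assumes "n \<ge> 1" "\<kappa> \<in> strip_pairs n lam mu"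
  shows "\<kappa> \<in> subpartitions lam" "mu \<in> subpartitions lam"
proof -
  have h: "horizontal_strip n lam \<kappa>" and v: "vertical_strip n \<kappa> mu"
    using assms(2) by (simp_all add: strip_pairs_def)
  have "(remove_ribbon n)\<^sup>*\<^sup>* lam \<kappa>" "(remove_ribbon n)\<^sup>*\<^sup>* \<kappa> mu"
    using horizontal_stripD [OF assms(1) h] vertical_stripD [OF assms(1) v] by metis+
  then have "diagram \<kappa> \<subseteq> diagram lam" "diagram mu \<subseteq> diagram \<kappa>"
    using remove_ribbons_subset by blast+
  then show "\<kappa> \<in> subpartitions lam" "mu \<in> subpartitions lam"
    by (auto simp: subpartitions_def)
qed

lemma finite_strip_pairs: "n \<ge> 1 \<Longrightarrow> finite (strip_pairs n lam mu)"
  using strip_pairs_subset(1) finite_subpartitions finite_subset by (metis subsetI)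

lemma super_ribbon_tableaux_Suc_subpartitions:
  assumes "n \<ge> 1"
  shows "super_ribbon_tableaux n (Suc r) lam mu =
     (\<lambda>(\<nu>, \<kappa>, T). lam # \<kappa> # T) `
       (SIGMA \<nu>:subpartitions lam. strip_pairs n lam \<nu> \<times> super_ribbon_tableaux n r \<nu> mu)"
  unfolding super_ribbon_tableaux_Suc using strip_pairs_subset(2) [OF assms] by force

lemma finite_super_ribbon_tableaux:
  assumes "n \<ge> 1"
  shows "finite (super_ribbon_tableaux n r lam mu)"
proof (induction r arbitrary: lam)
  case (Suc r)
  show ?case
    unfolding super_ribbon_tableaux_Suc_subpartitions [OF assms]
    using Suc finite_strip_pairs [OF assms] finite_subpartitions
    by (intro finite_imageI finite_SigmaI finite_cartesian_product)
qed (simp add: super_ribbon_tableaux_0)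

definition tableau_weight :: "nat \<Rightarrow> complex \<Rightarrow> complex list \<Rightarrow> partition list \<Rightarrow> complex" where
  "tableau_weight n t Zs T =
     (\<Prod>i<length Zs. strip_weight n t (Zs ! i) (T ! (2 * i)) (T ! (2 * i + 1)) (T ! (2 * i + 2)))"

lemma super_ribbon_function_eq:
  "super_ribbon_function n lam mu Zs (map (\<lambda>Z. t\<^sup>2 * Z) Zs) t =
     (\<Sum>T\<in>super_ribbon_tableaux n (length Zs) lam mu. tableau_weight n t Zs T)"
  unfolding super_ribbon_function_def tableau_weight_def tableau_spin_def tableau_wt_def tableau_wt'_def
    strip_weight_def power_sum prod.distrib by (simp add: mult_ac)

text \<open>For fixed \<open>\<nu>\<close> the choice of the intermediate partition is independent
  of the rest of the tableau, and summing over it produces one ice entry. This is the same recursion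
  as for the transfer matrices with the first parameter in front.\<close>

lemma sum_tableau_weight_Cons:
  assumes n: "n \<ge> 1" and t: "t \<noteq> 0"
  shows "(\<Sum>T\<in>super_ribbon_tableaux n (length (Z # Zs)) lam mu. tableau_weight n t (Z # Zs) T) =
    (\<Sum>\<nu>\<in>subpartitions lam. ice n t Z (columns lam) (columns \<nu>) *
       (\<Sum>T\<in>super_ribbon_tableaux n (length Zs) \<nu> mu. tableau_weight n t Zs T))"
proof -
  let ?tab = "\<lambda>\<nu>. super_ribbon_tableaux n (length Zs) \<nu> mu"
  let ?B = "SIGMA \<nu>:subpartitions lam. strip_pairs n lam \<nu> \<times> ?tab \<nu>"
  have hd: "T ! 0 = \<nu>" if "T \<in> ?tab \<nu>" for \<nu> T
    using that by (simp add: super_ribbon_tableaux_def)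
  have inj: "inj_on (\<lambda>(\<nu>, \<kappa>, T). lam # \<kappa> # T) ?B"
  proof (rule inj_onI)
    fix p p' assume p: "p \<in> ?B" "p' \<in> ?B" and eq: "(case p of (\<nu>, \<kappa>, T) \<Rightarrow> lam # \<kappa> # T) = (case p' of (\<nu>, \<kappa>, T) \<Rightarrow> lam # \<kappa> # T)"
    obtain \<nu> \<kappa> T \<nu>' \<kappa>' T' where pp: "p = (\<nu>, \<kappa>, T)" "p' = (\<nu>', \<kappa>', T')"
      by (metis prod_cases3)
    then show "p = p'"
      using eq p hd [of T \<nu>] hd [of T' \<nu>'] by simp
  qed
  have weight: "tableau_weight n t (Z # Zs) (lam # \<kappa> # T) = strip_weight n t Z lam \<kappa> \<nu> * tableau_weight n t Zs T"
    if "T \<in> ?tab \<nu>" for \<kappa> \<nu> T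
    using hd [OF that]
    by (simp add: tableau_weight_def prod.lessThan_Suc_shift numeral_2_eq_2 del: prod.lessThan_Suc)
  have "(\<Sum>T\<in>super_ribbon_tableaux n (length (Z # Zs)) lam mu. tableau_weight n t (Z # Zs) T) =
      (\<Sum>(\<nu>, \<kappa>, T)\<in>?B. strip_weight n t Z lam \<kappa> \<nu> * tableau_weight n t Zs T)"
    unfolding list.size(4) add_Suc_right add_0_right super_ribbon_tableaux_Suc_subpartitions [OF n] sum.reindex [OF inj] o_def
    by (intro sum.cong refl) (auto simp: weight)
  also have "\<dots> = (\<Sum>\<nu>\<in>subpartitions lam. \<Sum>(\<kappa>, T)\<in>strip_pairs n lam \<nu> \<times> ?tab \<nu>.
      strip_weight n t Z lam \<kappa> \<nu> * tableau_weight n t Zs T)"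
    using finite_strip_pairs [OF n] finite_super_ribbon_tableaux [OF n] finite_subpartitions
    by (subst sum.Sigma) (auto intro!: finite_cartesian_product)
  also have "\<dots> = (\<Sum>\<nu>\<in>subpartitions lam. (\<Sum>\<kappa>\<in>strip_pairs n lam \<nu>. strip_weight n t Z lam \<kappa> \<nu>) *
       (\<Sum>T\<in>?tab \<nu>. tableau_weight n t Zs T))"
    by (simp only: sum_product sum.cartesian_product)
  finally show ?thesis
    unfolding sum_strip_weight [OF n t] .
qed

lemma metaplectic_function_eq_sum_tableau_weight:
  assumes n: "n \<ge> 1" and q: "q \<noteq> 0"
  shows "metaplectic_function n q lam mu zs =
    (\<Sum>T\<in>super_ribbon_tableaux n (length zs) lam mu. tableau_weight n (- q) (map (\<lambda>z. z ^ n) zs) T)"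
proof (induction zs arbitrary: lam)
  case Nil
  then show ?case
    by (simp add: metaplectic_function_Nil super_ribbon_tableaux_0 tableau_weight_def)
next
  case (Cons z zs)
  have "- q \<noteq> 0"
    using q by simp
  from sum_tableau_weight_Cons [OF n this, of "z ^ n" "map (\<lambda>z. z ^ n) zs" lam mu]
  show ?case
    by (simp add: metaplectic_function_Cons_front [OF n q] Cons.IH)
qed

theorem corollary5p9:
  fixes n :: nat and q :: complex and lam mu :: partition and zs :: "complex list"
  assumes "n \<ge> 1"
    and "q \<noteq> 0"
    and "\<And>k :: nat. k > 0 \<Longrightarrow> q ^ k \<noteq> 1"
    and "diagram mu \<subseteq> diagram lam"
  shows "metaplectic_function n q lam mu zs =
           super_ribbon_function n lam mu (map (\<lambda>z. z ^ n) zs) (map (\<lambda>z. q ^ 2 * z ^ n) zs) (- q)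
       \<and> (n_core n lam \<noteq> n_core n mu \<longrightarrow> metaplectic_function n q lam mu zs = 0)"
proof
  have "map (\<lambda>z. q ^ 2 * z ^ n) zs = map (\<lambda>Z. (- q)\<^sup>2 * Z) (map (\<lambda>z. z ^ n) zs)"
    by simp
  note ws = this
  show "metaplectic_function n q lam mu zs =
      super_ribbon_function n lam mu (map (\<lambda>z. z ^ n) zs) (map (\<lambda>z. q ^ 2 * z ^ n) zs) (- q)"
    unfolding ws super_ribbon_function_eq length_map
    by (rule metaplectic_function_eq_sum_tableau_weight [OF assms(1,2)])
  \<comment> \<open>A nonzero entry yields a chain of ribbon removals from \<open>lam\<close> to
    \<open>mu\<close>, along which the core does not change.\<close>
  show "n_core n lam \<noteq> n_core n mu \<longrightarrow> metaplectic_function n q lam mu zs = 0"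
    using metaplectic_function_nonzero [OF assms(1,2)] n_core_eq [OF assms(1)] by blast
qed

end
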